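(* Let $n\geq 5$, let $(M^{2n},J)$ be a connected Kaehler manifold of complex dimension $n$ that is free of flat points, and let $f\colon M^{2n}\to\mathbb{R}^{2n+2}$ be a conformal immersion. Then there is an open dense subset $M_0$ of $M^{2n}$ such that along any connected component $N^{2n}$ of $M_0$ one of the following holds: (i) $f|_N$ is conformally congruent to a real Kaehler submanifold $g\colon N^{2n}\to\mathbb{R}^{2n+2}$. (ii) $f|_N=h\circ g$ is a composition of a real Kaehler hypersurface $g\colon N^{2n}\to\mathbb{R}^{2n+1}$ and a conformal immersion $h\colon V\to\mathbb{R}^{2n+2}$, where $V\subset\mathbb{R}^{2n+1}$ is an open subset with $g(N)\subset V$.
   Context: All manifolds and maps are smooth; $M^{2n}$ has real dimension $2n$ and carries its Kaehler metric $\langle\,,\,\rangle_M$, and open subsets of $M$ carry the restricted Kaehler structure. An immersion $f\colon M\to\mathbb{R}^{m}$ of a Riemannian manifold is conformal if there is a positive function $\lambda\in C^\infty(M)$ such that the metric induced by $f$ is $\lambda^2\langle\,,\,\rangle_M$; open subsets of Euclidean space carry the flat metric. A conformal immersion of a Kaehler manifold into Euclidean space is called a real Kaehler submanifold if $\lambda\equiv 1$, i.e. if it is an isometric immersion of the Kaehler manifold. A real Kaehler hypersurface is a real Kaehler submanifold of codimension one of a Kaehler manifold free of flat points. A flat point is a point at which the curvature tensor of the Kaehler metric vanishes. Two immersions $f,g\colon N\to\mathbb{R}^m$ are conformally congruent if $g=\tau\circ f$ for some conformal (Moebius) transformation $\tau$ of $\mathbb{R}^m$; as usual a Moebius transformation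 may fail to be defined at one point of $\mathbb{R}^m$, and it is required that $\tau$ be defined on $f(N)$. *)

theory Defs
  imports "HOL-Analysis.Analysis"
begin

section \<open>Smooth maps between Euclidean spaces\<close>

fun k_times_differentiable_on ::
  "nat \<Rightarrow> ('e::euclidean_space \<Rightarrow> 'f::real_normed_vector) \<Rightarrow> 'e set \<Rightarrow> bool" where
  "k_times_differentiable_on 0 f S \<longleftrightarrow> continuous_on S f"
| "k_times_differentiable_on (Suc k) f S \<longleftrightarrow>
     (\<forall>x\<in>S. f differentiable (at x)) \<and>
     (\<forall>v. k_times_differentiable_on k (\<lambda>x. frechet_derivative f (at x) v) S)"

text \<open>Only meaningful for open \<open>S\<close>, since the derivatives are taken at \<open>at x\<close>.\<close>

definition smooth_on :: "('e::euclidean_space \<Rightarrow> 'f::real_normed_vector) \<Rightarrow> 'e set \<Rightarrow> bool" where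
  "smooth_on f S \<longleftrightarrow> (\<forall>k. k_times_differentiable_on k f S)"

section \<open>Smooth manifolds\<close>

text \<open>
  A chart is a domain together with a coordinate map. A manifold is the union of the domains of
  an atlas inside a Hausdorff, second countable space; the atlas is not required to be maximal.
\<close>

type_synonym ('a, 'd) chart = "'a set \<times> ('a \<Rightarrow> real^'d)"

definition carrier_of :: "('a, 'd) chart set \<Rightarrow> 'a set" where
  "carrier_of A = (\<Union>(U, \<phi>)\<in>A. U)"

definition smooth_atlas ::
  "('a::{t2_space, second_countable_topology}, 'd::finite) chart set \<Rightarrow> bool" where
  "smooth_atlas A \<longleftrightarrow>
     (\<forall>(U, \<phi>)\<in>A. open U \<and> open (\<phi> ` U) \<and> homeomorphism U (\<phi> ` U) \<phi> (inv_into U \<phi>)) \<and>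
     (\<forall>(U, \<phi>)\<in>A. \<forall>(V, \<psi>)\<in>A. smooth_on (\<psi> \<circ> inv_into U \<phi>) (\<phi> ` (U \<inter> V)))"

definition smooth_map_on ::
  "('a, 'd::finite) chart set \<Rightarrow> 'a set \<Rightarrow> ('a \<Rightarrow> 'f::real_normed_vector) \<Rightarrow> bool" where
  "smooth_map_on A N f \<longleftrightarrow> (\<forall>(U, \<phi>)\<in>A. smooth_on (f \<circ> inv_into U \<phi>) (\<phi> ` (U \<inter> N)))"

section \<open>Riemannian metrics, Levi-Civita connection and curvature\<close>

text \<open>
  A tensor field of rank two is given by its component matrices in every chart of the atlas, as a
  function of the coordinates, subject to the transformation law under change of charts.
\<close>

type_synonym ('a, 'd) tensor2 = "('a, 'd) chart \<Rightarrow> real^'d \<Rightarrow> real^'d^'d"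

definition riemannian_metric ::
  "('a, 'd::finite) chart set \<Rightarrow> ('a, 'd) tensor2 \<Rightarrow> bool" where
  "riemannian_metric A g \<longleftrightarrow>
     (\<forall>(U, \<phi>)\<in>A. smooth_on (g (U, \<phi>)) (\<phi> ` U) \<and>
        (\<forall>x\<in>\<phi> ` U. transpose (g (U, \<phi>) x) = g (U, \<phi>) x \<and>
           (\<forall>v. v \<noteq> 0 \<longrightarrow> v \<bullet> (g (U, \<phi>) x *v v) > 0))) \<and>
     (\<forall>(U, \<phi>)\<in>A. \<forall>(V, \<psi>)\<in>A. \<forall>p\<in>U \<inter> V.
        let D = jacobian (\<psi> \<circ> inv_into U \<phi>) (at (\<phi> p))
        in g (U, \<phi>) (\<phi> p) = transpose D ** g (V, \<psi>) (\<psi> p) ** D)"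

definition partial :: "'d::finite \<Rightarrow> (real^'d \<Rightarrow> real) \<Rightarrow> real^'d \<Rightarrow> real" where
  "partial i F x = frechet_derivative F (at x) (axis i 1)"

text \<open>
  In the following, \<open>G\<close> is the component matrix of a metric in one chart; \<open>christoffel G k i j\<close>
  is the coefficient with upper index \<open>k\<close> and lower indices \<open>i\<close>, \<open>j\<close>.
\<close>

definition christoffel ::
  "(real^'d \<Rightarrow> real^'d^'d) \<Rightarrow> 'd::finite \<Rightarrow> 'd \<Rightarrow> 'd \<Rightarrow> real^'d \<Rightarrow> real" where
  "christoffel G k i j x =
     (\<Sum>l\<in>UNIV. matrix_inv (G x) $ k $ l *
        (partial i (\<lambda>y. G y $ j $ l) x + partial j (\<lambda>y. G y $ i $ l) x
           - partial l (\<lambda>y. G y $ i $ j) x)) / 2"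

text \<open>
  The \<open>l\<close>-th component of \<open>R(\<partial>\<^sub>i, \<partial>\<^sub>j)\<partial>\<^sub>k\<close>, where
  \<open>R(X, Y) = [\<nabla>\<^sub>X, \<nabla>\<^sub>Y] - \<nabla>\<^bsub>[X, Y]\<^esub>\<close>.
\<close>

definition curvature ::
  "(real^'d \<Rightarrow> real^'d^'d) \<Rightarrow> 'd::finite \<Rightarrow> 'd \<Rightarrow> 'd \<Rightarrow> 'd \<Rightarrow> real^'d \<Rightarrow> real" where
  "curvature G l i j k x =
     partial i (christoffel G l j k) x - partial j (christoffel G l i k) x +
     (\<Sum>m\<in>UNIV. christoffel G l i m x * christoffel G m j k x
              - christoffel G l j m x * christoffel G m i k x)"

definition flat_point ::
  "('a, 'd::finite) chart set \<Rightarrow> ('a, 'd) tensor2 \<Rightarrow> 'a \<Rightarrow> bool" where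
  "flat_point A g p \<longleftrightarrow>
     (\<forall>(U, \<phi>)\<in>A. p \<in> U \<longrightarrow> (\<forall>l i j k. curvature (g (U, \<phi>)) l i j k (\<phi> p) = 0))"

section \<open>Kaehler manifolds\<close>

definition almost_complex_structure ::
  "('a, 'd::finite) chart set \<Rightarrow> ('a, 'd) tensor2 \<Rightarrow> bool" where
  "almost_complex_structure A J \<longleftrightarrow>
     (\<forall>(U, \<phi>)\<in>A. smooth_on (J (U, \<phi>)) (\<phi> ` U) \<and>
        (\<forall>x\<in>\<phi> ` U. J (U, \<phi>) x ** J (U, \<phi>) x = - mat 1)) \<and>
     (\<forall>(U, \<phi>)\<in>A. \<forall>(V, \<psi>)\<in>A. \<forall>p\<in>U \<inter> V.
        let D = jacobian (\<psi> \<circ> inv_into U \<phi>) (at (\<phi> p))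
        in D ** J (U, \<phi>) (\<phi> p) = J (V, \<psi>) (\<psi> p) ** D)"

text \<open>The \<open>k\<close>-th component of \<open>(\<nabla>\<^sub>i J) \<partial>\<^sub>j\<close>, where \<open>G\<close> and \<open>Jc\<close> are the components in one chart.\<close>

definition covariant_deriv_endo ::
  "(real^'d \<Rightarrow> real^'d^'d) \<Rightarrow> (real^'d \<Rightarrow> real^'d^'d) \<Rightarrow> 'd::finite \<Rightarrow> 'd \<Rightarrow> 'd \<Rightarrow> real^'d \<Rightarrow> real"
  where
  "covariant_deriv_endo G Jc k i j x =
     partial i (\<lambda>y. Jc y $ k $ j) x +
     (\<Sum>l\<in>UNIV. christoffel G k i l x * Jc x $ l $ j - christoffel G l i j x * Jc x $ k $ l)"

text \<open>\<open>J\<close> is orthogonal and parallel with respect to the Levi-Civita connection.\<close>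

definition kaehler_manifold ::
  "('a::{t2_space, second_countable_topology}, 'd::finite) chart set \<Rightarrow>
   ('a, 'd) tensor2 \<Rightarrow> ('a, 'd) tensor2 \<Rightarrow> bool" where
  "kaehler_manifold A g J \<longleftrightarrow>
     smooth_atlas A \<and> riemannian_metric A g \<and> almost_complex_structure A J \<and>
     (\<forall>(U, \<phi>)\<in>A. \<forall>x\<in>\<phi> ` U.
        transpose (J (U, \<phi>) x) ** g (U, \<phi>) x ** J (U, \<phi>) x = g (U, \<phi>) x \<and>
        (\<forall>k i j. covariant_deriv_endo (g (U, \<phi>)) (J (U, \<phi>)) k i j x = 0))"

section \<open>Conformal immersions\<close>

text \<open>
  In the following predicates, the source is the open subset \<open>N\<close> of the manifold with atlas \<open>A\<close>,
  with the restricted structures.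
\<close>

definition immersion_on ::
  "('a::topological_space, 'd::finite) chart set \<Rightarrow> 'a set \<Rightarrow> ('a \<Rightarrow> real^'m::finite) \<Rightarrow> bool" where
  "immersion_on A N f \<longleftrightarrow>
     open N \<and> N \<subseteq> carrier_of A \<and> smooth_map_on A N f \<and>
     (\<forall>(U, \<phi>)\<in>A. \<forall>p\<in>U \<inter> N. inj (frechet_derivative (f \<circ> inv_into U \<phi>) (at (\<phi> p))))"

definition induced_metric ::
  "('a \<Rightarrow> real^'m::finite) \<Rightarrow> ('a, 'd::finite) tensor2" where
  "induced_metric f = (\<lambda>(U, \<phi>) x.
     let D = jacobian (f \<circ> inv_into U \<phi>) (at x) in transpose D ** D)"

definition conformal_immersion_with_factor ::
  "('a::topological_space, 'd::finite) chart set \<Rightarrow> ('a, 'd) tensor2 \<Rightarrow> 'a set \<Rightarrow>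
   ('a \<Rightarrow> real) \<Rightarrow> ('a \<Rightarrow> real^'m::finite) \<Rightarrow> bool" where
  "conformal_immersion_with_factor A g N lam f \<longleftrightarrow>
     immersion_on A N f \<and> smooth_map_on A N lam \<and> (\<forall>p\<in>N. lam p > 0) \<and>
     (\<forall>(U, \<phi>)\<in>A. \<forall>p\<in>U \<inter> N.
        induced_metric f (U, \<phi>) (\<phi> p) = (lam p)\<^sup>2 *\<^sub>R g (U, \<phi>) (\<phi> p))"

definition conformal_immersion ::
  "('a::topological_space, 'd::finite) chart set \<Rightarrow> ('a, 'd) tensor2 \<Rightarrow> 'a set \<Rightarrow>
   ('a \<Rightarrow> real^'m::finite) \<Rightarrow> bool" where
  "conformal_immersion A g N f \<longleftrightarrow> (\<exists>lam. conformal_immersion_with_factor A g N lam f)"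

text \<open>An open subset \<open>V\<close> of Euclidean space as a manifold with a single chart and its flat metric.\<close>

definition euclidean_atlas :: "(real^'d) set \<Rightarrow> (real^'d, 'd::finite) chart set" where
  "euclidean_atlas V = {(V, \<lambda>x. x)}"

definition flat_metric :: "(real^'d, 'd::finite) tensor2" where
  "flat_metric = (\<lambda>c x. mat 1)"

section \<open>Real Kaehler submanifolds\<close>

definition real_kaehler_submanifold ::
  "('a::{t2_space, second_countable_topology}, 'd::finite) chart set \<Rightarrow>
   ('a, 'd) tensor2 \<Rightarrow> ('a, 'd) tensor2 \<Rightarrow> 'a set \<Rightarrow> ('a \<Rightarrow> real^'m::finite) \<Rightarrow> bool" where
  "real_kaehler_submanifold A g J N f \<longleftrightarrow>
     kaehler_manifold A g J \<and> conformal_immersion_with_factor A g N (\<lambda>p. 1) f"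

definition real_kaehler_hypersurface ::
  "('a::{t2_space, second_countable_topology}, 'd::finite) chart set \<Rightarrow>
   ('a, 'd) tensor2 \<Rightarrow> ('a, 'd) tensor2 \<Rightarrow> 'a set \<Rightarrow> ('a \<Rightarrow> real^'m::finite) \<Rightarrow> bool" where
  "real_kaehler_hypersurface A g J N f \<longleftrightarrow>
     real_kaehler_submanifold A g J N f \<and> CARD('m) = CARD('d) + 1 \<and>
     (\<forall>p\<in>N. \<not> flat_point A g p)"

section \<open>Moebius transformations\<close>

text \<open>
  The one-point compactification of Euclidean space is modelled by \<^typ>\<open>'e option\<close>, with
  \<^const>\<open>None\<close> as the point at infinity. The Moebius group is generated by the reflections in
  hyperplanes and the inversions in spheres.
\<close>

definition hyperplane_reflection ::
  "'e::euclidean_space \<Rightarrow> 'e \<Rightarrow> 'e option \<Rightarrow> 'e option" where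
  "hyperplane_reflection a c = map_option (\<lambda>x. x - (2 * ((x - c) \<bullet> a) / (a \<bullet> a)) *\<^sub>R a)"

definition sphere_inversion ::
  "'e::euclidean_space \<Rightarrow> real \<Rightarrow> 'e option \<Rightarrow> 'e option" where
  "sphere_inversion c r y = (case y of
     None \<Rightarrow> Some c
   | Some x \<Rightarrow> if x = c then None else Some (c + (r\<^sup>2 / (norm (x - c))\<^sup>2) *\<^sub>R (x - c)))"

inductive moebius :: "('e::euclidean_space option \<Rightarrow> 'e option) \<Rightarrow> bool" where
  moebius_id: "moebius (\<lambda>y. y)"
| moebius_reflection: "moebius \<tau> \<Longrightarrow> a \<noteq> 0 \<Longrightarrow> moebius (hyperplane_reflection a c \<circ> \<tau>)"
| moebius_inversion: "moebius \<tau> \<Longrightarrow> r > 0 \<Longrightarrow> moebius (sphere_inversion c r \<circ> \<tau>)"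

text \<open>The transformation is required to be finite on the image of \<open>f\<close>.\<close>

definition conformally_congruent_on ::
  "'a set \<Rightarrow> ('a \<Rightarrow> 'e::euclidean_space) \<Rightarrow> ('a \<Rightarrow> 'e) \<Rightarrow> bool" where
  "conformally_congruent_on N f g \<longleftrightarrow> (\<exists>\<tau>. moebius \<tau> \<and> (\<forall>p\<in>N. \<tau> (Some (f p)) = Some (g p)))"

end

theory Submission imports Defs begin

text \<open>If \<open>f\<close> is conformal with factor \<open>\<lambda>\<close>, then \<open>F = (f, 1, f \<bullet> f / 2) / \<lambda>\<close> is an isometric immersion into
  the light cone of a Lorentz space. Its normal spaces have dimension at most 4 and its second fundamental
  form \<open>\<alpha>\<close> satisfies \<open>\<langle>\<alpha>(X, Y), F\<rangle> = - \<langle>X, Y\<rangle>\<close>. Since \<open>J\<close> is parallel, comparing the Gauss equations of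
  \<open>F\<close> for \<open>(Z, W)\<close> and \<open>(J Z, J W)\<close> shows that \<open>\<beta>(X, Y) = \<alpha>(X, Y) + \<alpha>(J X, J Y)\<close> is flat in the sense of
  Moore. The kernel of \<open>\<beta>\<close> at a regular vector is nonzero, as the complex dimension exceeds 4, and it yields a
  null normal \<open>\<eta>\<close> with \<open>\<langle>\<alpha>, \<eta>\<rangle> = 0\<close> and \<open>\<langle>\<eta>, F\<rangle> = -1\<close>; on an open dense set \<open>\<eta>\<close> can be chosen smoothly.

  If \<open>\<eta>\<close> is locally constant, intersecting the light cone with the affine hyperplane \<open>\<langle>\<eta>, y\<rangle> = -1\<close> is a Moebius
  transformation that makes \<open>f\<close> isometric. Otherwise the Codazzi equation and the absence of flat points force the
  derivative of \<open>\<eta>\<close> to have rank one, so \<open>\<eta> = c \<circ> \<tau>\<close> for a curve \<open>c\<close> in the light cone. Trivialising the bundle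
  \<open>{c, c'}\<^sup>\<bottom> / c\<close> by a parallel frame \<open>E\<close>, the functions \<open>\<langle>F, E i \<circ> \<tau>\<rangle>\<close> define an isometric immersion \<open>g\<close> as a
  hypersurface, and \<open>F\<close> is recovered from \<open>g\<close> because \<open>\<tau>\<close> is determined by \<open>\<langle>F, c'' \<circ> \<tau>\<rangle> = 0\<close>.

  Every nonempty open set thus contains a connected open set on which one of the two alternatives holds, and a
  maximal disjoint family of such sets has dense union.\<close>

section \<open>Directional derivatives and smooth maps\<close>

text \<open>In the light cone Moebius transformations act linearly and the conformal factor
  disappears, at the price of a normal space of dimension (2n + 4) - 2n = 4 with Lorentzian metric,
  where a vector orthogonal to itself need not vanish. The way out is the identity
  \<open>lor (b x y) F = - 2 * G x y\<close>: a kernel vector \<open>t\<close> has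
  \<open>b t t\<close> null but not orthogonal to \<open>F\<close>, so the two span a Lorentz plane
  and only a positive definite plane is left, in which isotropic vectors are zero.

  The bound n >= 5 comes from three counts (\<open>K_nonzero\<close>, \<open>K_off_diag\<close>,
  \<open>second_umbilic\<close>), each of which imposes at most eight real linear conditions on a
  tangent vector and needs 2n > 8.

  Pointwise solutions of linear systems become smooth fields only near points of maximal rank. This
  is why every construction passes to a smaller open set and why the result holds on a dense subset.
  In the hypersurface alternative the parallel frame is moreover constructed only on one side of the
  starting parameter, so the base point has to be moved.\<close>

definition dd :: "'e \<Rightarrow> ('e::euclidean_space \<Rightarrow> 'f::real_normed_vector) \<Rightarrow> 'e \<Rightarrow> 'f" where
  "dd v f x = frechet_derivative f (at x) v"

lemma dd_eq: "(f has_derivative f') (at x) \<Longrightarrow> dd v f x = f' v"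
  using frechet_derivative_at[of f f' x] by (simp add: dd_def)

lemma differentiable_has_dd:
  "f differentiable (at x) \<Longrightarrow> (f has_derivative (\<lambda>v. dd v f x)) (at x)"
  by (simp add: dd_def frechet_derivative_works)

lemma k_times_Suc:
  "k_times_differentiable_on (Suc k) f S \<longleftrightarrow>
     (\<forall>x\<in>S. f differentiable (at x)) \<and> (\<forall>v. k_times_differentiable_on k (dd v f) S)"
  by (simp add: dd_def[abs_def])

lemma k_times_Suc_diff: "k_times_differentiable_on (Suc k) f S \<Longrightarrow> x \<in> S \<Longrightarrow> f differentiable (at x)"
  by simp

lemma k_times_Suc_dd: "k_times_differentiable_on (Suc k) f S \<Longrightarrow> k_times_differentiable_on k (dd v f) S"
  by (simp add: k_times_Suc del: k_times_differentiable_on.simps)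

lemma k_times_SucI:
  "(\<And>x. x \<in> S \<Longrightarrow> f differentiable (at x)) \<Longrightarrow> (\<And>v. k_times_differentiable_on k (dd v f) S) \<Longrightarrow>
    k_times_differentiable_on (Suc k) f S"
  by (simp add: k_times_Suc del: k_times_differentiable_on.simps)

lemma dd_cong_open:
  assumes "open S" "x \<in> S" "\<And>y. y \<in> S \<Longrightarrow> f y = g y"
  shows "dd v f x = dd v g x"
proof -
  have "(f has_derivative f') (at x) \<longleftrightarrow> (g has_derivative f') (at x)" for f'
    using has_derivative_transform_within_open[OF _ assms(1,2)] assms(3) by metis
  then show ?thesis by (simp add: dd_def frechet_derivative_def)
qed

lemma differentiable_cong_open:
  assumes "open S" "x \<in> S" "\<And>y. y \<in> S \<Longrightarrow> f y = g y"
  shows "f differentiable (at x) \<longleftrightarrow> g differentiable (at x)"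
  unfolding differentiable_def
  using has_derivative_transform_within_open[OF _ assms(1,2)] assms(3) by metis

lemma k_times_cong:
  assumes "open S"
  shows "(\<And>x. x \<in> S \<Longrightarrow> f x = g x) \<Longrightarrow>
     k_times_differentiable_on k f S \<longleftrightarrow> k_times_differentiable_on k g S"
proof (induction k arbitrary: f g)
  case 0
  then show ?case by (simp cong: continuous_on_cong)
next
  case (Suc k)
  have "dd v f x = dd v g x" if "x \<in> S" for x v
    using dd_cong_open[OF assms that] Suc.prems by blast
  then have "k_times_differentiable_on k (dd v f) S \<longleftrightarrow> k_times_differentiable_on k (dd v g) S" for v
    using Suc.IH[of "dd v f" "dd v g"] by blast
  moreover have "f differentiable (at x) \<longleftrightarrow> g differentiable (at x)" if "x \<in> S" for x
    using differentiable_cong_open[OF assms that] Suc.prems by blast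
  ultimately show ?case unfolding k_times_Suc by auto
qed

lemma k_times_congI:
  assumes "open S" "k_times_differentiable_on k g S" "\<And>x. x \<in> S \<Longrightarrow> f x = g x"
  shows "k_times_differentiable_on k f S"
  using k_times_cong[OF assms(1), of f g k] assms(2,3) by blast

lemma k_times_subset:
  "T \<subseteq> S \<Longrightarrow> k_times_differentiable_on k f S \<Longrightarrow> k_times_differentiable_on k f T"
proof (induction k arbitrary: f)
  case 0
  then show ?case by (auto intro: continuous_on_subset)
next
  case (Suc k)
  then show ?case using k_times_Suc_diff k_times_Suc_dd
    by (intro k_times_SucI) blast+
qed

lemma k_times_Suc_imp: "k_times_differentiable_on (Suc k) f S \<Longrightarrow> k_times_differentiable_on k f S"
proof (induction k arbitrary: f)
  case 0
  then have "f differentiable_on S"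
    unfolding k_times_Suc differentiable_on_def by (auto intro: differentiable_at_withinI)
  then show ?case by (simp add: differentiable_imp_continuous_on)
next
  case (Suc k)
  show ?case
    by (rule k_times_SucI) (use k_times_Suc_diff[OF Suc.prems] Suc.IH[OF k_times_Suc_dd[OF Suc.prems]] in auto)
qed

lemma smooth_on_cong:
  "open S \<Longrightarrow> (\<And>x. x \<in> S \<Longrightarrow> f x = g x) \<Longrightarrow> smooth_on f S \<longleftrightarrow> smooth_on g S"
  unfolding smooth_on_def using k_times_cong by blast

lemma smooth_on_subset: "smooth_on f S \<Longrightarrow> T \<subseteq> S \<Longrightarrow> smooth_on f T"
  unfolding smooth_on_def using k_times_subset by blast

lemma smooth_on_dd: "smooth_on f S \<Longrightarrow> smooth_on (dd v f) S"
  unfolding smooth_on_def using k_times_Suc_dd by blast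

lemma smooth_on_differentiable: "smooth_on f S \<Longrightarrow> x \<in> S \<Longrightarrow> f differentiable (at x)"
  unfolding smooth_on_def using k_times_Suc_diff by blast

lemma smooth_on_has_derivative:
  "smooth_on f S \<Longrightarrow> x \<in> S \<Longrightarrow> (f has_derivative (\<lambda>v. dd v f x)) (at x)"
  by (simp add: differentiable_has_dd smooth_on_differentiable)

lemma smooth_on_continuous: "smooth_on f S \<Longrightarrow> continuous_on S f"
  unfolding smooth_on_def by (metis k_times_differentiable_on.simps(1))

lemma k_times_const: "k_times_differentiable_on k (\<lambda>x. c) S"
proof (induction k arbitrary: c)
  case 0
  then show ?case by simp
next
  case (Suc k)
  have "dd v (\<lambda>x. c) = (\<lambda>x. 0)" for v :: 'a
    by (rule ext, rule dd_eq, rule has_derivative_const)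
  then show ?case
    by (intro k_times_SucI) (simp_all add: Suc.IH)
qed

lemma k_times_bounded_linear:
  assumes "bounded_linear L" shows "k_times_differentiable_on k L S"
proof (cases k)
  case 0
  then show ?thesis using assms by (simp add: linear_continuous_on)
next
  case (Suc j)
  have "(L has_derivative L) (at x)" for x by (rule bounded_linear_imp_has_derivative[OF assms])
  then have "dd v L = (\<lambda>x. L v)" "L differentiable (at x)" for v x
    using dd_eq differentiable_def by blast+
  then show ?thesis unfolding Suc by (intro k_times_SucI) (simp_all add: k_times_const)
qed

lemma k_times_add:
  assumes "open S"
  shows "k_times_differentiable_on k f S \<Longrightarrow> k_times_differentiable_on k g S \<Longrightarrow>
    k_times_differentiable_on k (\<lambda>x. f x + g x) S"
proof (induction k arbitrary: f g)
  case 0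
  then show ?case by (simp add: continuous_on_add)
next
  case (Suc k)
  have d: "dd v (\<lambda>x. f x + g x) x = dd v f x + dd v g x" if "x \<in> S" for x v
    by (rule dd_eq) (intro has_derivative_add differentiable_has_dd k_times_Suc_diff[OF Suc.prems(1)]
      k_times_Suc_diff[OF Suc.prems(2)] that)
  have "k_times_differentiable_on k (dd v (\<lambda>x. f x + g x)) S" for v
    by (rule k_times_congI[OF assms _ d], rule Suc.IH) (intro k_times_Suc_dd Suc.prems)+
  then show ?case using k_times_Suc_diff[OF Suc.prems(1)] k_times_Suc_diff[OF Suc.prems(2)]
    by (intro k_times_SucI differentiable_add)
qed

lemma k_times_bilinear:
  assumes "open S" "bounded_bilinear B"
  shows "k_times_differentiable_on k f S \<Longrightarrow> k_times_differentiable_on k g S \<Longrightarrow>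
    k_times_differentiable_on k (\<lambda>x. B (f x) (g x)) S"
proof (induction k arbitrary: f g)
  case 0
  then show ?case using bounded_bilinear.continuous_on[OF assms(2)] by auto
next
  case (Suc k)
  have h: "((\<lambda>x. B (f x) (g x)) has_derivative (\<lambda>v. B (f x) (dd v g x) + B (dd v f x) (g x))) (at x)"
    if "x \<in> S" for x
    by (intro bounded_bilinear.FDERIV[OF assms(2)] differentiable_has_dd k_times_Suc_diff[OF Suc.prems(1)]
      k_times_Suc_diff[OF Suc.prems(2)] that)
  have d: "dd v (\<lambda>x. B (f x) (g x)) x = B (f x) (dd v g x) + B (dd v f x) (g x)" if "x \<in> S" for x v
    using dd_eq[OF h[OF that]] .
  have "k_times_differentiable_on k (\<lambda>x. B (f x) (dd v g x) + B (dd v f x) (g x)) S" for v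
    by (intro k_times_add[OF assms(1)] Suc.IH k_times_Suc_dd[OF Suc.prems(1)] k_times_Suc_dd[OF Suc.prems(2)]
      k_times_Suc_imp[OF Suc.prems(1)] k_times_Suc_imp[OF Suc.prems(2)])
  then have "k_times_differentiable_on k (dd v (\<lambda>x. B (f x) (g x))) S" for v
    by (rule k_times_congI[OF assms(1)]) (rule d)
  then show ?case using h differentiable_def by (intro k_times_SucI) blast+
qed

lemma k_times_linear_comp:
  assumes "open S" "bounded_linear L" "k_times_differentiable_on k f S"
  shows "k_times_differentiable_on k (\<lambda>x. L (f x)) S"
proof -
  have "bounded_bilinear (\<lambda>a b. b *\<^sub>R L a)"
    using bounded_bilinear.comp[OF bounded_bilinear_scaleR bounded_linear_ident assms(2)]
    by (rule bounded_bilinear.flip)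
  from k_times_bilinear[OF assms(1) this assms(3) k_times_const[of k "1::real"]]
  show ?thesis by simp
qed

lemma k_times_sum:
  assumes "open S" "\<And>i. i \<in> I \<Longrightarrow> k_times_differentiable_on k (f i) S"
  shows "k_times_differentiable_on k (\<lambda>x. \<Sum>i\<in>I. f i x) S"
  using assms(2)
proof (induction I rule: infinite_finite_induct)
  case (insert i I)
  then have "k_times_differentiable_on k (\<lambda>x. f i x + (\<Sum>i\<in>I. f i x)) S"
    by (intro k_times_add[OF assms(1)]) simp_all
  then show ?case using insert by simp
qed (simp_all add: k_times_const)

lemma k_times_compose:
  fixes f :: "'e::euclidean_space \<Rightarrow> 'f::euclidean_space"
  assumes "open S" "open T" "f ` S \<subseteq> T"
  shows "k_times_differentiable_on k g T \<Longrightarrow> k_times_differentiable_on k f S \<Longrightarrow>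
    k_times_differentiable_on k (\<lambda>x. g (f x)) S"
proof (induction k arbitrary: g)
  case 0
  then show ?case using continuous_on_compose2 assms(3) by fastforce
next
  case (Suc k)
  have fd: "(f has_derivative (\<lambda>v. dd v f x)) (at x)" if "x \<in> S" for x
    by (intro differentiable_has_dd k_times_Suc_diff[OF Suc.prems(2)] that)
  have gd: "(g has_derivative (\<lambda>v. dd v g (f x))) (at (f x))" if "x \<in> S" for x
    by (intro differentiable_has_dd k_times_Suc_diff[OF Suc.prems(1)]) (use that assms(3) in blast)
  have h: "((\<lambda>x. g (f x)) has_derivative (\<lambda>v. dd (dd v f x) g (f x))) (at x)" if "x \<in> S" for x
    by (rule has_derivative_compose[OF fd[OF that] gd[OF that]])
  \<comment> \<open>The direction \<open>dd v f x\<close> moves with \<open>x\<close>, while the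
    induction hypothesis concerns a fixed direction; expanding in the basis leaves only fixed
    directions \<open>b\<close>.\<close>
  have d: "dd v (\<lambda>x. g (f x)) x = (\<Sum>b\<in>Basis. (dd v f x \<bullet> b) *\<^sub>R dd b g (f x))" if "x \<in> S" for x v
  proof -
    have lin: "linear (\<lambda>w. dd w g (f x))"
      using gd[OF that] has_derivative_bounded_linear bounded_linear.linear by blast
    have "dd v (\<lambda>x. g (f x)) x = dd (dd v f x) g (f x)" by (rule dd_eq[OF h[OF that]])
    also have "\<dots> = dd (\<Sum>b\<in>Basis. (dd v f x \<bullet> b) *\<^sub>R b) g (f x)" by (simp add: euclidean_representation)
    also have "\<dots> = (\<Sum>b\<in>Basis. (dd v f x \<bullet> b) *\<^sub>R dd b g (f x))"
      by (simp add: linear_sum[OF lin] linear_scale[OF lin] o_def)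
    finally show ?thesis .
  qed
  have "k_times_differentiable_on k (\<lambda>x. \<Sum>b\<in>Basis. (dd v f x \<bullet> b) *\<^sub>R dd b g (f x)) S" for v
  proof (rule k_times_sum[OF assms(1)], rule k_times_bilinear[OF assms(1) bounded_bilinear_scaleR])
    fix b :: 'f assume "b \<in> Basis"
    show "k_times_differentiable_on k (\<lambda>x. dd v f x \<bullet> b) S"
      by (rule k_times_linear_comp[OF assms(1) bounded_linear_inner_left]) (intro k_times_Suc_dd Suc.prems)
    show "k_times_differentiable_on k (\<lambda>x. dd b g (f x)) S"
      by (intro Suc.IH k_times_Suc_dd[OF Suc.prems(1)] k_times_Suc_imp[OF Suc.prems(2)])
  qed
  then have "k_times_differentiable_on k (dd v (\<lambda>x. g (f x))) S" for v
    by (rule k_times_congI[OF assms(1)]) (rule d)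
  then show ?case using h differentiable_def by (intro k_times_SucI) blast+
qed

lemma k_times_inverse:
  fixes f :: "'e::euclidean_space \<Rightarrow> real"
  assumes "open S" "\<And>x. x \<in> S \<Longrightarrow> f x \<noteq> 0"
  shows "k_times_differentiable_on k f S \<Longrightarrow> k_times_differentiable_on k (\<lambda>x. inverse (f x)) S"
proof (induction k)
  case 0
  then show ?case using assms(2) by (auto intro: continuous_on_inverse)
next
  case (Suc k)
  have h: "((\<lambda>x. inverse (f x)) has_derivative (\<lambda>v. - (inverse (f x) * dd v f x * inverse (f x)))) (at x)"
    if "x \<in> S" for x
    by (rule Deriv.has_derivative_inverse[OF assms(2)[OF that]
      differentiable_has_dd[OF k_times_Suc_diff[OF Suc.prems that]]])
  have d: "dd v (\<lambda>x. inverse (f x)) x = - (inverse (f x) * dd v f x * inverse (f x))" if "x \<in> S" for x v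
    using dd_eq[OF h[OF that]] .
  have i: "k_times_differentiable_on k (\<lambda>x. inverse (f x)) S"
    by (intro Suc.IH k_times_Suc_imp[OF Suc.prems])
  have "k_times_differentiable_on k (\<lambda>x. - (inverse (f x) * dd v f x * inverse (f x))) S" for v
    by (intro k_times_linear_comp[OF assms(1) bounded_linear_minus[OF bounded_linear_ident]]
        k_times_bilinear[OF assms(1) bounded_bilinear_mult] i k_times_Suc_dd Suc.prems)
  then have "k_times_differentiable_on k (dd v (\<lambda>x. inverse (f x))) S" for v
    by (rule k_times_congI[OF assms(1)]) (rule d)
  then show ?case using h differentiable_def by (intro k_times_SucI) blast+
qed

lemma smooth_on_const: "smooth_on (\<lambda>x. c) S"
  by (simp add: smooth_on_def k_times_const)

lemma smooth_on_linear: "bounded_linear L \<Longrightarrow> smooth_on L S"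
  by (simp add: smooth_on_def k_times_bounded_linear)

lemma smooth_on_id: "smooth_on (\<lambda>x. x) S"
  by (rule smooth_on_linear) (rule bounded_linear_ident)

lemma smooth_on_add:
  "open S \<Longrightarrow> smooth_on f S \<Longrightarrow> smooth_on g S \<Longrightarrow> smooth_on (\<lambda>x. f x + g x) S"
  by (simp add: smooth_on_def k_times_add)

lemma smooth_on_bilinear:
  "bounded_bilinear B \<Longrightarrow> open S \<Longrightarrow> smooth_on f S \<Longrightarrow> smooth_on g S \<Longrightarrow> smooth_on (\<lambda>x. B (f x) (g x)) S"
  by (simp add: smooth_on_def k_times_bilinear)

lemma smooth_on_linear_comp:
  "bounded_linear L \<Longrightarrow> open S \<Longrightarrow> smooth_on f S \<Longrightarrow> smooth_on (\<lambda>x. L (f x)) S"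
  by (simp add: smooth_on_def k_times_linear_comp)

lemma smooth_on_sum:
  "open S \<Longrightarrow> (\<And>i. i \<in> I \<Longrightarrow> smooth_on (f i) S) \<Longrightarrow> smooth_on (\<lambda>x. \<Sum>i\<in>I. f i x) S"
  by (simp add: smooth_on_def k_times_sum)

lemma smooth_on_compose:
  fixes f :: "'e::euclidean_space \<Rightarrow> 'f::euclidean_space"
  shows "smooth_on g T \<Longrightarrow> open S \<Longrightarrow> open T \<Longrightarrow> f ` S \<subseteq> T \<Longrightarrow> smooth_on f S \<Longrightarrow> smooth_on (\<lambda>x. g (f x)) S"
  by (simp add: smooth_on_def k_times_compose)

lemma smooth_on_inverse:
  fixes f :: "'e::euclidean_space \<Rightarrow> real"
  shows "open S \<Longrightarrow> (\<And>x. x \<in> S \<Longrightarrow> f x \<noteq> 0) \<Longrightarrow> smooth_on f S \<Longrightarrow> smooth_on (\<lambda>x. inverse (f x)) S"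
  by (simp add: smooth_on_def k_times_inverse)

lemmas smooth_on_scaleR = smooth_on_bilinear[OF bounded_bilinear_scaleR]
lemmas smooth_on_inner = smooth_on_bilinear[OF bounded_bilinear_inner]
lemmas smooth_on_mult = smooth_on_bilinear[OF bounded_bilinear_mult]
lemmas smooth_on_vec_nth = smooth_on_linear_comp[OF bounded_linear_vec_nth]
lemmas smooth_on_fst = smooth_on_linear_comp[OF bounded_linear_fst]
lemmas smooth_on_snd = smooth_on_linear_comp[OF bounded_linear_snd]
lemmas smooth_on_minus = smooth_on_linear_comp[OF bounded_linear_minus[OF bounded_linear_ident]]

lemma smooth_on_diff:
  "open S \<Longrightarrow> smooth_on f S \<Longrightarrow> smooth_on g S \<Longrightarrow> smooth_on (\<lambda>x. f x - g x) S"
  using smooth_on_add[of S f "\<lambda>x. - g x"] smooth_on_minus[of S g] by simp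

lemma smooth_on_Pair:
  fixes f :: "'e::euclidean_space \<Rightarrow> 'f::real_normed_vector" and g :: "'e \<Rightarrow> 'g::real_normed_vector"
  assumes "open S" "smooth_on f S" "smooth_on g S"
  shows "smooth_on (\<lambda>x. (f x, g x)) S"
proof -
  have 1: "bounded_linear (\<lambda>a::'f. (a, 0::'g))" and 2: "bounded_linear (\<lambda>a::'g. (0::'f, a))"
    by (intro bounded_linear_Pair bounded_linear_ident bounded_linear_zero)+
  have "smooth_on (\<lambda>x. (f x, 0) + (0, g x)) S"
    by (intro smooth_on_add smooth_on_linear_comp[OF 1] smooth_on_linear_comp[OF 2] assms)
  then show ?thesis by simp
qed

lemma smooth_on_divide:
  fixes f g :: "'e::euclidean_space \<Rightarrow> real"
  shows "open S \<Longrightarrow> smooth_on f S \<Longrightarrow> smooth_on g S \<Longrightarrow> (\<And>x. x \<in> S \<Longrightarrow> g x \<noteq> 0) \<Longrightarrow>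
    smooth_on (\<lambda>x. f x / g x) S"
  unfolding divide_inverse by (intro smooth_on_mult smooth_on_inverse)

lemma smooth_on_prod:
  fixes f :: "'i \<Rightarrow> 'e::euclidean_space \<Rightarrow> real"
  assumes "open S" "\<And>i. i \<in> I \<Longrightarrow> smooth_on (f i) S"
  shows "smooth_on (\<lambda>x. \<Prod>i\<in>I. f i x) S"
  using assms(2)
proof (induction I rule: infinite_finite_induct)
  case (insert i I)
  then have "smooth_on (\<lambda>x. f i x * (\<Prod>i\<in>I. f i x)) S"
    by (intro smooth_on_mult[OF assms(1)]) simp_all
  then show ?case using insert by simp
qed (simp_all add: smooth_on_const)

lemma smooth_on_vec:
  fixes f :: "'i::finite \<Rightarrow> 'e::euclidean_space \<Rightarrow> 'f::euclidean_space"
  assumes "open S" "\<And>i. smooth_on (f i) S"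
  shows "smooth_on (\<lambda>x. \<chi> i. f i x) S"
proof -
  have bl: "bounded_linear (\<lambda>a::'f. (\<chi> j. if j = i then a else 0) :: 'f^'i)" for i
    by (rule linear_conv_bounded_linear[THEN iffD1]) (auto intro!: linearI simp: vec_eq_iff)
  have "smooth_on (\<lambda>x. \<Sum>i\<in>UNIV. (\<chi> j. if j = i then f i x else 0)) S"
    by (intro smooth_on_sum smooth_on_linear_comp[OF bl] assms)
  moreover have "(\<Sum>i\<in>UNIV. (\<chi> j. if j = i then f i x else 0)) = (\<chi> i. f i x)" for x
    by (simp add: vec_eq_iff sum_component)
  ultimately show ?thesis by simp
qed

text \<open>For functions whose derivative is expressed through the function itself, as for implicit
  functions and solutions of differential equations: order \<open>k\<close> of the function yields
  order \<open>k\<close> of its derivative, that is order \<open>k + 1\<close> of the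
  function.\<close>

lemma smooth_on_bootstrap:
  assumes "open S" "\<And>x. x \<in> S \<Longrightarrow> f differentiable (at x)"
    and "\<And>k v. k_times_differentiable_on k f S \<Longrightarrow> k_times_differentiable_on k (dd v f) S"
  shows "smooth_on f S"
proof -
  have "k_times_differentiable_on k f S" for k
  proof (induction k)
    case 0
    then show ?case using assms(2)
      by (simp add: continuous_at_imp_continuous_on differentiable_imp_continuous_within)
  next
    case (Suc k)
    then show ?case using assms by (intro k_times_SucI)
  qed
  then show ?thesis by (simp add: smooth_on_def)
qed

lemma dd_add: "f differentiable (at x) \<Longrightarrow> g differentiable (at x) \<Longrightarrow>
    dd v (\<lambda>x. f x + g x) x = dd v f x + dd v g x"
  by (rule dd_eq) (intro has_derivative_add differentiable_has_dd)

lemma dd_bilinear: "bounded_bilinear B \<Longrightarrow> f differentiable (at x) \<Longrightarrow> g differentiable (at x) \<Longrightarrow>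
    dd v (\<lambda>x. B (f x) (g x)) x = B (f x) (dd v g x) + B (dd v f x) (g x)"
  by (rule dd_eq, rule bounded_bilinear.FDERIV) (simp_all add: differentiable_has_dd)

lemma dd_linear: "bounded_linear L \<Longrightarrow> f differentiable (at x) \<Longrightarrow>
    dd v (\<lambda>x. L (f x)) x = L (dd v f x)"
  by (rule dd_eq, rule bounded_linear.has_derivative) (simp_all add: differentiable_has_dd)

lemma dd_const [simp]: "dd v (\<lambda>x. c) x = 0"
  by (rule dd_eq) (rule has_derivative_const)

lemma dd_sum: "(\<And>i. i \<in> I \<Longrightarrow> f i differentiable (at x)) \<Longrightarrow>
    dd v (\<lambda>x. \<Sum>i\<in>I. f i x) x = (\<Sum>i\<in>I. dd v (f i) x)"
  by (rule dd_eq, rule has_derivative_sum) (simp_all add: differentiable_has_dd)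

lemma dd_compose: "f differentiable (at x) \<Longrightarrow> g differentiable (at (f x)) \<Longrightarrow>
    dd v (\<lambda>x. g (f x)) x = dd (dd v f x) g (f x)"
  by (rule dd_eq, rule has_derivative_compose) (simp_all add: differentiable_has_dd)

lemma dd_linear_dir: "f differentiable (at x) \<Longrightarrow> linear (\<lambda>v. dd v f x)"
  using differentiable_has_dd has_derivative_bounded_linear bounded_linear.linear by blast

lemma dd_sum_dir: "f differentiable (at x) \<Longrightarrow>
    dd (\<Sum>i\<in>I. c i *\<^sub>R v i) f x = (\<Sum>i\<in>I. c i *\<^sub>R dd (v i) f x)"
  using linear_sum[OF dd_linear_dir, of f x "\<lambda>i. c i *\<^sub>R v i" I] linear_scale[OF dd_linear_dir, of f x]
  by simp

section \<open>Symmetry of second derivatives\<close>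

lemma line_has_vector_derivative:
  fixes f :: "'e::euclidean_space \<Rightarrow> 'f::real_normed_vector"
  assumes "f differentiable (at (p + h *\<^sub>R v))"
  shows "((\<lambda>h. f (p + h *\<^sub>R v)) has_vector_derivative dd v f (p + h *\<^sub>R v)) (at h)"
proof -
  have 1: "((\<lambda>h. p + h *\<^sub>R v) has_derivative (\<lambda>k. k *\<^sub>R v)) (at h)"
    by (auto intro!: derivative_eq_intros)
  have "((\<lambda>h. f (p + h *\<^sub>R v)) has_derivative (\<lambda>k. dd (k *\<^sub>R v) f (p + h *\<^sub>R v))) (at h)"
    by (rule has_derivative_compose[OF 1 differentiable_has_dd[OF assms]])
  then show ?thesis
    by (simp add: has_vector_derivative_def linear_scale[OF dd_linear_dir[OF assms]])
qed

lemma line_DERIV: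
  fixes f :: "'e::euclidean_space \<Rightarrow> real"
  assumes "f differentiable (at (p + h *\<^sub>R v))"
  shows "DERIV (\<lambda>h. f (p + h *\<^sub>R v)) h :> dd v f (p + h *\<^sub>R v)"
  using line_has_vector_derivative[OF assms] by (simp add: has_real_derivative_iff_has_vector_derivative)

text \<open>The mean value theorem is applied along \<open>v\<close> to the difference of
  \<open>f\<close> at points \<open>\<epsilon> *\<^sub>R w\<close> apart, then along
  \<open>w\<close> to \<open>dd v f\<close>. The left-hand side is symmetric in \<open>v\<close> and
  \<open>w\<close>, which forces the mixed derivatives to agree.\<close>

lemma second_difference:
  fixes f :: "'e::euclidean_space \<Rightarrow> real"
  assumes f: "smooth_on f S" and \<epsilon>: "\<epsilon> > 0"
    and in_S: "\<And>s t. 0 \<le> s \<Longrightarrow> s \<le> \<epsilon> \<Longrightarrow> 0 \<le> t \<Longrightarrow> t \<le> \<epsilon> \<Longrightarrow> x + s *\<^sub>R v + t *\<^sub>R w \<in> S"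
  obtains s t where "0 < s" "s < \<epsilon>" "0 < t" "t < \<epsilon>"
    "f (x + \<epsilon> *\<^sub>R v + \<epsilon> *\<^sub>R w) - f (x + \<epsilon> *\<^sub>R v) - f (x + \<epsilon> *\<^sub>R w) + f x
       = \<epsilon> * \<epsilon> * dd w (dd v f) (x + s *\<^sub>R v + t *\<^sub>R w)"
proof -
  let ?\<psi> = "\<lambda>h. f ((x + \<epsilon> *\<^sub>R w) + h *\<^sub>R v) - f (x + h *\<^sub>R v)"
  have fd: "f differentiable (at y)" "dd v f differentiable (at y)" if "y \<in> S" for y
    using smooth_on_differentiable[OF f that] smooth_on_differentiable[OF smooth_on_dd[OF f] that] by auto
  have "DERIV ?\<psi> h :> dd v f ((x + \<epsilon> *\<^sub>R w) + h *\<^sub>R v) - dd v f (x + h *\<^sub>R v)" if "0 \<le> h" "h \<le> \<epsilon>" for h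
    using in_S[OF that, of \<epsilon>] in_S[OF that, of 0] \<epsilon>
    by (intro DERIV_diff line_DERIV fd) (simp_all add: algebra_simps)
  from MVT2[OF \<epsilon> this] obtain s where s: "0 < s" "s < \<epsilon>"
    and e1: "?\<psi> \<epsilon> - ?\<psi> 0 = (\<epsilon> - 0) * (dd v f ((x + \<epsilon> *\<^sub>R w) + s *\<^sub>R v) - dd v f (x + s *\<^sub>R v))"
    by blast
  have "DERIV (\<lambda>k. dd v f ((x + s *\<^sub>R v) + k *\<^sub>R w)) k :> dd w (dd v f) ((x + s *\<^sub>R v) + k *\<^sub>R w)"
    if "0 \<le> k" "k \<le> \<epsilon>" for k
    using in_S[OF _ _ that, of s] s by (intro line_DERIV fd) (simp_all add: algebra_simps)
  from MVT2[OF \<epsilon> this] obtain t where t: "0 < t" "t < \<epsilon>"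
    and e2: "dd v f ((x + s *\<^sub>R v) + \<epsilon> *\<^sub>R w) - dd v f ((x + s *\<^sub>R v) + 0 *\<^sub>R w)
       = (\<epsilon> - 0) * dd w (dd v f) ((x + s *\<^sub>R v) + t *\<^sub>R w)"
    by blast
  have c: "(x + \<epsilon> *\<^sub>R w) + r *\<^sub>R v = x + r *\<^sub>R v + \<epsilon> *\<^sub>R w" for r by (simp add: algebra_simps)
  show ?thesis
    by (rule that[OF s t]) (use e1 e2 in \<open>simp add: c algebra_simps\<close>)
qed

text \<open>The two mixed derivatives, taken at two points near \<open>x\<close>, equal the same
  second difference divided by the square of \<open>\<epsilon>\<close>. By continuity each is closer
  to its value at \<open>x\<close> than half the supposed gap.\<close>

lemma dd_commute_real:
  fixes f :: "'e::euclidean_space \<Rightarrow> real"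
  assumes S: "open S" "x \<in> S" and f: "smooth_on f S"
  shows "dd v (dd w f) x = dd w (dd v f) x"
proof (rule ccontr)
  let ?e = "\<bar>dd v (dd w f) x - dd w (dd v f) x\<bar> / 2"
  assume ne: "dd v (dd w f) x \<noteq> dd w (dd v f) x"
  then have e: "?e > 0" by simp
  have cont: "isCont (dd a (dd b f)) x" for a b
    using smooth_on_continuous[OF smooth_on_dd[OF smooth_on_dd[OF f]], of a b] S
    by (simp add: continuous_on_eq_continuous_at)
  obtain d0 where d0: "d0 > 0" "ball x d0 \<subseteq> S" using S open_contains_ball by blast
  obtain d1 where d1: "d1 > 0" "\<And>y. dist y x < d1 \<Longrightarrow> dist (dd v (dd w f) y) (dd v (dd w f) x) < ?e"
    using cont[of v w, unfolded continuous_at_eps_delta, rule_format, OF e] by blast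
  obtain d2 where d2: "d2 > 0" "\<And>y. dist y x < d2 \<Longrightarrow> dist (dd w (dd v f) y) (dd w (dd v f) x) < ?e"
    using cont[of w v, unfolded continuous_at_eps_delta, rule_format, OF e] by blast
  define d where "d = min d0 (min d1 d2)"
  have d: "d > 0" "d \<le> d0" "d \<le> d1" "d \<le> d2" using d0 d1 d2 by (auto simp: d_def)
  \<comment> \<open>Keeps the whole parallelogram spanned by \<open>\<epsilon> *\<^sub>R v\<close>
    and \<open>\<epsilon> *\<^sub>R w\<close> within distance \<open>d / 2\<close> of
    \<open>x\<close>; the \<open>+ 1\<close> avoids a division by zero.\<close>
  define \<epsilon> where "\<epsilon> = d / (2 * (norm v + norm w + 1))"
  have p: "norm v + norm w + 1 > 0" by (smt (verit) norm_ge_zero)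
  have \<epsilon>: "\<epsilon> > 0" using d p by (simp add: \<epsilon>_def)
  have small: "dist (x + s *\<^sub>R v + t *\<^sub>R w) x < d" if "0 \<le> s" "s \<le> \<epsilon>" "0 \<le> t" "t \<le> \<epsilon>" for s t
  proof -
    have "norm (s *\<^sub>R v + t *\<^sub>R w) \<le> s * norm v + t * norm w"
      using norm_triangle_ineq[of "s *\<^sub>R v" "t *\<^sub>R w"] that by simp
    also have "\<dots> \<le> \<epsilon> * norm v + \<epsilon> * norm w" using that by (intro add_mono mult_right_mono) auto
    also have "\<dots> \<le> \<epsilon> * (norm v + norm w + 1)" using \<epsilon> by (simp add: algebra_simps)
    also have "\<dots> = d / 2" using p by (simp add: \<epsilon>_def field_simps)
    finally show ?thesis using d by (simp add: dist_norm add.assoc)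
  qed
  have inS: "x + s *\<^sub>R v + t *\<^sub>R w \<in> S" if "0 \<le> s" "s \<le> \<epsilon>" "0 \<le> t" "t \<le> \<epsilon>" for s t
    using small[OF that] d0 d by (auto simp: dist_commute)
  obtain s t where st: "0 < s" "s < \<epsilon>" "0 < t" "t < \<epsilon>"
    "f (x + \<epsilon> *\<^sub>R v + \<epsilon> *\<^sub>R w) - f (x + \<epsilon> *\<^sub>R v) - f (x + \<epsilon> *\<^sub>R w) + f x
       = \<epsilon> * \<epsilon> * dd w (dd v f) (x + s *\<^sub>R v + t *\<^sub>R w)"
    using second_difference[OF f \<epsilon> inS] by blast
  have inS': "x + s *\<^sub>R w + t *\<^sub>R v \<in> S" if "0 \<le> s" "s \<le> \<epsilon>" "0 \<le> t" "t \<le> \<epsilon>" for s t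
    using inS[OF that(3,4,1,2)] by (simp add: algebra_simps)
  obtain s' t' where st': "0 < s'" "s' < \<epsilon>" "0 < t'" "t' < \<epsilon>"
    "f (x + \<epsilon> *\<^sub>R w + \<epsilon> *\<^sub>R v) - f (x + \<epsilon> *\<^sub>R w) - f (x + \<epsilon> *\<^sub>R v) + f x
       = \<epsilon> * \<epsilon> * dd v (dd w f) (x + s' *\<^sub>R w + t' *\<^sub>R v)"
    using second_difference[OF f \<epsilon> inS'] by blast
  have sw: "x + a *\<^sub>R w + b *\<^sub>R v = x + b *\<^sub>R v + a *\<^sub>R w" for a b by (simp add: add_ac)
  have "\<epsilon> * \<epsilon> * dd w (dd v f) (x + s *\<^sub>R v + t *\<^sub>R w) = \<epsilon> * \<epsilon> * dd v (dd w f) (x + t' *\<^sub>R v + s' *\<^sub>R w)"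
    using st(5) st'(5) unfolding sw[of s' t'] sw[of \<epsilon> \<epsilon>] by linarith
  then have eq: "dd w (dd v f) (x + s *\<^sub>R v + t *\<^sub>R w) = dd v (dd w f) (x + t' *\<^sub>R v + s' *\<^sub>R w)"
    using \<epsilon> by simp
  have "dist (dd w (dd v f) (x + s *\<^sub>R v + t *\<^sub>R w)) (dd w (dd v f) x) < ?e"
    using small[of s t] st d by (intro d2) auto
  moreover have "dist (dd v (dd w f) (x + t' *\<^sub>R v + s' *\<^sub>R w)) (dd v (dd w f) x) < ?e"
    using small[of t' s'] st' d by (intro d1) auto
  ultimately show False unfolding eq dist_real_def by (auto simp: abs_if split: if_splits)
qed

lemma dd_commute:
  fixes f :: "'e::euclidean_space \<Rightarrow> 'f::euclidean_space"
  assumes S: "open S" "x \<in> S" and f: "smooth_on f S"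
  shows "dd v (dd w f) x = dd w (dd v f) x"
proof (rule euclidean_eqI)
  fix b :: 'f assume "b \<in> Basis"
  have fb: "smooth_on (\<lambda>y. f y \<bullet> b) S" by (intro smooth_on_inner f smooth_on_const S)
  have *: "dd a (\<lambda>y. g y \<bullet> b) y = dd a g y \<bullet> b" if "smooth_on g S" "y \<in> S" for a g y
    by (rule dd_linear[OF bounded_linear_inner_left smooth_on_differentiable[OF that]])
  have **: "dd a (dd c (\<lambda>y. f y \<bullet> b)) x = dd a (dd c f) x \<bullet> b" for a c
    using dd_cong_open[OF S, of "dd c (\<lambda>y. f y \<bullet> b)" "\<lambda>y. dd c f y \<bullet> b" a] *[OF f]
      *[OF smooth_on_dd[OF f] S(2)] by simp
  show "dd v (dd w f) x \<bullet> b = dd w (dd v f) x \<bullet> b"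
    using dd_commute_real[OF S fb, of v w] by (simp add: **)
qed

lemma k_times_Pair:
  fixes f :: "'e::euclidean_space \<Rightarrow> 'f::real_normed_vector" and g :: "'e \<Rightarrow> 'g::real_normed_vector"
  assumes "open S" "k_times_differentiable_on k f S" "k_times_differentiable_on k g S"
  shows "k_times_differentiable_on k (\<lambda>x. (f x, g x)) S"
proof -
  have 1: "bounded_linear (\<lambda>a::'f. (a, 0::'g))" and 2: "bounded_linear (\<lambda>a::'g. (0::'f, a))"
    by (intro bounded_linear_Pair bounded_linear_ident bounded_linear_zero)+
  have "k_times_differentiable_on k (\<lambda>x. (f x, 0) + (0, g x)) S"
    by (intro k_times_add k_times_linear_comp[OF _ 1] k_times_linear_comp[OF _ 2] assms)
  then show ?thesis by simp
qed

section \<open>Implicit functions, kernel sections and linear differential equations\<close>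

text \<open>The inverse function theorem is applied to
  \<open>(p, s) \<mapsto> (p, \<Phi> (p, s))\<close>, and \<open>\<sigma>\<close> is read off the
  inverse at \<open>(p, 0)\<close>; uniqueness is injectivity on the neighbourhood. Smoothness is
  bootstrapped from the formula for the derivative of \<open>\<sigma>\<close>, which involves only
  \<open>\<sigma>\<close> and derivatives of \<open>\<Phi>\<close>.\<close>

theorem implicit_scalar:
  fixes \<Phi> :: "'p::euclidean_space \<times> real \<Rightarrow> real"
  assumes "open S" "(p0, s0) \<in> S" and \<Phi>: "smooth_on \<Phi> S" and zero: "\<Phi> (p0, s0) = 0"
    and ne: "dd (0, 1) \<Phi> (p0, s0) \<noteq> 0"
  obtains U I \<sigma> where "open U" "p0 \<in> U" "open I" "s0 \<in> I" "U \<times> I \<subseteq> S" "smooth_on \<sigma> U"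
    "\<And>p. p \<in> U \<Longrightarrow> \<sigma> p \<in> I" "\<And>p. p \<in> U \<Longrightarrow> \<Phi> (p, \<sigma> p) = 0"
    "\<And>p s. p \<in> U \<Longrightarrow> s \<in> I \<Longrightarrow> \<Phi> (p, s) = 0 \<Longrightarrow> s = \<sigma> p"
proof -
  \<comment> \<open>On all of \<open>S0\<close> one may divide by the partial derivative, so the
    formula for \<open>dd v \<sigma>\<close> holds on the whole neighbourhood and not only at
    \<open>p0\<close>.\<close>
  define S0 where "S0 = {x \<in> S. dd (0, 1) \<Phi> x \<noteq> 0}"
  have "S0 = S \<inter> dd (0, 1) \<Phi> -` (- {0})" by (auto simp: S0_def)
  then have S0: "open S0" using continuous_open_preimage[OF smooth_on_continuous[OF smooth_on_dd[OF \<Phi>]] \<open>open S\<close>]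
    by (metis open_Compl closed_singleton)
  have \<Phi>0: "smooth_on \<Phi> S0" using smooth_on_subset[OF \<Phi>] by (auto simp: S0_def)
  have x0: "(p0, s0) \<in> S0" using assms by (simp add: S0_def)
  define f where "f = (\<lambda>x. (fst x, \<Phi> x))"
  define f' where "f' = (\<lambda>x. Blinfun (\<lambda>v. (fst v, dd v \<Phi> x)))"
  have bl: "bounded_linear (\<lambda>v. (fst v, dd v \<Phi> x))" if "x \<in> S0" for x
    by (intro bounded_linear_Pair bounded_linear_fst
        has_derivative_bounded_linear[OF smooth_on_has_derivative[OF \<Phi>0 that]])
  have f'_apply: "blinfun_apply (f' x) v = (fst v, dd v \<Phi> x)" if "x \<in> S0" for x v
    unfolding f'_def by (simp add: bounded_linear_Blinfun_apply[OF bl[OF that]])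
  have derf: "(f has_derivative blinfun_apply (f' x)) (at x)" if "x \<in> S0" for x
    unfolding f'_apply[OF that, abs_def] f_def
    by (intro has_derivative_Pair has_derivative_fst has_derivative_ident smooth_on_has_derivative[OF \<Phi>0 that])
  have contf: "continuous_on S0 f'"
  proof (rule continuous_on_blinfun_componentwise)
    fix i :: "'p \<times> real"
    have "continuous_on S0 (\<lambda>x. (fst i, dd i \<Phi> x))"
      by (intro continuous_intros smooth_on_continuous[OF smooth_on_dd[OF \<Phi>0]])
    then show "continuous_on S0 (\<lambda>x. blinfun_apply (f' x) i)"
      by (simp add: f'_apply cong: continuous_on_cong)
  qed
  let ?d = "dd (0, 1) \<Phi> (p0, s0)"
  have lin: "linear (\<lambda>v. dd v \<Phi> x)" if "x \<in> S0" for x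
    by (rule dd_linear_dir[OF smooth_on_differentiable[OF \<Phi>0 that]])
  have dec: "dd (a, s) \<Phi> x = dd (a, 0) \<Phi> x + s * dd (0, 1) \<Phi> x" if "x \<in> S0" for a s x
  proof -
    have "(a, s) = (a, 0) + s *\<^sub>R (0, 1)" by simp
    then show ?thesis using linear_add[OF lin[OF that], of "(a,0)" "s *\<^sub>R (0,1)"]
        linear_scale[OF lin[OF that], of s "(0, 1)"] by simp
  qed
  define invf where "invf = Blinfun (\<lambda>v. (fst v, (snd v - dd (fst v, 0) \<Phi> (p0, s0)) / ?d))"
  have "linear (\<lambda>v. (fst v, (snd v - dd (fst v, 0) \<Phi> (p0, s0)) / ?d))"
  proof (rule linearI)
    fix a b :: "'p \<times> real"
    have "dd (fst a + fst b, 0) \<Phi> (p0, s0) = dd (fst a, 0) \<Phi> (p0, s0) + dd (fst b, 0) \<Phi> (p0, s0)"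
      using linear_add[OF lin[OF x0], of "(fst a, 0)" "(fst b, 0)"] by simp
    then show "(fst (a + b), (snd (a + b) - dd (fst (a + b), 0) \<Phi> (p0, s0)) / ?d) =
       (fst a, (snd a - dd (fst a, 0) \<Phi> (p0, s0)) / ?d) + (fst b, (snd b - dd (fst b, 0) \<Phi> (p0, s0)) / ?d)"
      by (simp add: diff_divide_distrib add_divide_distrib)
  next
    fix r and b :: "'p \<times> real"
    have "dd (r *\<^sub>R fst b, 0) \<Phi> (p0, s0) = r * dd (fst b, 0) \<Phi> (p0, s0)"
      using linear_scale[OF lin[OF x0], of r "(fst b, 0)"] by simp
    then show "(fst (r *\<^sub>R b), (snd (r *\<^sub>R b) - dd (fst (r *\<^sub>R b), 0) \<Phi> (p0, s0)) / ?d) =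
       r *\<^sub>R (fst b, (snd b - dd (fst b, 0) \<Phi> (p0, s0)) / ?d)"
      by (simp add: right_diff_distrib)
  qed
  then have invf_apply: "blinfun_apply invf v = (fst v, (snd v - dd (fst v, 0) \<Phi> (p0, s0)) / ?d)" for v
    unfolding invf_def by (simp add: bounded_linear_Blinfun_apply linear_conv_bounded_linear)
  have inv: "invf o\<^sub>L f' (p0, s0) = id_blinfun"
  proof (rule blinfun_eqI)
    fix v :: "'p \<times> real"
    show "blinfun_apply (invf o\<^sub>L f' (p0, s0)) v = blinfun_apply id_blinfun v"
      using dec[OF x0, of "fst v" "snd v"] ne by (simp add: invf_apply f'_apply[OF x0])
  qed
  obtain U' V g g' where U': "open U'" "U' \<subseteq> S0" "(p0, s0) \<in> U'" and V: "open V" "f (p0, s0) \<in> V"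
    and hom: "homeomorphism U' V f g" and g': "\<And>y. y \<in> V \<Longrightarrow> (g has_derivative (g' y)) (at y)"
    by (rule inverse_function_theorem[OF S0 _ contf x0 inv], erule derf, rule that) assumption+
  obtain A I where AI: "open A" "open I" "p0 \<in> A" "s0 \<in> I" "A \<times> I \<subseteq> U'"
    by (rule open_prod_elim[OF U'(1,3)]) (auto intro: that)
  define \<sigma> where "\<sigma> = (\<lambda>p. snd (g (p, 0)))"
  define V1 where "V1 = {p \<in> A. (p, 0) \<in> V}"
  have "V1 = A \<inter> (\<lambda>p. (p, 0)) -` V" by (auto simp: V1_def)
  then have V1: "open V1" using AI(1) V(1) by (auto intro!: open_Int open_vimage continuous_intros)
  have cg: "continuous_on V g" using hom by (simp add: homeomorphism_def)
  have c\<sigma>: "continuous_on V1 \<sigma>" unfolding \<sigma>_def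
    by (intro continuous_intros continuous_on_compose2[OF cg]) (auto simp: V1_def)
  define U where "U = V1 \<inter> \<sigma> -` I"
  have U: "open U" unfolding U_def by (rule continuous_open_preimage[OF c\<sigma> V1 AI(2)])
  have gf: "g (f x) = x" if "x \<in> U'" for x using hom that by (simp add: homeomorphism_def)
  have f0: "f (p0, s0) = (p0, 0)" by (simp add: f_def zero)
  have \<sigma>0: "\<sigma> p0 = s0" using gf[OF U'(3)] by (simp add: \<sigma>_def f0)
  have p0: "p0 \<in> U" using AI V \<sigma>0 f0 by (simp add: U_def V1_def)
  have fg: "f (g y) = y" "g y \<in> U'" if "y \<in> V" for y using hom that by (auto simp: homeomorphism_def)
  have g_eq: "g (p, 0) = (p, \<sigma> p)" "\<Phi> (p, \<sigma> p) = 0" if "p \<in> U" for p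
  proof -
    have y: "(p, 0) \<in> V" using that by (simp add: U_def V1_def)
    from fg(1)[OF y] show *: "g (p, 0) = (p, \<sigma> p)"
      by (simp add: f_def \<sigma>_def prod_eq_iff)
    from fg(1)[OF y] show "\<Phi> (p, \<sigma> p) = 0" by (simp add: f_def *)
  qed
  have UI: "U \<times> I \<subseteq> S" using AI U' by (auto simp: U_def V1_def S0_def)
  have uniq: "s = \<sigma> p" if "p \<in> U" "s \<in> I" "\<Phi> (p, s) = 0" for p s
  proof -
    have "(p, s) \<in> U'" using that AI by (auto simp: U_def V1_def)
    from gf[OF this] show ?thesis using that by (simp add: f_def \<sigma>_def)
  qed
  have \<sigma>I: "\<sigma> p \<in> I" if "p \<in> U" for p using that by (simp add: U_def)
  have \<sigma>S0: "(p, \<sigma> p) \<in> S0" if "p \<in> U" for p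
    using that AI \<sigma>I[OF that] U' by (auto simp: U_def V1_def)
  have diff: "\<sigma> differentiable (at p)" if "p \<in> U" for p
  proof -
    have y: "(p, 0) \<in> V" using that by (simp add: U_def V1_def)
    have "((\<lambda>p. (p, 0::real)) has_derivative (\<lambda>v. (v, 0))) (at p)"
      by (intro has_derivative_Pair has_derivative_ident has_derivative_const)
    from has_derivative_snd[OF has_derivative_compose[OF this g'[OF y]]]
    show ?thesis unfolding \<sigma>_def differentiable_def by blast
  qed
  have d\<sigma>: "dd v \<sigma> p = - dd (v, 0) \<Phi> (p, \<sigma> p) * inverse (dd (0, 1) \<Phi> (p, \<sigma> p))" if "p \<in> U" for p v
  proof -
    have 1: "((\<lambda>p. (p, \<sigma> p)) has_derivative (\<lambda>v. (v, dd v \<sigma> p))) (at p)"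
      by (intro has_derivative_Pair has_derivative_ident differentiable_has_dd diff that)
    have "((\<lambda>p. \<Phi> (p, \<sigma> p)) has_derivative (\<lambda>v. dd (v, dd v \<sigma> p) \<Phi> (p, \<sigma> p))) (at p)"
      by (rule has_derivative_compose[OF 1 smooth_on_has_derivative[OF \<Phi>0 \<sigma>S0[OF that]]])
    then have "dd v (\<lambda>p. \<Phi> (p, \<sigma> p)) p = dd (v, dd v \<sigma> p) \<Phi> (p, \<sigma> p)" by (rule dd_eq)
    moreover have "dd v (\<lambda>p. \<Phi> (p, \<sigma> p)) p = 0"
      using dd_cong_open[OF U that, of "\<lambda>p. \<Phi> (p, \<sigma> p)" "\<lambda>_. 0" v] g_eq(2) by simp
    ultimately have "dd (v, 0) \<Phi> (p, \<sigma> p) + dd v \<sigma> p * dd (0, 1) \<Phi> (p, \<sigma> p) = 0"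
      using dec[OF \<sigma>S0[OF that], of v "dd v \<sigma> p"] by simp
    then show ?thesis using \<sigma>S0[OF that] by (simp add: S0_def field_simps)
  qed
  have sm: "smooth_on \<sigma> U"
  proof (rule smooth_on_bootstrap[OF U diff])
    fix k v assume k: "k_times_differentiable_on k \<sigma> U"
    have id: "k_times_differentiable_on k (\<lambda>p. p) U" by (rule k_times_bounded_linear) (rule bounded_linear_ident)
    have sub: "(\<lambda>p. (p, \<sigma> p)) ` U \<subseteq> S0" using \<sigma>S0 by blast
    have comp: "k_times_differentiable_on k (\<lambda>p. dd a \<Phi> (p, \<sigma> p)) U" for a
      using smooth_on_dd[OF \<Phi>0, of a] unfolding smooth_on_def
      by (intro k_times_compose[OF U S0 sub _ k_times_Pair[OF U id k]]) (rule spec)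
    have i: "k_times_differentiable_on k (\<lambda>p. inverse (dd (0, 1) \<Phi> (p, \<sigma> p))) U"
      by (rule k_times_inverse[OF U _ comp]) (use \<sigma>S0 in \<open>simp add: S0_def\<close>)
    have n: "k_times_differentiable_on k (\<lambda>p. - dd (v, 0) \<Phi> (p, \<sigma> p)) U"
      by (rule k_times_linear_comp[OF U bounded_linear_minus[OF bounded_linear_ident] comp])
    show "k_times_differentiable_on k (dd v \<sigma>) U"
      by (rule k_times_congI[OF U k_times_bilinear[OF U bounded_bilinear_mult n i] d\<sigma>])
  qed
  show ?thesis
    by (rule that[OF U p0 AI(2,4) UI sm \<sigma>I g_eq(2) uniq])
qed

lemma max_dim_point:
  fixes A :: "'e \<Rightarrow> 'w::euclidean_space set"
  assumes "x1 \<in> S"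
  obtains x0 where "x0 \<in> S" "\<And>x. x \<in> S \<Longrightarrow> dim (A x) \<le> dim (A x0)"
proof -
  have "\<exists>x. x \<in> S \<and> (\<forall>y. y \<in> S \<longrightarrow> dim (A y) \<le> dim (A x))"
    by (rule ex_has_greatest_nat[where b = "DIM('w) + 1"])
       (use assms dim_subset_UNIV[where 'a='w] in \<open>auto simp: less_Suc_eq_le\<close>)
  then show ?thesis using that by blast
qed

text \<open>The maximality of the rank at \<open>x0\<close> is what makes the kernels form a smooth bundle near \<open>x0\<close>.\<close>

lemma kernel_section:
  fixes A :: "'e::euclidean_space \<Rightarrow> real^'n \<Rightarrow> 'w::euclidean_space"
  assumes S: "open S" "x0 \<in> S" and lin: "\<And>x. x \<in> S \<Longrightarrow> linear (A x)"
    and sm: "\<And>v. smooth_on (\<lambda>x. A x v) S"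
    and max: "\<And>x. x \<in> S \<Longrightarrow> dim (range (A x)) \<le> dim (range (A x0))"
    and v0: "A x0 v0 = 0"
  obtains U Y where "open U" "x0 \<in> U" "U \<subseteq> S" "smooth_on Y U" "Y x0 = v0"
    "\<And>x. x \<in> U \<Longrightarrow> A x (Y x) = 0"
proof -
  note lin0 = lin[OF S(2)]
  define K where "K = {v. A x0 v = 0}"
  define C where "C = {y. \<forall>x\<in>K. orthogonal x y}"
  have K: "subspace K" unfolding K_def by (rule linear_subspace_kernel[OF lin0])
  have C: "subspace C" unfolding C_def by (rule subspace_orthogonal_to_vectors)
  have KC: "v = 0" if "v \<in> K" "v \<in> C" for v
    using that by (auto simp: C_def orthogonal_self)
  have dec: "\<exists>k c. v = k + c \<and> k \<in> K \<and> c \<in> C" for v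
  proof -
    obtain y z where "y \<in> span K" "\<And>w. w \<in> span K \<Longrightarrow> orthogonal z w" "v = y + z"
      using orthogonal_subspace_decomp_exists by blast
    then show ?thesis unfolding C_def using K span_eq_iff[of K] orthogonal_commute by blast
  qed
  have injC: "inj_on (A x0) C"
  proof (rule inj_onI)
    fix u v assume "u \<in> C" "v \<in> C" "A x0 u = A x0 v"
    then have "u - v \<in> K" "u - v \<in> C" using subspace_diff[OF C] by (auto simp: K_def linear_diff[OF lin0])
    then show "u = v" using KC by fastforce
  qed
  obtain L where L: "range L \<subseteq> C" "linear L" "\<And>v. v \<in> C \<Longrightarrow> L (A x0 v) = v"
    using linear_exists_left_inverse_on[OF lin0 C injC] by blast
  have LA0: "v - L (A x0 v) \<in> K" for v
  proof -
    obtain k c where "v = k + c" "k \<in> K" "c \<in> C" using dec by blast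
    then show ?thesis using L(3) by (simp add: K_def linear_add[OF lin0])
  qed
  have rC: "dim (range (A x0)) = dim C"
  proof -
    have "range (A x0) = A x0 ` C"
    proof -
      have "A x0 v \<in> A x0 ` C" for v
      proof -
        obtain k c where "v = k + c" "k \<in> K" "c \<in> C" using dec by blast
        then show ?thesis by (simp add: K_def linear_add[OF lin0])
      qed
      then show ?thesis by blast
    qed
    then show ?thesis using dim_image_eq[OF lin0, of C] injC C by (simp add: span_eq_iff[THEN iffD2])
  qed
  \<comment> \<open>\<open>T x v\<close> is the sum of \<open>v - L (A x0 v)\<close> in
    \<open>K\<close> and \<open>L (A x v)\<close> in \<open>C\<close>. Hence solving
    \<open>T x (Y x) = v0\<close> with \<open>v0\<close> in \<open>K\<close> gives
    \<open>L (A x (Y x)) = 0\<close>; and \<open>T x0\<close> is the identity, so \<open>T x\<close>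
    stays invertible nearby.\<close>
  define T where "T = (\<lambda>x v. v + L (A x v - A x0 v))"
  have linT: "linear (T x)" if "x \<in> S" for x
    unfolding T_def by (rule linearI)
      (simp_all add: linear_add[OF L(2)] linear_add[OF lin[OF that]] linear_add[OF lin0] linear_diff[OF L(2)]
        linear_scale[OF L(2)] linear_scale[OF lin[OF that]] linear_scale[OF lin0] algebra_simps)
  define M where "M = (\<lambda>x. matrix (T x))"
  have M: "M x *v v = T x v" if "x \<in> S" for x v
    unfolding M_def by (rule matrix_works[OF linT[OF that, folded linear_matrix_vector_mul_eq]])
  have smT: "smooth_on (\<lambda>x. T x v) S" for v
    unfolding T_def
    by (intro smooth_on_add smooth_on_const smooth_on_linear_comp[OF L(2)[unfolded linear_conv_bounded_linear]]
        smooth_on_diff sm S)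
  have smM: "smooth_on (\<lambda>x. M x $ i $ j) S" for i j
    unfolding M_def matrix_def using smooth_on_vec_nth[OF S(1) smT[of "axis j 1"]] by simp
  have smdet: "smooth_on (\<lambda>x. det (N x)) S" if "\<And>i j. smooth_on (\<lambda>x. N x $ i $ j) S" for N :: "'e \<Rightarrow> real^'n^'n"
    unfolding det_def by (intro smooth_on_sum smooth_on_mult smooth_on_const smooth_on_prod that S)
  have T0: "T x0 = id" by (auto simp: T_def linear_0[OF L(2)])
  have "M x0 = mat 1" unfolding M_def T0 using matrix_id_mat_1 by (simp add: id_def)
  then have det0: "det (M x0) \<noteq> 0" by simp
  define U where "U = S \<inter> (\<lambda>x. det (M x)) -` (- {0})"
  have U: "open U" unfolding U_def
    by (rule continuous_open_preimage[OF smooth_on_continuous[OF smdet[OF smM]] S(1)]) (rule open_Compl[OF closed_singleton])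
  \<comment> \<open>Cramer's rule for \<open>T x (Y x) = v0\<close>, which makes smoothness
    visible.\<close>
  define Y where "Y = (\<lambda>x. \<chi> k. det (\<chi> i j. if j = k then v0 $ i else M x $ i $ j) / det (M x))"
  have "smooth_on Y U"
    unfolding Y_def
  proof (intro smooth_on_vec smooth_on_divide U)
    fix k
    show "smooth_on (\<lambda>x. det (\<chi> i j. if j = k then v0 $ i else M x $ i $ j)) U"
    proof (rule smooth_on_subset[OF smdet])
      fix i j
      show "smooth_on (\<lambda>x. (\<chi> i j. if j = k then v0 $ i else M x $ i $ j) $ i $ j) S"
        by (cases "j = k") (simp_all add: smooth_on_const smM)
    qed (simp add: U_def)
    show "smooth_on (\<lambda>x. det (M x)) U"
      by (rule smooth_on_subset[OF smdet[OF smM]]) (simp add: U_def)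
  qed (simp add: U_def)
  moreover have TY: "T x (Y x) = v0" if "x \<in> U" for x
    using cramer[of "M x" "Y x" v0] that M[of x "Y x"] by (auto simp: U_def Y_def)
  moreover have "Y x0 = v0" using TY[of x0] T0 S det0 by (simp add: U_def)
  moreover have "A x (Y x) = 0" if x: "x \<in> U" for x
  proof -
    have xS: "x \<in> S" using x by (simp add: U_def)
    note linx = lin[OF xS]
    have T_alt: "T x v = (v - L (A x0 v)) + L (A x v)" for v
      by (simp add: T_def linear_diff[OF L(2)])
    have LA: "L (A x v) = c" if "T x v = k + c" "k \<in> K" "c \<in> C" for v k c
    proof -
      have "L (A x v) - c = k - (v - L (A x0 v))" using that T_alt[of v] by (simp add: algebra_simps)
      moreover have "L (A x v) - c \<in> C" using L(1) that subspace_diff[OF C] by blast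
      moreover have "k - (v - L (A x0 v)) \<in> K" using LA0 that subspace_diff[OF K] by blast
      ultimately show ?thesis using KC[of "L (A x v) - c"] by simp
    qed
    have 0: "L (A x (Y x)) = 0"
      using LA[of "Y x" v0 0] TY[OF x] v0 subspace_0[OF C] by (simp add: K_def)
    obtain B where B: "M x ** B = mat 1"
      using x invertible_det_nz[of "M x"] by (auto simp: U_def invertible_def)
    \<comment> \<open>On \<open>C\<close> the map \<open>s\<close> is a right inverse of
      \<open>L\<close> with values in the range of \<open>A x\<close>. The rank of
      \<open>A x\<close> is at most \<open>dim C\<close>, so \<open>s\<close> maps \<open>C\<close>
      onto that range; thus \<open>A x (Y x) = s c\<close> for some \<open>c\<close> in
      \<open>C\<close>, and \<open>c = L (A x (Y x)) = 0\<close>.\<close>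
    define s where "s = (\<lambda>c. A x (B *v c))"
    have TB: "T x (B *v c) = c" for c
      using M[OF xS, of "B *v c"] by (simp add: matrix_vector_mul_assoc B)
    have Ls: "L (s c) = c" if "c \<in> C" for c
      unfolding s_def by (rule LA[of _ 0]) (use TB that subspace_0[OF K] in auto)
    have lins: "linear s" unfolding s_def
      using linear_compose[OF matrix_vector_mul_linear linx] by (simp add: o_def)
    have "inj_on s C" by (rule inj_on_inverseI[where g = L]) (use Ls in auto)
    then have "dim (s ` C) = dim C" using dim_image_eq[OF lins, of C] C by (simp add: span_eq_iff[THEN iffD2])
    then have "dim (range (A x)) \<le> dim (s ` C)" using max[OF xS] rC by simp
    moreover have "s ` C \<subseteq> range (A x)" by (auto simp: s_def)
    moreover have "subspace (s ` C)" by (rule linear_subspace_image[OF lins C])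
    moreover have "subspace (range (A x))" by (rule linear_subspace_image[OF linx]) simp
    ultimately have "s ` C = range (A x)" using subspace_dim_equal by blast
    then obtain c where c: "c \<in> C" "A x (Y x) = s c" by blast
    then have "c = 0" using Ls 0 by simp
    then show ?thesis using c linear_0[OF lins] by simp
  qed
  ultimately show ?thesis using that[of U Y] U S det0 by (auto simp: U_def)
qed

text \<open>Banach's fixed point theorem for the integral equation. By linearity
  \<open>\<delta>\<close> depends only on a bound for \<open>A\<close>, so one interval serves all
  initial values \<open>e\<close>. Derivatives are claimed on the open interval; continuity up to
  \<open>t0\<close> carries the initial value.\<close>

lemma linear_ode:
  fixes A :: "real \<Rightarrow> 'l::euclidean_space \<Rightarrow> 'l"
  assumes I: "open I" "t0 \<in> I" and lin: "\<And>t. t \<in> I \<Longrightarrow> linear (A t)"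
    and sm: "\<And>v. smooth_on (\<lambda>t. A t v) I"
  obtains \<delta> where "\<delta> > 0" "{t0..t0 + \<delta>} \<subseteq> I"
    "\<And>e. \<exists>y. y t0 = e \<and> continuous_on {t0..t0 + \<delta>} y \<and> smooth_on y {t0<..<t0 + \<delta>} \<and>
       (\<forall>t\<in>{t0<..<t0 + \<delta>}. (y has_vector_derivative A t (y t)) (at t))"
proof -
  obtain d where d: "d > 0" "cball t0 d \<subseteq> I" using I open_contains_cball by blast
  have dI: "{t0..t0 + d} \<subseteq> I" using d by (auto simp: cball_def dist_real_def)
  have cA: "continuous_on {t0..t0 + d} (\<lambda>t. A t b)" for b
    using continuous_on_subset[OF smooth_on_continuous[OF sm] dI] .
  have "\<exists>m. \<forall>t\<in>{t0..t0 + d}. norm (A t b) \<le> m" for b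
    using compact_imp_bounded[OF compact_continuous_image[OF cA[of b] compact_Icc]] unfolding bounded_iff by blast
  then obtain m where m: "\<And>b t. t \<in> {t0..t0 + d} \<Longrightarrow> norm (A t b) \<le> m b" by metis
  have m0: "m b \<ge> 0" for b using m[of t0 b] d by (smt (verit) atLeastAtMost_iff norm_ge_zero)
  define M where "M = (\<Sum>b\<in>Basis. m b) + 1"
  have M: "M > 0" unfolding M_def using m0 by (smt (verit) sum_nonneg)
  have A_expand: "A t v = (\<Sum>b\<in>Basis. (v \<bullet> b) *\<^sub>R A t b)" if "t \<in> I" for t v
  proof -
    have "A t v = A t (\<Sum>b\<in>Basis. (v \<bullet> b) *\<^sub>R b)" by (simp add: euclidean_representation)
    then show ?thesis by (simp add: linear_sum[OF lin[OF that]] linear_scale[OF lin[OF that]])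
  qed
  have A_bound: "norm (A t v) \<le> M * norm v" if t: "t \<in> {t0..t0 + d}" for t v
  proof -
    have "norm (A t v) \<le> (\<Sum>b\<in>Basis. norm ((v \<bullet> b) *\<^sub>R A t b))"
      using A_expand[of t v] t dI norm_sum[of "\<lambda>b. (v \<bullet> b) *\<^sub>R A t b" Basis] by auto
    also have "\<dots> \<le> (\<Sum>b\<in>Basis. norm v * m b)"
      using m[OF t] by (auto intro!: sum_mono mult_mono simp: Basis_le_norm)
    also have "\<dots> \<le> M * norm v" by (simp add: M_def sum_distrib_left[symmetric] algebra_simps)
    finally show ?thesis .
  qed
  \<comment> \<open>Makes the contraction constant \<open>M * \<delta>\<close> at most 1/2.\<close>
  define \<delta> where "\<delta> = min d (1 / (2 * M))"
  have \<delta>: "\<delta> > 0" "\<delta> \<le> d" "M * \<delta> \<le> 1 / 2" using d M by (auto simp: \<delta>_def min_def field_simps)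
  have \<delta>I: "{t0..t0 + \<delta>} \<subseteq> I" using dI \<delta> by force
  have cAy: "continuous_on {t0..t0 + \<delta>} (\<lambda>s. A s (y s))" if "continuous_on {t0..t0 + \<delta>} y" for y
  proof -
    have "continuous_on {t0..t0 + \<delta>} (\<lambda>s. \<Sum>b\<in>Basis. (y s \<bullet> b) *\<^sub>R A s b)"
      by (intro continuous_intros that continuous_on_subset[OF cA]) (use \<delta> in auto)
    then show ?thesis
      by (rule continuous_on_eq) (use A_expand \<delta>I in auto)
  qed
  have ex: "\<exists>y. y t0 = e \<and> continuous_on {t0..t0 + \<delta>} y \<and> smooth_on y {t0<..<t0 + \<delta>} \<and>
       (\<forall>t\<in>{t0<..<t0 + \<delta>}. (y has_vector_derivative A t (y t)) (at t))" for e
  proof -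
    \<comment> \<open>Clamping the time to \<open>{t0..t0 + \<delta>}\<close> turns
      \<open>P y\<close> into a bounded continuous function on the whole line, an element of the
      complete space in which the fixed point is sought.\<close>
    define cl where "cl = (\<lambda>t::real. max t0 (min (t0 + \<delta>) t))"
    have cl: "cl t \<in> {t0..t0 + \<delta>}" for t using \<delta> by (auto simp: cl_def)
    have ccl: "continuous_on UNIV cl" unfolding cl_def by (intro continuous_intros)
    define P where "P = (\<lambda>y t. e + integral {t0..cl t} (\<lambda>s. A s (y s)))"
    have P_b: "P (apply_bcontfun y) \<in> bcontfun" for y :: "real \<Rightarrow>\<^sub>C 'l"
    proof -
      let ?Q = "\<lambda>t. integral {t0..t} (\<lambda>s. A s (y s))"
      have "(\<lambda>s. A s (y s)) integrable_on {t0..t0 + \<delta>}"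
        by (rule integrable_continuous_real[OF cAy]) simp
      then have cQ: "continuous_on {t0..t0 + \<delta>} ?Q" by (rule indefinite_integral_continuous_1)
      then obtain B where B: "\<And>t. t \<in> {t0..t0 + \<delta>} \<Longrightarrow> norm (?Q t) \<le> B"
        using compact_imp_bounded[OF compact_continuous_image[OF cQ compact_Icc]] unfolding bounded_iff by blast
      have "continuous_on UNIV (\<lambda>t. ?Q (cl t))"
        by (rule continuous_on_compose2[OF cQ ccl]) (use cl in auto)
      then have "continuous_on UNIV (P y)" unfolding P_def by (intro continuous_intros)
      moreover have "norm (P y t) \<le> norm e + B" for t
        unfolding P_def using B[OF cl[of t]] norm_triangle_ineq[of e "?Q (cl t)"] by linarith
      ultimately show ?thesis by (rule bcontfun_normI)
    qed
    define F where "F = (\<lambda>y. Bcontfun (P (apply_bcontfun y)))"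
    have F: "apply_bcontfun (F y) t = P y t" for y t
      unfolding F_def by (simp add: Bcontfun_inverse[OF P_b])
    have contr: "dist (F y) (F z) \<le> 1/2 * dist y z" for y z
    proof (rule dist_bound)
      fix t
      have iy: "(\<lambda>s. A s (y s)) integrable_on {t0..cl t}" for y :: "real \<Rightarrow>\<^sub>C 'l"
        by (rule integrable_continuous_real[OF continuous_on_subset[OF cAy]]) (use cl[of t] in auto)
      have "dist (F y t) (F z t) = norm (integral {t0..cl t} (\<lambda>s. A s (y s) - A s (z s)))"
        unfolding F P_def by (simp add: dist_norm integral_diff[OF iy iy])
      also have "\<dots> \<le> (M * dist y z) * (cl t - t0)"
      proof (rule integral_bound)
        show "continuous_on {t0..cl t} (\<lambda>s. A s (y s) - A s (z s))"
          by (intro continuous_intros continuous_on_subset[OF cAy]) (use cl[of t] in auto)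
        fix s assume s: "s \<in> {t0..cl t}"
        then have s': "s \<in> {t0..t0 + d}" using cl[of t] \<delta> by auto
        have "norm (A s (y s) - A s (z s)) = norm (A s (y s - z s))"
          using linear_diff[OF lin, of s] s' dI by auto
        also have "\<dots> \<le> M * norm (y s - z s)" by (rule A_bound[OF s'])
        also have "\<dots> \<le> M * dist y z" using dist_bounded[of y s z] M by (simp add: dist_norm)
        finally show "norm (A s (y s) - A s (z s)) \<le> M * dist y z" .
      qed (use cl[of t] in auto)
      also have "\<dots> \<le> (M * dist y z) * \<delta>" using cl[of t] M by (intro mult_left_mono) auto
      also have "\<dots> = (M * \<delta>) * dist y z" by simp
      also have "\<dots> \<le> 1/2 * dist y z" using \<delta> by (intro mult_right_mono) auto
      finally show "dist (F y t) (F z t) \<le> 1/2 * dist y z" .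
    qed
    have "\<exists>!y. F y = y" using contr by (intro banach_fix_type[of "1/2"]) simp_all
    then obtain y where y: "F y = y" by (elim ex1E)
    have yP: "y t = e + integral {t0..cl t} (\<lambda>s. A s (y s))" for t
      using F[of y t] unfolding y P_def .
    have cy: "continuous_on {t0..t0 + \<delta>} (apply_bcontfun y)" by simp
    have y0: "y t0 = e" using yP[of t0] \<delta> by (simp add: cl_def)
    have dy: "(apply_bcontfun y has_vector_derivative A t (y t)) (at t)" if t: "t \<in> {t0<..<t0 + \<delta>}" for t
    proof -
      have "((\<lambda>u. integral {t0..u} (\<lambda>s. A s (y s))) has_vector_derivative A t (y t)) (at t within {t0..t0 + \<delta>})"
        by (rule integral_has_vector_derivative[OF cAy[OF cy]]) (use t in auto)
      then have "((\<lambda>u. integral {t0..u} (\<lambda>s. A s (y s))) has_vector_derivative A t (y t)) (at t)"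
        using at_within_Icc_at[of t0 t "t0 + \<delta>"] t by simp
      then have "((\<lambda>u. e + integral {t0..u} (\<lambda>s. A s (y s))) has_vector_derivative A t (y t)) (at t)"
        by (auto intro!: derivative_eq_intros)
      moreover have "e + integral {t0..u} (\<lambda>s. A s (y s)) = y u" if "u \<in> {t0<..<t0 + \<delta>}" for u
      proof -
        have "cl u = u" using that by (simp add: cl_def)
        then show ?thesis by (subst yP[of u]) simp
      qed
      ultimately show ?thesis
        using has_vector_derivative_transform_within_open[OF _ open_greaterThanLessThan t] by blast
    qed
    have sub: "{t0<..<t0 + \<delta>} \<subseteq> I" using \<delta>I by force
    have "smooth_on (apply_bcontfun y) {t0<..<t0 + \<delta>}"
    proof (rule smooth_on_bootstrap)
      show "apply_bcontfun y differentiable at t" if "t \<in> {t0<..<t0 + \<delta>}" for t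
        using dy[OF that] unfolding has_vector_derivative_def differentiable_def by blast
      fix k and v :: real assume k: "k_times_differentiable_on k (apply_bcontfun y) {t0<..<t0 + \<delta>}"
      have 1: "dd v (apply_bcontfun y) t = v *\<^sub>R (\<Sum>b\<in>Basis. (y t \<bullet> b) *\<^sub>R A t b)" if t: "t \<in> {t0<..<t0 + \<delta>}" for t
        using dd_eq[OF dy[OF t, unfolded has_vector_derivative_def], of v] A_expand[of t "y t"] sub t by auto
      have 2: "k_times_differentiable_on k (\<lambda>t. v *\<^sub>R (\<Sum>b\<in>Basis. (y t \<bullet> b) *\<^sub>R A t b)) {t0<..<t0 + \<delta>}"
      proof (rule k_times_bilinear[OF _ bounded_bilinear_scaleR k_times_const])
        show "k_times_differentiable_on k (\<lambda>t. (\<Sum>b\<in>Basis. (y t \<bullet> b) *\<^sub>R A t b)) {t0<..<t0 + \<delta>}"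
        proof (rule k_times_sum)
          fix b
          show "k_times_differentiable_on k (\<lambda>t. (y t \<bullet> b) *\<^sub>R A t b) {t0<..<t0 + \<delta>}"
            using smooth_on_subset[OF sm sub] unfolding smooth_on_def
            by (intro k_times_bilinear[OF open_greaterThanLessThan bounded_bilinear_scaleR
              k_times_linear_comp[OF open_greaterThanLessThan bounded_linear_inner_left k]]) (rule spec)
        qed simp
      qed simp
      show "k_times_differentiable_on k (dd v (apply_bcontfun y)) {t0<..<t0 + \<delta>}"
        by (rule k_times_congI[OF open_greaterThanLessThan 2 1])
    qed simp
    then show ?thesis using y0 cy dy by (intro exI[of _ "apply_bcontfun y"] conjI ballI)
  qed
  show ?thesis by (rule that[OF \<delta>(1) \<delta>I ex])
qed

section \<open>Second fundamental forms in Lorentz space\<close>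

text \<open>The last two coordinates are null coordinates, so that \<open>lor\<close> has Lorentzian signature and \<open>(y, 1, y \<bullet> y / 2)\<close>
  runs through a section of the light cone isometric to Euclidean space.\<close>

type_synonym 'm lspace = "(real^'m) \<times> real \<times> real"

definition lor :: "'m::finite lspace \<Rightarrow> 'm lspace \<Rightarrow> real" where
  "lor u v = fst u \<bullet> fst v - fst (snd u) * snd (snd v) - snd (snd u) * fst (snd v)"

section \<open>Linear algebra of the Lorentzian form\<close>

lemma lor_sym: "lor u v = lor v u"
  by (simp add: lor_def inner_commute)

lemma lor_bilinear: "bounded_bilinear (lor :: 'm::finite lspace \<Rightarrow> _)"
proof -
  have "bilinear (lor :: 'm lspace \<Rightarrow> _)"
    unfolding bilinear_def
    by (auto intro!: linearI simp: lor_def inner_add_left inner_add_right algebra_simps)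
  then show ?thesis by (simp add: bilinear_conv_bounded_bilinear)
qed

interpretation lor: bounded_bilinear lor by (rule lor_bilinear)

lemmas lor_simps = lor.add_left lor.add_right lor.diff_left lor.diff_right lor.scaleR_left lor.scaleR_right
  lor.minus_left lor.minus_right lor.zero_left lor.zero_right

text \<open>The complement of a null vector is positive semidefinite with radical spanned by that
  vector: subtracting \<open>q / b\<close> times \<open>F\<close> from \<open>v\<close> changes no
  product and removes the first null coordinate, which leaves a Euclidean square. If
  \<open>b = 0\<close>, then \<open>F\<close> lies on the last null axis and \<open>v\<close> itself
  has no such coordinate.\<close>

lemma lor_null_perp:
  assumes F: "lor F F = 0" "F \<noteq> 0" and v: "lor v F = 0"
  shows "lor v v \<ge> 0" "lor v v = 0 \<Longrightarrow> \<exists>k. v = k *\<^sub>R F"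
proof -
  obtain a b c where Fe: "F = (a, b, c)" by (cases F)
  obtain p q r where ve: "v = (p, q, r)" by (cases v)
  have 1: "a \<bullet> a = 2 * b * c" and 2: "p \<bullet> a = q * c + r * b"
    using F v by (simp_all add: Fe ve lor_def)
  have "lor v v \<ge> 0 \<and> (lor v v = 0 \<longrightarrow> (\<exists>k. v = k *\<^sub>R F))"
  proof (cases "b = 0")
    case True
    then have a: "a = 0" using 1 by simp
    then have "c \<noteq> 0" using F(2) True by (simp add: Fe zero_prod_def)
    moreover have "q = 0" using 2 True a \<open>c \<noteq> 0\<close> by simp
    ultimately show ?thesis
      by (auto simp: Fe ve lor_def a True intro!: exI[of _ "r / c"])
  next
    case False
    let ?k = "q / b"
    have "(p - ?k *\<^sub>R a) \<bullet> (p - ?k *\<^sub>R a) = p \<bullet> p - 2 * ?k * (p \<bullet> a) + ?k * ?k * (a \<bullet> a)"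
      by (simp add: inner_diff_left inner_diff_right inner_commute algebra_simps)
    also have "\<dots> = p \<bullet> p - 2 * q * r" using False by (simp add: 1 2 field_simps)
    finally have sq: "lor v v = (p - ?k *\<^sub>R a) \<bullet> (p - ?k *\<^sub>R a)" by (simp add: lor_def ve)
    have "v = ?k *\<^sub>R F" if "lor v v = 0"
    proof -
      have p: "p = ?k *\<^sub>R a" using that sq by simp
      have "?k * (2 * b * c) = q * c + r * b" using 2 1 by (simp add: p)
      then have "r = ?k * c" using False by (simp add: field_simps)
      then show ?thesis using p False by (simp add: Fe ve)
    qed
    then show ?thesis using sq by auto
  qed
  then show "lor v v \<ge> 0" "lor v v = 0 \<Longrightarrow> \<exists>k. v = k *\<^sub>R F" by auto
qed

text \<open>A null \<open>v\<close> would be a multiple of \<open>F\<close>, and the pairing with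
  \<open>\<eta>\<close> excludes nonzero multiples. This is the device by which isotropic normal
  vectors are shown to vanish.\<close>

lemma lor_perp_pos:
  assumes F: "lor F F = 0" "lor \<eta> F = -1" and v: "lor v F = 0" "lor v \<eta> = 0"
  shows "lor v v \<ge> 0" "lor v v = 0 \<Longrightarrow> v = 0"
proof -
  have ne: "F \<noteq> 0" using F by (auto simp: lor_simps)
  show "lor v v \<ge> 0" by (rule lor_null_perp(1)[OF F(1) ne v(1)])
  assume "lor v v = 0"
  then obtain k where k: "v = k *\<^sub>R F" using lor_null_perp(2)[OF F(1) ne v(1)] by blast
  then have "k * lor F \<eta> = 0" using v(2) by (simp add: lor_simps)
  then show "v = 0" using F(2) k by (simp add: lor_sym[of F])
qed

text \<open>Non-null pairwise orthogonal vectors are independent, as in the definite case. They are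
  given as a list because its length is then their number.\<close>

lemma lor_orthogonal_family:
  assumes xs: "sorted_wrt (\<lambda>u v. lor u v = 0) xs" "\<And>u. u \<in> set xs \<Longrightarrow> lor u u \<noteq> 0" "set xs \<subseteq> N"
  shows "length xs \<le> dim N"
proof -
  have orth: "lor (xs ! i) (xs ! j) = 0" if "i < length xs" "j < length xs" "i \<noteq> j" for i j
    using xs(1) that lor_sym[of "xs ! i" "xs ! j"]
    by (cases "i < j") (auto simp: sorted_wrt_iff_nth_less)
  have dist: "distinct xs"
    unfolding distinct_conv_nth using orth xs(2) by (metis nth_mem)
  have "independent (set xs)"
    unfolding dependent_def
  proof
    assume "\<exists>a\<in>set xs. a \<in> span (set xs - {a})"
    then obtain a where a: "a \<in> set xs" "a \<in> span (set xs - {a})" by blast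
    have "lor a x = 0" if "x \<in> span (set xs - {a})" for x
      using that
    proof (induction rule: span_induct)
      case base
      show ?case by (auto simp: subspace_def lor_simps)
    next
      case (step x)
      then show ?case using a(1) orth by (metis Diff_iff in_set_conv_nth singletonI)
    qed
    then show False using a xs(2) by blast
  qed
  from independent_card_le_dim[OF xs(3) this] show ?thesis by (simp add: distinct_card[OF dist])
qed

lemma common_zero:
  fixes \<Phi> :: "('v::euclidean_space \<Rightarrow> real) set"
  assumes fin: "finite \<Phi>" "card \<Phi> < DIM('v)" and lin: "\<And>\<phi>. \<phi> \<in> \<Phi> \<Longrightarrow> linear \<phi>"
  obtains y where "y \<noteq> 0" "\<And>\<phi>. \<phi> \<in> \<Phi> \<Longrightarrow> \<phi> y = 0"
proof -
  let ?r = "\<lambda>\<phi>. adjoint \<phi> (1::real)"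
  have r: "\<phi> y = ?r \<phi> \<bullet> y" if "\<phi> \<in> \<Phi>" for \<phi> y
    using adjoint_works[OF lin[OF that], of y 1] by (simp add: inner_commute)
  have "dim (?r ` \<Phi>) \<le> card (?r ` \<Phi>)" using fin by (intro dim_le_card') simp
  also have "\<dots> < DIM('v)" using fin card_image_le[of \<Phi> ?r] by simp
  finally obtain y where "y \<noteq> 0" "\<And>z. z \<in> span (?r ` \<Phi>) \<Longrightarrow> orthogonal y z"
    using orthogonal_to_subspace_exists by blast
  then show ?thesis using that r span_base[of _ "?r ` \<Phi>"]
    by (metis imageI inner_commute orthogonal_def)
qed

text \<open>Turns a vector equation in \<open>N\<close> into \<open>dim N\<close> scalar equations,
  ready for the counts made with \<open>common_zero\<close>.\<close>

lemma separating_functionals: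
  fixes N :: "'v::euclidean_space set"
  assumes "subspace N"
  obtains B where "finite B" "card B = dim N" "\<And>p. p \<in> N \<Longrightarrow> (\<forall>w\<in>B. p \<bullet> w = 0) \<Longrightarrow> p = 0"
proof -
  obtain B where B: "B \<subseteq> N" "independent B" "N \<subseteq> span B" "card B = dim N"
    using basis_exists by blast
  have "p = 0" if p: "p \<in> N" "\<forall>w\<in>B. p \<bullet> w = 0" for p
  proof -
    have "p \<bullet> x = 0" if "x \<in> span B" for x
      using that
      by (induction rule: span_induct) (use p(2) in \<open>auto simp: subspace_def inner_add_right\<close>)
    then have "p \<bullet> p = 0" using p(1) B(3) by blast
    then show ?thesis by simp
  qed
  then show ?thesis using that[of B] B finiteI_independent by blast
qed

text \<open>The pointwise data of the lift: \<open>N\<close> is the normal space, which contains the position vector \<open>F\<close>, and \<open>kaehler\<close>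
  combines the Gauss equation with the invariance of the curvature tensor under \<open>J\<close>.\<close>

locale kaehler_sff =
  fixes N :: "'m::finite lspace set" and F :: "'m lspace"
    and G :: "real^'d \<Rightarrow> real^'d \<Rightarrow> real" and J :: "real^'d \<Rightarrow> real^'d::finite"
    and \<alpha> :: "real^'d \<Rightarrow> real^'d \<Rightarrow> 'm lspace"
  assumes N: "subspace N" "dim N \<le> 4" and F: "F \<in> N" "lor F F = 0"
    and G: "bounded_bilinear G" "\<And>x y. G x y = G y x" "\<And>x. x \<noteq> 0 \<Longrightarrow> G x x > 0"
    and J: "linear J" "\<And>x. J (J x) = - x" "\<And>x y. G (J x) (J y) = G x y"
    and \<alpha>: "bounded_bilinear \<alpha>" "\<And>x y. \<alpha> x y = \<alpha> y x" "\<And>x y. \<alpha> x y \<in> N"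
    and \<alpha>F: "\<And>x y. lor (\<alpha> x y) F = - G x y"
    and kaehler: "\<And>x y z w. lor (\<alpha> x (J w)) (\<alpha> y (J z)) - lor (\<alpha> x (J z)) (\<alpha> y (J w))
        = lor (\<alpha> x w) (\<alpha> y z) - lor (\<alpha> x z) (\<alpha> y w)"
begin

sublocale G: bounded_bilinear G by (rule G(1))
sublocale \<alpha>: bounded_bilinear \<alpha> by (rule \<alpha>(1))

text \<open>By the Gauss equation this is the curvature term <R(x, y)z, w>; \<open>kaehler\<close>
  is its invariance under \<open>J\<close> in the last pair, and \<open>S_pair\<close> moves the
  invariance to the first pair.\<close>

definition "S x y z w = lor (\<alpha> x w) (\<alpha> y z) - lor (\<alpha> x z) (\<alpha> y w)"

lemma S_J: "S x y (J z) (J w) = S x y z w"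
  unfolding S_def by (rule kaehler)

lemma S_pair: "S x y z w = S z w x y"
  unfolding S_def by (simp add: \<alpha>(2)[of z] \<alpha>(2)[of w] lor_sym)

lemma S_J': "S (J x) (J y) z w = S x y z w"
  by (metis S_J S_pair)

lemma S_minus: "S x y (- z) w = - S x y z w" "S x y z (- w) = - S x y z w" "S (- x) y z w = - S x y z w" "S x (- y) z w = - S x y z w"
  by (simp_all add: S_def \<alpha>.minus_right \<alpha>.minus_left lor_simps)

lemma S_J_swap: "S x y (J z) w = - S x y z (J w)" "S (J x) y z w = - S x (J y) z w"
  using S_J[of x y "J z" w] S_J'[of "J x" y z w] by (simp_all add: J(2) S_minus)

text \<open>Twice the \<open>J\<close>-invariant part of \<open>\<alpha>\<close>, while
  \<open>a\<close> is twice the anti-invariant part. Flatness is available for \<open>b\<close>;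
  what is learnt about \<open>b\<close> is carried over to \<open>a\<close> by
  \<open>ab_mixed\<close>.\<close>

definition "b x y = \<alpha> x y + \<alpha> (J x) (J y)"
definition "a x y = \<alpha> x y - \<alpha> (J x) (J y)"

lemma J_lin: "J (x + y) = J x + J y" "J (r *\<^sub>R x) = r *\<^sub>R J x" "J (x - y) = J x - J y" "J (- x) = - J x" "J 0 = 0"
  by (simp_all add: linear_add[OF J(1)] linear_scale[OF J(1)] linear_diff[OF J(1)] linear_neg[OF J(1)] linear_0[OF J(1)])

lemma b_bilinear: "bounded_bilinear b"
proof -
  have "bilinear b" unfolding bilinear_def b_def
    by (auto intro!: linearI simp: J_lin \<alpha>.add_left \<alpha>.add_right \<alpha>.scaleR_left \<alpha>.scaleR_right algebra_simps)
  then show ?thesis by (simp add: bilinear_conv_bounded_bilinear)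
qed

sublocale b: bounded_bilinear b by (rule b_bilinear)

lemma b_sym: "b x y = b y x"
  by (simp add: b_def \<alpha>(2)[of x y] \<alpha>(2)[of "J x" "J y"])

lemma b_N: "b x y \<in> N"
  unfolding b_def using \<alpha>(3) subspace_add[OF N(1)] by blast

lemma b_F: "lor (b x y) F = - 2 * G x y"
  by (simp add: b_def lor_simps \<alpha>F J(3))

lemma b_JJ: "b (J x) (J y) = b x y"
  by (simp add: b_def J(2) \<alpha>.minus_left \<alpha>.minus_right)

lemma b_J_swap: "b (J x) y = - b x (J y)"
  using b_JJ[of "J x" y] by (simp add: J(2) b.minus_left)

lemma b_self_J: "b x (J x) = 0"
proof -
  have "b x (J x) = - b x (J x)" using b_J_swap[of x x] b_sym[of "J x" x] by simp
  then have "b x (J x) + b x (J x) = 0" by (metis add.right_inverse)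
  then show ?thesis by (simp add: scaleR_2[symmetric])
qed

lemma G_J_swap: "G (J x) y = - G x (J y)"
  using J(3)[of "J x" y] by (simp add: J(2) G.minus_left)

lemma G_self_J: "G x (J x) = 0" "G (J x) x = 0"
  using G_J_swap[of x x] G(2)[of x "J x"] by auto

text \<open>Moore flatness, in complex form: \<open>(b x y, - b x (J y))\<close> are real and imaginary part of a
  complex-valued form.\<close>

lemma b_flat:
  "lor (b x y) (b z t) - lor (b x (J y)) (b z (J t)) = lor (b x t) (b z y) - lor (b x (J t)) (b z (J y))"
proof -
  have "lor (b x y) (b z t) - lor (b x (J y)) (b z (J t)) - (lor (b x t) (b z y) - lor (b x (J t)) (b z (J y)))
     = (S x z t y - S x z (J t) (J y)) + (S (J x) (J z) (J t) (J y) - S (J x) (J z) t y)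
       + (S x (J z) (J t) y + S x (J z) t (J y)) + (S (J x) z (J t) y + S (J x) z t (J y))"
    unfolding b_def S_def J(2)
    by (simp add: lor_simps \<alpha>.minus_left \<alpha>.minus_right)
  also have "\<dots> = 0" by (simp add: S_J S_J_swap J(2) S_minus)
  finally show ?thesis by simp
qed

text \<open>Expanding \<open>a\<close> and \<open>b\<close> turns the difference into curvature
  terms that cancel by invariance under \<open>J\<close>. Once \<open>b z u\<close> and
  \<open>b z (J u)\<close> vanish, the right-hand side is zero, which is how the identity is
  used.\<close>

lemma ab_mixed:
  "lor (a z v) (b w u) + lor (a z (J v)) (b w (J u)) = lor (a w v) (b z u) + lor (a w (J v)) (b z (J u))"
proof -
  have "lor (a z v) (b w u) + lor (a z (J v)) (b w (J u)) - (lor (a w v) (b z u) + lor (a w (J v)) (b z (J u)))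
     = S z w u v + S z w (J u) (J v) + S z (J w) (J u) v - S z (J w) u (J v) - S (J z) w u (J v)
       + S (J z) w (J u) v - S (J z) (J w) (J u) (J v) - S (J z) (J w) u v"
    unfolding a_def b_def S_def J(2)
    by (simp add: lor_simps \<alpha>.minus_left \<alpha>.minus_right lor_sym)
  also have "\<dots> = 0" by (simp add: S_J S_J' S_J_swap J(2) S_minus)
  finally show ?thesis by simp
qed

text \<open>\<open>N\<close> has dimension at most four and already contains the Lorentz plane of
  \<open>F\<close> and \<open>\<eta>\<close> and the orthogonal spacelike vectors \<open>u\<close>
  and \<open>v\<close>; a nonzero \<open>p\<close> would be a fifth orthogonal vector.\<close>

lemma perp_independent:
  assumes "lor \<eta> \<eta> = 0" "lor \<eta> F = -1" "\<eta> \<in> N"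
    and u: "u \<in> N" "lor u F = 0" "lor u \<eta> = 0" "lor u u > 0"
    and v: "v \<in> N" "lor v F = 0" "lor v \<eta> = 0" "lor v v > 0" "lor u v = 0"
    and p: "p \<in> N" "lor p F = 0" "lor p \<eta> = 0" "lor p u = 0" "lor p v = 0"
  shows "p = 0"
proof (rule ccontr)
  assume "p \<noteq> 0"
  then have pp: "lor p p \<noteq> 0" using lor_perp_pos(2)[OF F(2) assms(2) p(2,3)] by blast
  have sy: "lor F \<eta> = -1" "lor F u = 0" "lor F v = 0" "lor F p = 0" "lor \<eta> u = 0" "lor \<eta> v = 0" "lor \<eta> p = 0"
    "lor u p = 0" "lor v p = 0"
    using assms by (simp_all add: lor_sym[of F] lor_sym[of u p] lor_sym[of v p] lor_sym[of \<eta> u] lor_sym[of \<eta> v] lor_sym[of \<eta> p])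
  \<comment> \<open>\<open>F + \<eta>\<close> and \<open>F - \<eta>\<close> are orthogonal with
    squares -2 and 2, so they replace the null pair in \<open>lor_orthogonal_family\<close>.\<close>
  have "length [F + \<eta>, F - \<eta>, u, v, p] \<le> dim N"
  proof (rule lor_orthogonal_family)
    show "sorted_wrt (\<lambda>u v. lor u v = 0) [F + \<eta>, F - \<eta>, u, v, p]"
      using assms F(2) by (simp add: lor_simps sy)
    show "lor x x \<noteq> 0" if "x \<in> set [F + \<eta>, F - \<eta>, u, v, p]" for x
      using that assms F(2) pp by (auto simp: lor_simps sy)
    show "set [F + \<eta>, F - \<eta>, u, v, p] \<subseteq> N"
      using assms F(1) subspace_add[OF N(1)] subspace_diff[OF N(1)] by simp
  qed
  then show False using N(2) by simp
qed

text \<open>Moore's argument at a regular vector. As the rank is maximal at \<open>x0\<close>, the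
  kernel vector \<open>t\<close> extends to a smooth \<open>Y\<close> with
  \<open>b x (Y x) = 0\<close> for \<open>x\<close> near \<open>x0\<close>; differentiating at
  \<open>x0\<close> in direction \<open>w\<close> expresses \<open>b w t\<close> through
  \<open>b x0\<close>. The pair of \<open>b x y\<close> and \<open>b x (J y)\<close> encodes one
  complex-linear map of \<open>y\<close>.\<close>

lemma b_kernel_sections:
  assumes max: "\<And>x. dim (range (\<lambda>y. (b x y, b x (J y)))) \<le> dim (range (\<lambda>y. (b x0 y, b x0 (J y))))"
    and t: "b x0 t = 0" "b x0 (J t) = 0"
  shows "\<exists>u. b w t = b x0 u \<and> b w (J t) = b x0 (J u)"
proof -
  let ?A = "\<lambda>x y. (b x y, b x (J y))"
  have blr: "bounded_linear J" using J(1) by (simp add: linear_conv_bounded_linear)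
  have bl: "linear (?A x)" for x
    by (rule linearI) (simp_all add: b.add_right b.scaleR_right J_lin)
  have sm: "smooth_on (\<lambda>x. ?A x v) UNIV" for v
    by (intro smooth_on_Pair smooth_on_bilinear[OF b_bilinear] smooth_on_id smooth_on_const open_UNIV)
  obtain U Y where U: "open U" "x0 \<in> U" and Y: "smooth_on Y U" "Y x0 = t" "\<And>x. x \<in> U \<Longrightarrow> ?A x (Y x) = 0"
    by (rule kernel_section[where A = ?A and S = UNIV and ?x0.0 = x0 and ?v0.0 = t])
      (use bl sm max t in \<open>simp_all add: zero_prod_def\<close>)
  note dY = smooth_on_differentiable[OF Y(1) U(2)]
  have 0: "dd w (\<lambda>x. b x (Y x)) x0 = 0" "dd w (\<lambda>x. b x (J (Y x))) x0 = 0"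
    using dd_cong_open[OF U, of "\<lambda>x. b x (Y x)" "\<lambda>_. 0" w] dd_cong_open[OF U, of "\<lambda>x. b x (J (Y x))" "\<lambda>_. 0" w] Y(3)
    by (simp_all add: zero_prod_def)
  have did: "(\<lambda>x. x) differentiable (at x0)" by simp
  have ddid: "dd w (\<lambda>x. x) x0 = w" by (rule dd_eq[OF has_derivative_ident])
  have dJY: "(\<lambda>x. J (Y x)) differentiable (at x0)" "dd w (\<lambda>x. J (Y x)) x0 = J (dd w Y x0)"
    using smooth_on_differentiable[OF smooth_on_linear_comp[OF blr U(1) Y(1)] U(2)] dd_linear[OF blr dY] by auto
  have "b x0 (dd w Y x0) + b w t = 0" "b x0 (J (dd w Y x0)) + b w (J t) = 0"
    using dd_bilinear[OF b_bilinear did dY, of w] dd_bilinear[OF b_bilinear did dJY(1), of w] 0 Y(2)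
    by (simp_all add: ddid dJY)
  then show ?thesis
    by (intro exI[of _ "- dd w Y x0"])
       (simp add: b.minus_right J_lin eq_neg_iff_add_eq_0 add.commute)
qed


section \<open>The complex kernel of the flat form at a regular vector\<close>

definition "K x0 = {t. b x0 t = 0 \<and> b x0 (J t) = 0}"

lemma K_J: "t \<in> K x0 \<Longrightarrow> J t \<in> K x0"
  by (simp add: K_def J(2) b.minus_right)

lemma K_scale: "t \<in> K x0 \<Longrightarrow> r *\<^sub>R t \<in> K x0"
  by (simp add: K_def J_lin b.scaleR_right)

lemma unit_vector:
  assumes "t \<noteq> 0" obtains r where "r \<noteq> 0" "G (r *\<^sub>R t) (r *\<^sub>R t) = 1"
proof -
  have p: "G t t > 0" by (rule G(3)[OF assms])
  then have "G ((1 / sqrt (G t t)) *\<^sub>R t) ((1 / sqrt (G t t)) *\<^sub>R t) = 1"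
    by (simp add: G.scaleR_left G.scaleR_right field_simps)
  then show ?thesis using p by (intro that[of "1 / sqrt (G t t)"]) auto
qed

end

text \<open>\<open>x0\<close> is a regular vector in the sense of Moore: the rank of the complex map
  given by \<open>b x0\<close> is maximal. The bound 10 leaves room beyond the eight real
  conditions, two for each dimension of \<open>N\<close>, that cut out \<open>K x0\<close>.\<close>

locale kaehler_sff_regular = kaehler_sff N F G J \<alpha>
  for N :: "'m::finite lspace set" and F :: "'m lspace"
    and G :: "real^'d \<Rightarrow> real^'d \<Rightarrow> real" and J :: "real^'d \<Rightarrow> real^'d::finite"
    and \<alpha> :: "real^'d \<Rightarrow> real^'d \<Rightarrow> 'm lspace" +
  fixes x0 :: "real^'d"
  assumes large: "CARD('d) \<ge> 10"
    and max: "\<And>x. dim (range (\<lambda>y. (b x y, b x (J y)))) \<le> dim (range (\<lambda>y. (b x0 y, b x0 (J y))))"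
begin

text \<open>The real part of the statement that the complex values of \<open>b\<close> at
  \<open>t\<close> are orthogonal to the range of \<open>b x0\<close>; \<open>J t\<close> in place
  of \<open>t\<close> gives the imaginary part.\<close>

lemma K_orth_range:
  assumes t: "t \<in> K x0"
  shows "lor (b w t) (b x0 u) = lor (b w (J t)) (b x0 (J u))"
  using b_flat[of w t x0 u] t by (simp add: K_def lor_simps)

text \<open>By \<open>b_kernel_sections\<close> the value \<open>b w t\<close> lies in the range of
  \<open>b x0\<close>, and flatness makes that range orthogonal to the values at
  \<open>t'\<close>.\<close>

lemma K_isotropic:
  assumes t: "t \<in> K x0" and t': "t' \<in> K x0"
  shows "lor (b w t) (b w' t') = lor (b w (J t)) (b w' (J t'))"
proof -
  obtain u where u: "b w t = b x0 u" "b w (J t) = b x0 (J u)"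
    using b_kernel_sections[OF max] t by (auto simp: K_def)
  show ?thesis using b_flat[of x0 u w' t'] t' by (simp add: u K_def lor_simps)
qed

lemma K_nonzero: obtains t where "t \<in> K x0" "G t t = 1"
proof -
  obtain B where B: "finite B" "card B = dim N" "\<And>p. p \<in> N \<Longrightarrow> (\<forall>w\<in>B. p \<bullet> w = 0) \<Longrightarrow> p = 0"
    using separating_functionals[OF N(1)] by blast
  let ?\<Phi> = "(\<lambda>w y. b x0 y \<bullet> w) ` B \<union> (\<lambda>w y. b x0 (J y) \<bullet> w) ` B"
  have "card ?\<Phi> \<le> card B + card B"
    by (intro order_trans[OF card_Un_le] add_mono card_image_le B(1))
  also have "\<dots> < DIM(real^'d)" using B(2) N(2) large by simp
  finally have c: "card ?\<Phi> < DIM(real^'d)" .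
  have f: "finite ?\<Phi>" using B(1) by simp
  have l: "linear \<phi>" if "\<phi> \<in> ?\<Phi>" for \<phi>
    using that by (auto intro!: linearI simp: b.add_right b.scaleR_right inner_add_left J_lin)
  obtain t where t: "t \<noteq> 0" "\<And>\<phi>. \<phi> \<in> ?\<Phi> \<Longrightarrow> \<phi> t = 0"
    using common_zero[OF f c l] by blast
  have "b x0 t = 0" "b x0 (J t) = 0"
    by (rule B(3)[OF b_N], use t(2) in blast)+
  then have "t \<in> K x0" by (simp add: K_def)
  moreover obtain r where "G (r *\<^sub>R t) (r *\<^sub>R t) = 1" using unit_vector[OF t(1)] by blast
  ultimately show ?thesis using that[of "r *\<^sub>R t"] K_scale by blast
qed

text \<open>Half, because \<open>lor (b t t) F = - 2 * G t t\<close> and the pairing with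
  \<open>F\<close> is to be -1 for a unit vector.\<close>

definition "\<eta> t = (1/2) *\<^sub>R b t t"

lemma \<eta>_basic:
  assumes "t \<in> K x0" "G t t = 1"
  shows "lor (\<eta> t) (\<eta> t) = 0" "lor (\<eta> t) F = -1" "\<eta> t \<in> N" "b t t = 2 *\<^sub>R \<eta> t"
  using K_isotropic[OF assms(1) assms(1), of t t]
  by (auto simp: \<eta>_def lor_simps b_self_J b_F assms(2) intro: subspace_scale[OF N(1)] b_N)

text \<open>Both vectors are null, pair to -1 with \<open>F\<close> and are orthogonal to each
  other, so their difference is null and orthogonal to \<open>F\<close> and \<open>\<eta> t\<close>,
  hence zero by \<open>lor_perp_pos\<close>.\<close>

lemma K_diag:
  assumes t: "t \<in> K x0" "G t t = 1" and t': "t' \<in> K x0" "G t' t' = 1"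
  shows "\<eta> t' = \<eta> t"
proof -
  note e = \<eta>_basic[OF t] and e' = \<eta>_basic[OF t']
  have "lor (\<eta> t') (\<eta> t) = 0"
    using K_isotropic[OF t'(1) t(1), of t' t] by (simp add: \<eta>_def lor_simps b_self_J)
  then have "\<eta> t' - \<eta> t = 0"
    using e e' by (intro lor_perp_pos(2)[OF F(2) e(2)]) (simp_all add: lor_simps lor_sym[of "\<eta> t" "\<eta> t'"])
  then show ?thesis by simp
qed

lemma K_diag_general:
  assumes t: "t \<in> K x0" "G t t = 1" and t': "t' \<in> K x0" "t' \<noteq> 0"
  shows "b t' t' = (2 * G t' t') *\<^sub>R \<eta> t"
proof -
  obtain r where r: "r \<noteq> 0" "G (r *\<^sub>R t') (r *\<^sub>R t') = 1" using unit_vector[OF t'(2)] by blast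
  have 1: "\<eta> (r *\<^sub>R t') = \<eta> t" by (rule K_diag[OF t K_scale[OF t'(1)] r(2)])
  have 2: "r * r * G t' t' = 1" using r(2) by (simp add: G.scaleR_left G.scaleR_right mult.assoc)
  have 3: "\<eta> (r *\<^sub>R t') = (r * r / 2) *\<^sub>R b t' t'" by (simp add: \<eta>_def b.scaleR_left b.scaleR_right)
  have "(2 * G t' t') *\<^sub>R \<eta> t = (r * r * G t' t') *\<^sub>R b t' t'"
    unfolding 1[symmetric] 3 by (simp add: algebra_simps)
  then show ?thesis using 2 by simp
qed

lemma K_off_diag_facts:
  assumes t: "t \<in> K x0" "G t t = 1" and w: "G w t = 0" "G w (J t) = 0"
  shows "lor (b w t) F = 0" "lor (b w (J t)) F = 0" "lor (b w t) (\<eta> t) = 0" "lor (b w (J t)) (\<eta> t) = 0"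
    "lor (b w (J t)) (b w (J t)) = lor (b w t) (b w t)" "lor (b w t) (b w (J t)) = 0"
proof -
  show "lor (b w t) F = 0" "lor (b w (J t)) F = 0" using w by (simp_all add: b_F)
  show "lor (b w t) (\<eta> t) = 0"
    using K_isotropic[OF t(1) t(1), of w t] by (simp add: \<eta>_def lor_simps b_self_J)
  show "lor (b w (J t)) (\<eta> t) = 0"
    using K_isotropic[OF K_J[OF t(1)] t(1), of w t] by (simp add: \<eta>_def lor_simps b_self_J)
  show "lor (b w (J t)) (b w (J t)) = lor (b w t) (b w t)"
    using K_isotropic[OF t(1) t(1), of w w] by simp
  show "lor (b w t) (b w (J t)) = 0"
    using K_isotropic[OF t(1) K_J[OF t(1)], of w w]
    by (simp add: J(2) b.minus_right lor_simps lor_sym[of "b w (J t)"])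
qed

text \<open>Otherwise \<open>u = b w t\<close> and \<open>v = b w (J t)\<close> are orthogonal of
  equal positive length and fill the positive plane of \<open>N\<close>. A vector \<open>s\<close>
  annihilated by eight functionals then lies in \<open>K x0\<close> and satisfies
  \<open>b w s = b w (J s) = 0\<close>. Flatness with \<open>s\<close> makes \<open>b w w\<close>
  orthogonal to \<open>\<eta> t\<close>, while flatness with \<open>t\<close> gives
  \<open>2 * lor (b w w) (\<eta> t) = lor u u + lor v v > 0\<close>.\<close>

lemma K_off_diag:
  assumes t: "t \<in> K x0" "G t t = 1" and w: "G w t = 0" "G w (J t) = 0"
  shows "b w t = 0 \<and> b w (J t) = 0"
proof (rule ccontr)
  assume ne: "\<not> ?thesis"
  let ?u = "b w t" and ?v = "b w (J t)"
  note e = \<eta>_basic[OF t]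
  note f = K_off_diag_facts[OF t w]
  have uu: "lor ?u ?u > 0"
  proof (rule ccontr)
    assume "\<not> lor ?u ?u > 0"
    then have "lor ?u ?u = 0" "lor ?v ?v = 0"
      using lor_perp_pos(1)[OF F(2) e(2) f(1,3)] f(5) by auto
    then show False using ne lor_perp_pos(2)[OF F(2) e(2)] f by blast
  qed
  then have vv: "lor ?v ?v > 0" using f(5) by simp
  note perp = perp_independent[OF e(1-3) b_N f(1,3) uu b_N f(2,4) vv f(6)]
  let ?\<phi>s = "[\<lambda>y. G x0 y, \<lambda>y. G x0 (J y), \<lambda>y. lor (b x0 y) ?u, \<lambda>y. lor (b x0 y) ?v,
    \<lambda>y. G w y, \<lambda>y. G w (J y), \<lambda>y. lor (b w y) ?u, \<lambda>y. lor (b w y) ?v]"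
  let ?\<Phi> = "set ?\<phi>s"
  have c: "card ?\<Phi> < DIM(real^'d)"
  proof -
    have "card ?\<Phi> \<le> length ?\<phi>s" by (rule card_length)
    then show ?thesis using large by simp
  qed
  have l: "linear \<phi>" if "\<phi> \<in> ?\<Phi>" for \<phi>
    using that by (auto intro!: linearI simp: b.add_right b.scaleR_right J_lin lor_simps G.add_right G.scaleR_right)
  obtain s where s: "s \<noteq> 0" "\<And>\<phi>. \<phi> \<in> ?\<Phi> \<Longrightarrow> \<phi> s = 0"
    using common_zero[OF _ c l] by auto
  have s0: "G x0 s = 0" "G x0 (J s) = 0" "lor (b x0 s) ?u = 0" "lor (b x0 s) ?v = 0"
    "G w s = 0" "G w (J s) = 0" "lor (b w s) ?u = 0" "lor (b w s) ?v = 0"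
    by (rule s(2)[of "\<lambda>y. G x0 y"] s(2)[of "\<lambda>y. G x0 (J y)"] s(2)[of "\<lambda>y. lor (b x0 y) ?u"]
        s(2)[of "\<lambda>y. lor (b x0 y) ?v"] s(2)[of "\<lambda>y. G w y"] s(2)[of "\<lambda>y. G w (J y)"]
        s(2)[of "\<lambda>y. lor (b w y) ?u"] s(2)[of "\<lambda>y. lor (b w y) ?v"], simp)+
  have \<eta>_range: "lor (b x0 u) (\<eta> t) = 0" for u
    using K_orth_range[OF t(1), of t u] by (simp add: \<eta>_def lor_simps b_self_J lor_sym[of _ "b t t"])
  have p: "b x0 s = 0"
    by (rule perp) (simp_all add: b_N b_F s0 \<eta>_range)
  \<comment> \<open>The products of \<open>b x0 (J s)\<close> with \<open>?u\<close> and
    \<open>?v\<close> vanish by flatness, so they cost no further functionals and the count stays at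
    eight.\<close>
  have q: "b x0 (J s) = 0"
  proof (rule perp)
    show "lor (b x0 (J s)) ?v = 0"
      using K_orth_range[OF t(1), of w s] by (simp add: p lor_simps lor_sym[of _ ?v])
    show "lor (b x0 (J s)) ?u = 0"
      using K_orth_range[OF K_J[OF t(1)], of w s] by (simp add: p lor_simps J(2) b.minus_right lor_sym[of _ ?u])
  qed (simp_all add: b_N b_F s0 \<eta>_range)
  have sK: "s \<in> K x0" using p q by (simp add: K_def)
  have \<eta>s: "lor (b w s') (\<eta> t) = 0" if "s' \<in> K x0" for s'
    using K_isotropic[OF that t(1), of w t] by (simp add: \<eta>_def lor_simps b_self_J)
  have ws: "b w s = 0"
    by (rule perp) (simp_all add: b_N b_F s0 \<eta>s[OF sK])
  have "lor (b w (J s)) (b w (J s)) = 0"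
    using K_isotropic[OF sK sK, of w w] by (simp add: ws lor_simps)
  then have wJs: "b w (J s) = 0"
    using lor_perp_pos(2)[OF F(2) e(2)] \<eta>s[OF K_J[OF sK]] s0 by (simp add: b_F)
  have "lor (b w w) (b s s) = 0"
    using b_flat[of w w s s] by (simp add: b_self_J ws wJs lor_simps)
  then have "G s s * lor (b w w) (\<eta> t) = 0"
    by (simp add: K_diag_general[OF t sK s(1)] lor_simps)
  then have 0: "lor (b w w) (\<eta> t) = 0" using G(3)[OF s(1)] by simp
  have "2 * lor (b w w) (\<eta> t) = lor ?u ?u + lor ?v ?v"
    using b_flat[of w w t t] b_J_swap[of w t] b_sym[of "J w" t] b_sym[of t w]
    by (simp add: b_self_J e(4) lor_simps)
  then show False using 0 uu vv by simp
qed

text \<open>Split \<open>y\<close> into components along \<open>t\<close> and \<open>J t\<close> and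
  a remainder orthogonal to both; \<open>K_off_diag\<close> removes the remainder and
  \<open>b_self_J\<close> the second component.\<close>

lemma K_umbilic:
  assumes t: "t \<in> K x0" "G t t = 1"
  shows "b y t = (2 * G y t) *\<^sub>R \<eta> t"
proof -
  let ?w = "y - G y t *\<^sub>R t - G y (J t) *\<^sub>R J t"
  have "G (J t) (J t) = 1" using t J(3) by simp
  then have "G ?w t = 0" "G ?w (J t) = 0"
    using t(2) by (simp_all add: G.diff_left G.scaleR_left G_self_J)
  then have "b ?w t = 0" using K_off_diag[OF t] by blast
  moreover have "b (J t) t = 0" using b_self_J[of t] b_sym[of t] by simp
  ultimately show ?thesis using \<eta>_basic(4)[OF t] by (simp add: b.diff_left b.scaleR_left)
qed

text \<open>The range of \<open>b x0\<close> lies in the complement of \<open>\<eta> t\<close> in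
  \<open>N\<close>, of dimension at most three because \<open>F\<close> is not in it. Six conditions
  for the kernel and two for orthogonality to \<open>t\<close> and \<open>J t\<close> are still
  fewer than ten.\<close>

lemma second_umbilic:
  assumes t: "t \<in> K x0" "G t t = 1"
  obtains s where "s \<in> K x0" "G s s = 1" "G t s = 0" "G (J t) s = 0"
proof -
  note e = \<eta>_basic[OF t]
  define N3 where "N3 = {p \<in> N. lor p (\<eta> t) = 0}"
  have N3: "subspace N3"
    using N(1) by (auto simp: N3_def subspace_def lor_simps)
  have "F \<notin> N3" using e(2) by (simp add: N3_def lor_sym[of F])
  then have "N3 \<subset> N" using F(1) by (auto simp: N3_def)
  then have d3: "dim N3 < dim N"
    using N3 N(1) by (intro dim_psubset) (simp add: span_eq_iff[THEN iffD2])
  obtain B where B: "finite B" "card B = dim N3" "\<And>p. p \<in> N3 \<Longrightarrow> (\<forall>w\<in>B. p \<bullet> w = 0) \<Longrightarrow> p = 0"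
    using separating_functionals[OF N3] by blast
  let ?\<Phi> = "(\<lambda>w y. b x0 y \<bullet> w) ` B \<union> (\<lambda>w y. b x0 (J y) \<bullet> w) ` B \<union> {\<lambda>y. G t y, \<lambda>y. G (J t) y}"
  have "card ?\<Phi> \<le> card B + card B + 2"
    by (intro order_trans[OF card_Un_le] add_mono card_image_le B(1)) (auto intro: order_trans[OF card_insert_le_m1])
  also have "\<dots> < DIM(real^'d)" using B(2) d3 N(2) large by simp
  finally have c: "card ?\<Phi> < DIM(real^'d)" .
  have f: "finite ?\<Phi>" using B(1) by simp
  have l: "linear \<phi>" if "\<phi> \<in> ?\<Phi>" for \<phi>
    using that by (auto intro!: linearI simp: b.add_right b.scaleR_right inner_add_left J_lin G.add_right G.scaleR_right)
  obtain s where s: "s \<noteq> 0" "\<And>\<phi>. \<phi> \<in> ?\<Phi> \<Longrightarrow> \<phi> s = 0"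
    using common_zero[OF f c l] by blast
  have "lor (b x0 u) (\<eta> t) = 0" for u
    using K_orth_range[OF t(1), of t u] by (simp add: \<eta>_def lor_simps b_self_J lor_sym[of _ "b t t"])
  then have r: "b x0 u \<in> N3" for u by (simp add: N3_def b_N)
  have "b x0 s = 0" "b x0 (J s) = 0"
    by (rule B(3)[OF r], use s(2) in blast)+
  then have sK: "s \<in> K x0" by (simp add: K_def)
  have o: "G t s = 0" "G (J t) s = 0" using s(2) by simp_all
  obtain k where "G (k *\<^sub>R s) (k *\<^sub>R s) = 1" using unit_vector[OF s(1)] by blast
  then show ?thesis using that[of "k *\<^sub>R s"] K_scale[OF sK] o by (simp add: G.scaleR_right)
qed

text \<open>This is \<open>ab_mixed\<close> with \<open>w = u = t\<close>: its right-hand side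
  contains the factors \<open>b z t\<close> and \<open>b z (J t)\<close>, which vanish, and its
  left-hand side is twice the product in question.\<close>

lemma a_perp_\<eta>:
  assumes t: "t \<in> K x0" "G t t = 1" and z: "G z t = 0" "G z (J t) = 0"
  shows "lor (a z v) (\<eta> t) = 0"
proof -
  have "b z t = 0" using K_umbilic[OF t] z by simp
  moreover have "b z (J t) = 0" using K_off_diag[OF t z] by blast
  ultimately show ?thesis
    using ab_mixed[of z v t t] by (simp add: b_self_J \<eta>_basic(4)[OF t] lor_simps)
qed

text \<open>\<open>\<alpha>\<close> is half of \<open>a + b\<close>. For \<open>a\<close>, the lemma
  \<open>a_perp_\<eta>\<close> leaves out the directions \<open>t\<close> and \<open>J t\<close>; a
  second unit kernel vector \<open>s\<close> orthogonal to them, with the same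
  \<open>\<eta>\<close>, covers them. For \<open>b\<close>, flatness with two arguments
  \<open>t\<close> reduces the product to multiples of
  \<open>lor (\<eta> t) (\<eta> t) = 0\<close>.\<close>

lemma \<alpha>_perp_\<eta>:
  assumes t: "t \<in> K x0" "G t t = 1"
  shows "lor (\<alpha> x y) (\<eta> t) = 0"
proof -
  note e = \<eta>_basic[OF t]
  obtain s where s: "s \<in> K x0" "G s s = 1" and ts: "G t s = 0" "G (J t) s = 0" using second_umbilic[OF t] .
  have ts': "G t (J s) = 0" "G (J t) (J s) = 0" using ts G_J_swap[of t s] J(3) by simp_all
  have \<eta>s: "\<eta> s = \<eta> t" by (rule K_diag[OF t s])
  have at: "lor (a t v) (\<eta> t) = 0" "lor (a (J t) v) (\<eta> t) = 0" for v
    using a_perp_\<eta>[OF s ts(1) ts'(1), of v] a_perp_\<eta>[OF s ts(2) ts'(2), of v] \<eta>s by simp_all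
  let ?w = "x - G x t *\<^sub>R t - G x (J t) *\<^sub>R J t"
  have "G (J t) (J t) = 1" using t J(3) by simp
  then have "G ?w t = 0" "G ?w (J t) = 0"
    using t(2) by (simp_all add: G.diff_left G.scaleR_left G_self_J)
  then have "lor (a ?w y) (\<eta> t) = 0" by (rule a_perp_\<eta>[OF t])
  moreover have "a ?w y = a x y - G x t *\<^sub>R a t y - G x (J t) *\<^sub>R a (J t) y"
    by (simp add: a_def J_lin \<alpha>.diff_left \<alpha>.add_left \<alpha>.scaleR_left \<alpha>.minus_left J(2) algebra_simps)
  ultimately have a0: "lor (a x y) (\<eta> t) = 0" by (simp add: lor_simps at)
  have bJ: "b u (J t) = (2 * G u (J t)) *\<^sub>R \<eta> t" for u
    using K_umbilic[OF t, of "J u"] b_J_swap[of u t] G_J_swap[of u t] by (simp add: minus_equation_iff[of "b u (J t)"])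
  have "lor (b x y) (b t t) = 0"
    using b_flat[of x y t t] K_umbilic[OF t, of x] K_umbilic[OF t, of y] bJ[of x] b_sym[of t y] b_sym[of t "J y"]
      K_umbilic[OF t, of "J y"]
    by (simp add: b_self_J lor_simps e(1))
  then have "lor (b x y) (\<eta> t) = 0" by (simp add: \<eta>_def lor_simps)
  moreover have "\<alpha> x y = (1/2) *\<^sub>R (a x y + b x y)" by (simp add: a_def b_def scaleR_2[symmetric])
  ultimately show ?thesis using a0 by (simp add: lor_simps)
qed

end

text \<open>Half of \<open>\<alpha> t t + \<alpha> (J t) (J t)\<close> is the null normal: being
  orthogonal to all values of \<open>\<alpha>\<close>, it is orthogonal to itself. It is written
  through \<open>\<alpha>\<close> alone so that it becomes a solution of a linear system in a
  chart.\<close>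

theorem (in kaehler_sff) null_normal_exists:
  assumes "CARD('d) \<ge> 10"
  obtains t where "G t t = 1" "\<And>x y. lor (\<alpha> x y) (\<alpha> t t + \<alpha> (J t) (J t)) = 0"
proof -
  obtain x0 where max: "\<And>x. dim (range (\<lambda>y. (b x y, b x (J y)))) \<le> dim (range (\<lambda>y. (b x0 y, b x0 (J y))))"
    using max_dim_point[of undefined UNIV "\<lambda>x. range (\<lambda>y. (b x y, b x (J y)))"] by auto
  interpret kaehler_sff_regular N F G J \<alpha> x0
    by unfold_locales (use assms max in auto)
  obtain t where t: "t \<in> K x0" "G t t = 1" using K_nonzero .
  have "\<alpha> t t + \<alpha> (J t) (J t) = 2 *\<^sub>R \<eta> t" using \<eta>_basic(4)[OF t] by (simp add: b_def)
  then have "lor (\<alpha> x y) (\<alpha> t t + \<alpha> (J t) (J t)) = 0" for x y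
    by (simp only: lor.scaleR_right \<alpha>_perp_\<eta>[OF t]) simp
  then show ?thesis using that t(2) by blast
qed

section \<open>The derivative of the null normal: Codazzi equation and rank\<close>

locale kaehler_sff_codazzi = kaehler_sff N F G J \<alpha>
  for N :: "'m::finite lspace set" and F :: "'m lspace"
    and G :: "real^'d \<Rightarrow> real^'d \<Rightarrow> real" and J :: "real^'d \<Rightarrow> real^'d::finite"
    and \<alpha> :: "real^'d \<Rightarrow> real^'d \<Rightarrow> 'm lspace" +
  fixes \<eta> :: "'m lspace" and \<omega> :: "real^'d \<Rightarrow> 'm lspace"
  assumes large: "CARD('d) \<ge> 10"
    and \<eta>: "\<eta> \<in> N" "lor \<eta> \<eta> = 0" "lor \<eta> F = -1" "\<And>x y. lor (\<alpha> x y) \<eta> = 0"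
    and \<omega>: "linear \<omega>" "\<And>x. \<omega> x \<in> N" "\<And>x. lor (\<omega> x) F = 0" "\<And>x. lor (\<omega> x) \<eta> = 0"
    and codazzi: "\<And>x y z. lor (\<omega> x) (\<alpha> y z) = lor (\<omega> y) (\<alpha> x z)"
    and nonflat: "\<exists>x y z w. S x y z w \<noteq> 0"
begin

text \<open>Its values lie in the complement of \<open>F\<close> and \<open>\<eta>\<close> in
  \<open>N\<close>, which is positive definite of dimension at most two. As \<open>\<eta>\<close> is
  null and orthogonal to \<open>\<alpha>\<close>, the curvature is unchanged.\<close>

definition "\<alpha>' x y = \<alpha> x y - G x y *\<^sub>R \<eta>"

lemma \<alpha>'_bilinear: "bounded_bilinear \<alpha>'"
proof -
  have "bilinear \<alpha>'" unfolding bilinear_def \<alpha>'_def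
    by (auto intro!: linearI simp: \<alpha>.add_left \<alpha>.add_right \<alpha>.scaleR_left \<alpha>.scaleR_right
        G.add_left G.add_right G.scaleR_left G.scaleR_right algebra_simps)
  then show ?thesis by (simp add: bilinear_conv_bounded_bilinear)
qed

sublocale \<alpha>': bounded_bilinear \<alpha>' by (rule \<alpha>'_bilinear)

lemma \<alpha>'_sym: "\<alpha>' x y = \<alpha>' y x"
  by (simp add: \<alpha>'_def \<alpha>(2)[of x y] G(2)[of x y])

lemma \<alpha>'_normal: "\<alpha>' x y \<in> N" "lor (\<alpha>' x y) F = 0" "lor (\<alpha>' x y) \<eta> = 0"
  using \<alpha>(3) \<eta> subspace_diff[OF N(1)] subspace_scale[OF N(1)]
  by (auto simp: \<alpha>'_def lor_simps \<alpha>F)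

lemma S_\<alpha>': "S x y z w = lor (\<alpha>' x w) (\<alpha>' y z) - lor (\<alpha>' x z) (\<alpha>' y w)"
  by (simp add: S_def \<alpha>'_def lor_simps \<eta>(2,4) lor_sym[of \<eta> "\<alpha> _ _"])

lemma \<omega>_\<alpha>': "lor (\<omega> x) (\<alpha>' y z) = lor (\<omega> x) (\<alpha> y z)"
  by (simp add: \<alpha>'_def lor_simps \<omega>(4))

lemma codazzi': "lor (\<omega> x) (\<alpha>' y z) = lor (\<omega> y) (\<alpha>' x z)"
  by (simp add: \<omega>_\<alpha>' codazzi)

lemma \<omega>_lin: "\<omega> (x + y) = \<omega> x + \<omega> y" "\<omega> (r *\<^sub>R x) = r *\<^sub>R \<omega> x" "\<omega> (x - y) = \<omega> x - \<omega> y"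
  by (simp_all add: linear_add[OF \<omega>(1)] linear_scale[OF \<omega>(1)] linear_diff[OF \<omega>(1)])

lemma \<omega>_pos: "\<omega> x \<noteq> 0 \<Longrightarrow> lor (\<omega> x) (\<omega> x) > 0"
  using lor_perp_pos[OF F(2) \<eta>(3) \<omega>(3,4)[of x]] by (smt (verit))

lemma plane_zero:
  assumes "\<omega> x1 \<noteq> 0" "\<omega> x2 \<noteq> 0" "lor (\<omega> x1) (\<omega> x2) = 0"
    and p: "p \<in> N" "lor p F = 0" "lor p \<eta> = 0" "lor p (\<omega> x1) = 0" "lor p (\<omega> x2) = 0"
  shows "p = 0"
  by (rule perp_independent[OF \<eta>(2,3,1) \<omega>(2-4) \<omega>_pos[OF assms(1)] \<omega>(2-4) \<omega>_pos[OF assms(2)] assms(3) p])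

text \<open>If the values of \<open>\<omega>\<close> fill the positive plane, the Codazzi equation
  moves \<open>y\<close> into \<open>\<omega>\<close>, so \<open>\<alpha>' y z\<close> is orthogonal
  to that plane.\<close>

lemma rank_two_kernel:
  assumes "\<omega> x1 \<noteq> 0" "\<omega> x2 \<noteq> 0" "lor (\<omega> x1) (\<omega> x2) = 0" and y: "\<omega> y = 0"
  shows "\<alpha>' y z = 0"
proof (rule plane_zero[OF assms(1-3)])
  show "lor (\<alpha>' y z) (\<omega> x1) = 0" "lor (\<alpha>' y z) (\<omega> x2) = 0"
    using codazzi'[of x1 y z] codazzi'[of x2 y z] by (simp_all add: y lor_simps lor_sym[of "\<alpha>' y z"])
qed (rule \<alpha>'_normal)+

lemma rank_one:
  assumes u: "\<omega> x1 \<noteq> 0" and no: "\<And>x. lor (\<omega> x1) (\<omega> x) = 0 \<Longrightarrow> \<omega> x = 0"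
  shows "\<omega> x = (lor (\<omega> x1) (\<omega> x) / lor (\<omega> x1) (\<omega> x1)) *\<^sub>R \<omega> x1"
proof -
  let ?\<tau> = "lor (\<omega> x1) (\<omega> x) / lor (\<omega> x1) (\<omega> x1)"
  have "\<omega> (x - ?\<tau> *\<^sub>R x1) = 0"
    by (rule no) (use \<omega>_pos[OF u] in \<open>simp add: \<omega>_lin lor_simps\<close>)
  then show ?thesis by (simp add: \<omega>_lin)
qed

text \<open>If the image of \<open>\<omega>\<close> is a line, the curvature is that of the scalar form \<open>B\<close>, so the kernel of \<open>B\<close> is invariant
  under \<open>J\<close> and has codimension at most two.\<close>

lemma exists_null_direction:
  assumes ne: "\<omega> x1 \<noteq> 0"
  obtains y where "y \<noteq> 0" "\<And>z. \<alpha>' y z = 0" "\<And>z. \<alpha>' (J y) z = 0" "\<omega> y = 0" "\<omega> (J y) = 0"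
proof (cases "\<exists>x2. \<omega> x2 \<noteq> 0 \<and> lor (\<omega> x1) (\<omega> x2) = 0")
  case True
  then obtain x2 where x2: "\<omega> x2 \<noteq> 0" "lor (\<omega> x1) (\<omega> x2) = 0" by blast
  let ?\<phi>s = "[\<lambda>y. lor (\<omega> y) (\<omega> x1), \<lambda>y. lor (\<omega> y) (\<omega> x2), \<lambda>y. lor (\<omega> (J y)) (\<omega> x1), \<lambda>y. lor (\<omega> (J y)) (\<omega> x2)]"
  have c: "card (set ?\<phi>s) < DIM(real^'d)" using card_length[of ?\<phi>s] large by simp
  have l: "linear \<phi>" if "\<phi> \<in> set ?\<phi>s" for \<phi>
    using that by (auto intro!: linearI simp: \<omega>_lin J_lin lor_simps)
  obtain y where y: "y \<noteq> 0" "\<And>\<phi>. \<phi> \<in> set ?\<phi>s \<Longrightarrow> \<phi> y = 0"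
    using common_zero[OF finite_set c l] by blast
  have 1: "\<omega> y = 0"
    by (rule plane_zero[OF ne x2 \<omega>(2-4)] ; rule y(2)[of "\<lambda>y. lor (\<omega> y) (\<omega> x1)"] y(2)[of "\<lambda>y. lor (\<omega> y) (\<omega> x2)"]; simp)
  have 2: "\<omega> (J y) = 0"
    by (rule plane_zero[OF ne x2 \<omega>(2-4)] ; rule y(2)[of "\<lambda>y. lor (\<omega> (J y)) (\<omega> x1)"] y(2)[of "\<lambda>y. lor (\<omega> (J y)) (\<omega> x2)"]; simp)
  show ?thesis
    by (rule that[OF y(1) rank_two_kernel[OF ne x2 1] rank_two_kernel[OF ne x2 2] 1 2])
next
  case False
  let ?u = "\<omega> x1"
  define \<tau> where "\<tau> x = lor ?u (\<omega> x) / lor ?u ?u" for x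
  have uu: "lor ?u ?u > 0" by (rule \<omega>_pos[OF ne])
  have \<omega>\<tau>: "\<omega> x = \<tau> x *\<^sub>R ?u" for x
    unfolding \<tau>_def by (rule rank_one[OF ne]) (use False in blast)
  have \<tau>1: "\<tau> x1 = 1" using uu by (simp add: \<tau>_def)
  define \<kappa> where "\<kappa> = lor ?u (\<alpha>' x1 x1)"
  have c1: "\<tau> x * lor ?u (\<alpha>' y z) = \<tau> y * lor ?u (\<alpha>' x z)" for x y z
    using codazzi'[of x y z] by (simp add: \<omega>\<tau>[of x] \<omega>\<tau>[of y] lor_simps)
  have \<alpha>1: "lor ?u (\<alpha>' y z) = \<tau> y * \<tau> z * \<kappa>" for y z
    using c1[of x1 y z] c1[of x1 z x1] \<tau>1 by (simp add: \<kappa>_def \<alpha>'_sym[of x1 z])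
  \<comment> \<open>The component of \<open>\<alpha>'\<close> orthogonal to \<open>?u\<close>. The
    other component is a multiple of \<open>\<tau> x * \<tau> y\<close> by \<open>\<alpha>1\<close>
    and contributes nothing to the curvature, which is therefore that of \<open>A\<close>
    alone.\<close>
  define A where "A x y = \<alpha>' x y - (lor ?u (\<alpha>' x y) / lor ?u ?u) *\<^sub>R ?u" for x y
  have A_normal: "A x y \<in> N" "lor (A x y) F = 0" "lor (A x y) \<eta> = 0" "lor (A x y) ?u = 0" for x y
    using \<alpha>'_normal[of x y] \<omega>(2-4)[of x1] subspace_diff[OF N(1)] subspace_scale[OF N(1)] uu
    by (auto simp: A_def lor_simps lor_sym[of "\<alpha>' x y" ?u])
  have A_dec: "\<alpha>' x y = A x y + (\<tau> x * \<tau> y * \<kappa> / lor ?u ?u) *\<^sub>R ?u" for x y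
    by (simp add: A_def \<alpha>1)
  have uA: "lor ?u (A x y) = 0" for x y using A_normal(4)[of x y] by (simp add: lor_sym)
  have SA: "S x y z w = lor (A x w) (A y z) - lor (A x z) (A y w)" for x y z w
    unfolding S_\<alpha>' A_dec using uu by (simp add: lor_simps A_normal uA field_simps)
  obtain x y z w where S: "S x y z w \<noteq> 0" using nonflat by blast
  have "\<exists>p q. A p q \<noteq> 0"
    using S unfolding SA by (metis diff_self lor.zero_left)
  then obtain p q where pq: "A p q \<noteq> 0" by blast
  let ?v = "A p q"
  have vv: "lor ?v ?v > 0"
    using lor_perp_pos[OF F(2) \<eta>(3) A_normal(2,3)[of p q]] pq by (smt (verit))
  note perp = perp_independent[OF \<eta>(2,3,1) \<omega>(2-4)[of x1] uu A_normal(1-3)[of p q] vv uA]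
  define B where "B x y = lor (\<alpha>' x y) ?v" for x y
  have B_lin: "B x (r *\<^sub>R y) = r * B x y" "B x (y + y') = B x y + B x y'" "B x (- y) = - B x y" for x y y' r
    by (simp_all add: B_def \<alpha>'.scaleR_right \<alpha>'.add_right \<alpha>'.minus_right lor_simps)
  have B_sym: "B x y = B y x" for x y by (simp add: B_def \<alpha>'_sym[of x y])
  have BA: "lor (A x y) ?v = B x y" for x y by (simp add: B_def A_dec[of x y] lor_simps uA)
  have AB: "A x y = (B x y / lor ?v ?v) *\<^sub>R ?v" for x y
  proof -
    have "A x y - (B x y / lor ?v ?v) *\<^sub>R ?v = 0"
      by (rule perp) (use A_normal subspace_diff[OF N(1)] subspace_scale[OF N(1)] vv in \<open>auto simp: lor_simps BA\<close>)
    then show ?thesis by simp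
  qed
  have SB: "S x y z w * lor ?v ?v = B x w * B y z - B x z * B y w" for x y z w
  proof -
    have seq: "S x y z w = (B x w * B y z / (lor ?v ?v * lor ?v ?v)) * lor ?v ?v - (B x z * B y w / (lor ?v ?v * lor ?v ?v)) * lor ?v ?v"
      unfolding SA by (subst AB[of x w], subst AB[of y z], subst AB[of x z], subst AB[of y w]) (simp add: lor_simps mult.commute)
    have gen: "((p / (r * r)) * r - (q / (r * r)) * r) * r = p - q" if "r \<noteq> 0" for p q r :: real
      using that by (simp add: field_simps)
    show ?thesis unfolding seq by (rule gen) (use vv in simp)
  qed
  define D where "D = B x w * B y z - B x z * B y w"
  have D: "D \<noteq> 0" using SB[of x y z w] S vv by (auto simp: D_def)
  \<comment> \<open>\<open>S x y (J k) h = - S x y k (J h) = 0\<close> gives, for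
    \<open>h = w\<close> and \<open>h = z\<close>, two linear equations for \<open>B x (J k)\<close>
    and \<open>B y (J k)\<close> whose determinant is \<open>D\<close> up to sign.\<close>
  have JD: "B x (J k) = 0 \<and> B y (J k) = 0" if k: "B x k = 0" "B y k = 0" for k
  proof -
    have e: "B x h * B y (J k) - B x (J k) * B y h = 0" for h
      using SB[of x y "J k" h] SB[of x y k "J h"] S_J_swap(1)[of x y k h] k by simp
    have "D * B y (J k) = B y z * (B x w * B y (J k) - B x (J k) * B y w) - B y w * (B x z * B y (J k) - B x (J k) * B y z)"
      by (simp add: D_def algebra_simps)
    then have 1: "D * B y (J k) = 0" by (simp only: e mult_zero_right diff_self)
    have "D * B x (J k) = B x z * (B x w * B y (J k) - B x (J k) * B y w) - B x w * (B x z * B y (J k) - B x (J k) * B y z)"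
      by (simp add: D_def algebra_simps)
    then have 2: "D * B x (J k) = 0" by (simp only: e mult_zero_right diff_self)
    show ?thesis using D 1 2 by simp
  qed
  \<comment> \<open>Invariance of the curvature under \<open>J\<close> gives \<open>e1\<close> and
    \<open>e2\<close>, which have the shape of complex multiplication; for an \<open>l\<close> with
    \<open>B x l\<close> nonzero they force the sum of the squares of \<open>B h k\<close> and
    \<open>B h (J k)\<close> to vanish.\<close>
  have null: "B h k = 0" if k: "B x k = 0" "B y k = 0" for h k
  proof -
    have e1: "B x l * B h k = B x (J l) * B h (J k)" for l
      using SB[of x h k l] SB[of x h "J k" "J l"] S_J[of x h k l] k JD[OF k] by simp
    have e2: "B x (J l) * B h k = - (B x l * B h (J k))" for l
      using e1[of "J l"] by (simp add: J(2) B_lin)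
    have "B x l * (B h k * B h k + B h (J k) * B h (J k)) = 0" for l
    proof -
      have "B x l * (B h k * B h k + B h (J k) * B h (J k)) = (B x l * B h k) * B h k + B x l * B h (J k) * B h (J k)"
        by (simp add: algebra_simps)
      also have "\<dots> = (B x (J l) * B h k) * B h (J k) + B x l * B h (J k) * B h (J k)"
        by (subst e1) (simp add: algebra_simps)
      also have "\<dots> = 0" by (simp add: e2)
      finally show ?thesis .
    qed
    moreover have "\<exists>l. B x l \<noteq> 0" using D unfolding D_def by (metis diff_self mult_zero_left)
    ultimately have "B h k * B h k + B h (J k) * B h (J k) = 0" by (metis mult_eq_0_iff)
    then show ?thesis by (simp add: sum_squares_eq_zero_iff)
  qed
  let ?\<phi>s = "[\<lambda>k. B x k, \<lambda>k. B y k, \<lambda>k. \<tau> k, \<lambda>k. \<tau> (J k)]"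
  have c: "card (set ?\<phi>s) < DIM(real^'d)" using card_length[of ?\<phi>s] large by simp
  have l: "linear \<phi>" if "\<phi> \<in> set ?\<phi>s" for \<phi>
    using that by (auto intro!: linearI simp: \<tau>_def \<omega>_lin J_lin B_lin lor_simps add_divide_distrib)
  obtain k where k: "k \<noteq> 0" "\<And>\<phi>. \<phi> \<in> set ?\<phi>s \<Longrightarrow> \<phi> k = 0"
    using common_zero[OF finite_set c l] by blast
  have k0: "B x k = 0" "B y k = 0" "\<tau> k = 0" "\<tau> (J k) = 0"
    by (rule k(2)[of "\<lambda>k. B x k"] k(2)[of "\<lambda>k. B y k"] k(2)[of "\<lambda>k. \<tau> k"] k(2)[of "\<lambda>k. \<tau> (J k)"], simp)+
  have "B k h = 0" "B (J k) h = 0" for h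
    using null[OF k0(1,2), of h] null[of "J k" h] JD[OF k0(1,2)] by (auto simp: B_sym[of k h] B_sym[of "J k" h])
  then have "A k h = 0" "A (J k) h = 0" for h
    using AB[of k h] AB[of "J k" h] by simp_all
  then show ?thesis
    using that[of k] k(1) k0 \<omega>\<tau>[of k] \<omega>\<tau>[of "J k"] by (simp add: A_dec)
qed

text \<open>If \<open>\<omega>\<close> had rank two, its kernel would lie in that of
  \<open>\<alpha>'\<close>, so \<open>\<alpha>'\<close> would be determined by its values on
  \<open>x1\<close> and \<open>x2\<close>, and the whole curvature by the single number
  \<open>s\<close>. With \<open>\<alpha>' v\<close> written through \<open>x1\<close> and
  \<open>x2\<close>, the vanishing of \<open>\<alpha>' (J v)\<close> and invariance under
  \<open>J\<close> give \<open>a * s = b * s = 0\<close>. As \<open>\<alpha>' v x1\<close> is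
  nonzero, so is \<open>a\<close> or \<open>b\<close>, and the curvature would vanish.\<close>

lemma \<omega>_rank_one:
  assumes v: "\<And>x. \<alpha>' v x = - (c *\<^sub>R \<omega> x)" "c > 0" "\<And>x. \<alpha>' (J v) x = 0"
    and u: "\<omega> x1 \<noteq> 0"
  shows "\<omega> x = (lor (\<omega> x1) (\<omega> x) / lor (\<omega> x1) (\<omega> x1)) *\<^sub>R \<omega> x1"
proof (rule rank_one[OF u])
  fix x2 assume o: "lor (\<omega> x1) (\<omega> x2) = 0"
  show "\<omega> x2 = 0"
  proof (rule ccontr)
    assume w: "\<omega> x2 \<noteq> 0"
    let ?u = "\<omega> x1" and ?w = "\<omega> x2"
    have uu: "lor ?u ?u > 0" "lor ?w ?w > 0" using \<omega>_pos u w by blast+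
    have o': "lor ?w ?u = 0" using o by (simp add: lor_sym)
    have dec: "\<exists>a b. \<forall>z. \<alpha>' y z = a *\<^sub>R \<alpha>' x1 z + b *\<^sub>R \<alpha>' x2 z" for y
    proof -
      define a where "a = lor (\<omega> y) ?u / lor ?u ?u"
      define b where "b = lor (\<omega> y) ?w / lor ?w ?w"
      have "\<omega> (y - a *\<^sub>R x1 - b *\<^sub>R x2) = 0"
      proof (rule plane_zero[OF u w o \<omega>(2-4)])
        show "lor (\<omega> (y - a *\<^sub>R x1 - b *\<^sub>R x2)) ?u = 0" "lor (\<omega> (y - a *\<^sub>R x1 - b *\<^sub>R x2)) ?w = 0"
          using uu by (simp_all add: \<omega>_lin lor_simps o o' a_def b_def)
      qed
      from rank_two_kernel[OF u w o this] have "\<forall>z. \<alpha>' y z = a *\<^sub>R \<alpha>' x1 z + b *\<^sub>R \<alpha>' x2 z"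
        by (simp add: \<alpha>'.diff_left \<alpha>'.add_left \<alpha>'.scaleR_left algebra_simps)
      then show ?thesis by blast
    qed
    obtain a b where ab: "\<And>z. \<alpha>' v z = a *\<^sub>R \<alpha>' x1 z + b *\<^sub>R \<alpha>' x2 z" using dec by blast
    have Sv: "S x1 x2 z v = 0" for z
    proof -
      have "S x1 x2 (J z) (J v) = 0" by (simp add: S_\<alpha>' \<alpha>'_sym[of _ "J v"] v(3) lor_simps)
      then show ?thesis by (simp add: S_J)
    qed
    define s where "s = lor (\<alpha>' x1 x1) (\<alpha>' x2 x2) - lor (\<alpha>' x1 x2) (\<alpha>' x1 x2)"
    have "a * s = 0" "b * s = 0"
      using Sv[of x2] Sv[of x1]
      by (auto simp add: S_\<alpha>' \<alpha>'_sym[of _ v] ab lor_simps s_def \<alpha>'_sym[of x2 x1] lor_sym algebra_simps)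
    moreover have "a \<noteq> 0 \<or> b \<noteq> 0" using ab[of x1] v(1)[of x1] v(2) u by auto
    ultimately have s0: "s = 0" by auto
    have "S x y z t = 0" for x y z t
    proof -
      obtain a1 b1 where 1: "\<And>h. \<alpha>' x h = a1 *\<^sub>R \<alpha>' x1 h + b1 *\<^sub>R \<alpha>' x2 h" using dec by blast
      obtain a2 b2 where 2: "\<And>h. \<alpha>' y h = a2 *\<^sub>R \<alpha>' x1 h + b2 *\<^sub>R \<alpha>' x2 h" using dec by blast
      obtain a3 b3 where 3: "\<And>h. \<alpha>' z h = a3 *\<^sub>R \<alpha>' x1 h + b3 *\<^sub>R \<alpha>' x2 h" using dec by blast
      obtain a4 b4 where 4: "\<And>h. \<alpha>' t h = a4 *\<^sub>R \<alpha>' x1 h + b4 *\<^sub>R \<alpha>' x2 h" using dec by blast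
      define P where "P = \<alpha>' x1 x1"
      define Q where "Q = \<alpha>' x1 x2"
      define R where "R = \<alpha>' x2 x2"
      have Q': "\<alpha>' x2 x1 = Q" by (simp add: Q_def \<alpha>'_sym[of x2])
      have e: "\<alpha>' x1 h = k1 *\<^sub>R P + k2 *\<^sub>R Q" "\<alpha>' x2 h = k1 *\<^sub>R Q + k2 *\<^sub>R R"
        if "\<And>l. \<alpha>' h l = k1 *\<^sub>R \<alpha>' x1 l + k2 *\<^sub>R \<alpha>' x2 l" for h k1 k2
        using that[of x1] that[of x2] Q' by (simp_all add: \<alpha>'_sym[of x1 h] \<alpha>'_sym[of x2 h] P_def Q_def R_def)
      have 5: "\<alpha>' x h = (a1 * k1) *\<^sub>R P + (a1 * k2 + b1 * k1) *\<^sub>R Q + (b1 * k2) *\<^sub>R R"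
        if "\<And>l. \<alpha>' h l = k1 *\<^sub>R \<alpha>' x1 l + k2 *\<^sub>R \<alpha>' x2 l" for h k1 k2
        by (simp add: 1 e[OF that] algebra_simps)
      have 6: "\<alpha>' y h = (a2 * k1) *\<^sub>R P + (a2 * k2 + b2 * k1) *\<^sub>R Q + (b2 * k2) *\<^sub>R R"
        if "\<And>l. \<alpha>' h l = k1 *\<^sub>R \<alpha>' x1 l + k2 *\<^sub>R \<alpha>' x2 l" for h k1 k2
        by (simp add: 2 e[OF that] algebra_simps)
      have PR: "lor P R = lor Q Q" using s0 by (simp add: s_def P_def Q_def R_def)
      show ?thesis
        unfolding S_\<alpha>' 5[OF 3] 5[OF 4] 6[OF 3] 6[OF 4]
        by (simp add: lor_simps lor_sym[of R P] lor_sym[of Q P] lor_sym[of R Q] PR algebra_simps)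
    qed
    then show False using nonflat by blast
  qed
qed

end

lemma partial_eq_dd: "partial i f x = dd (axis i 1) f x"
  by (simp add: partial_def dd_def)

section \<open>The light-cone lift in a chart\<close>

text \<open>Used both for the coordinate frame of \<open>F\<close> and for its image under the parallel complex structure; comparing the
  two Gauss equations gives the Kaehler symmetry of the second fundamental form.\<close>

locale adapted_frame =
  fixes W :: "(real^'d::finite) set" and g :: "real^'d \<Rightarrow> real^'d^'d"
    and \<phi> :: "'d \<Rightarrow> real^'d \<Rightarrow> 'm::finite lspace" and A :: "'d \<Rightarrow> 'd \<Rightarrow> real^'d \<Rightarrow> 'm lspace"
  assumes W: "open W"
    and smooth_\<Gamma>: "\<And>k i j. smooth_on (christoffel g k i j) W"
    and smooth_\<phi>: "\<And>j. smooth_on (\<phi> j) W"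
    and smooth_A: "\<And>i j. smooth_on (A i j) W"
    and deriv_\<phi>: "\<And>x i j. x \<in> W \<Longrightarrow>
        dd (axis i 1) (\<phi> j) x = (\<Sum>l\<in>UNIV. christoffel g l i j x *\<^sub>R \<phi> l x) + A i j x"
    and A_normal: "\<And>x i j w. x \<in> W \<Longrightarrow> lor (A i j x) (\<phi> w x) = 0"
    and gram: "\<And>x l w. x \<in> W \<Longrightarrow> lor (\<phi> l x) (\<phi> w x) = g x $ l $ w"
begin

lemma second_deriv:
  assumes x: "x \<in> W"
  shows "dd (axis k 1) (dd (axis i 1) (\<phi> j)) x =
    (\<Sum>l\<in>UNIV. christoffel g l i j x *\<^sub>R dd (axis k 1) (\<phi> l) x + dd (axis k 1) (christoffel g l i j) x *\<^sub>R \<phi> l x)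
      + dd (axis k 1) (A i j) x"
proof -
  have d: "christoffel g l i j differentiable (at x)" "\<phi> l differentiable (at x)" "A i j differentiable (at x)" for l
    using smooth_on_differentiable[OF smooth_\<Gamma> x] smooth_on_differentiable[OF smooth_\<phi> x]
      smooth_on_differentiable[OF smooth_A x] by auto
  have d2: "(\<lambda>x. christoffel g l i j x *\<^sub>R \<phi> l x) differentiable (at x)" for l
    by (rule smooth_on_differentiable[OF smooth_on_scaleR[OF W smooth_\<Gamma> smooth_\<phi>] x])
  have "dd (axis k 1) (dd (axis i 1) (\<phi> j)) x =
      dd (axis k 1) (\<lambda>x. (\<Sum>l\<in>UNIV. christoffel g l i j x *\<^sub>R \<phi> l x) + A i j x) x"
    by (rule dd_cong_open[OF W x deriv_\<phi>])
  also have "\<dots> = dd (axis k 1) (\<lambda>x. (\<Sum>l\<in>UNIV. christoffel g l i j x *\<^sub>R \<phi> l x)) x + dd (axis k 1) (A i j) x"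
    by (rule dd_add[OF smooth_on_differentiable[OF smooth_on_sum[OF W smooth_on_scaleR[OF W smooth_\<Gamma> smooth_\<phi>]] x] d(3)])
  also have "dd (axis k 1) (\<lambda>x. (\<Sum>l\<in>UNIV. christoffel g l i j x *\<^sub>R \<phi> l x)) x =
      (\<Sum>l\<in>UNIV. christoffel g l i j x *\<^sub>R dd (axis k 1) (\<phi> l) x + dd (axis k 1) (christoffel g l i j) x *\<^sub>R \<phi> l x)"
    by (subst dd_sum[OF d2]) (rule sum.cong[OF refl], rule dd_bilinear[OF bounded_bilinear_scaleR d(1,2)])
  finally show ?thesis .
qed

lemma deriv_A_paired:
  assumes x: "x \<in> W" and \<nu>: "\<nu> differentiable (at x)" "\<And>y. y \<in> W \<Longrightarrow> lor (A i j y) (\<nu> y) = 0"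
  shows "lor (dd v (A i j) x) (\<nu> x) = - lor (A i j x) (dd v \<nu> x)"
proof -
  have "dd v (\<lambda>y. lor (A i j y) (\<nu> y)) x = 0"
    using dd_cong_open[OF W x, of "\<lambda>y. lor (A i j y) (\<nu> y)" "\<lambda>_. 0" v] \<nu>(2) by simp
  then show ?thesis
    using dd_bilinear[OF lor_bilinear smooth_on_differentiable[OF smooth_A x] \<nu>(1), of v i j] by simp
qed

text \<open>The tangential component of the symmetry of second derivatives of
  \<open>\<phi> j\<close>. Only the structure equation \<open>deriv_\<phi>\<close> expresses the
  frame, so that frames other than coordinate frames are covered.\<close>

lemma gauss:
  assumes x: "x \<in> W"
  shows "(\<Sum>l\<in>UNIV. curvature g l k i j x * g x $ l $ w)
    = lor (A i j x) (A k w x) - lor (A k j x) (A i w x)"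
proof -
  let ?\<Gamma> = "christoffel g"
  have e: "lor (dd (axis k 1) (dd (axis i 1) (\<phi> j)) x) (\<phi> w x) =
      (\<Sum>l\<in>UNIV. (\<Sum>m\<in>UNIV. ?\<Gamma> l k m x * ?\<Gamma> m i j x) * g x $ l $ w) + (\<Sum>l\<in>UNIV. partial k (?\<Gamma> l i j) x * g x $ l $ w)
       - lor (A i j x) (A k w x)" for k i
  proof -
    have 1: "lor (dd (axis k 1) (A i j) x) (\<phi> w x) = - lor (A i j x) (A k w x)"
      using deriv_A_paired[OF x smooth_on_differentiable[OF smooth_\<phi> x, of w] A_normal, where i = i and j = j and v = "axis k 1"]
      by (simp add: deriv_\<phi>[OF x] lor_simps lor.sum_right A_normal[OF x])
    have 2: "lor (dd (axis k 1) (\<phi> l) x) (\<phi> w x) = (\<Sum>m\<in>UNIV. ?\<Gamma> m k l x * g x $ m $ w)" for l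
      by (simp add: deriv_\<phi>[OF x] lor_simps lor.sum_left A_normal[OF x] gram[OF x])
    have "(\<Sum>l\<in>UNIV. ?\<Gamma> l i j x * (\<Sum>m\<in>UNIV. ?\<Gamma> m k l x * g x $ m $ w))
       = (\<Sum>l\<in>UNIV. (\<Sum>m\<in>UNIV. ?\<Gamma> l k m x * ?\<Gamma> m i j x) * g x $ l $ w)"
      unfolding sum_distrib_left sum_distrib_right
      by (subst sum.swap) (simp add: algebra_simps)
    then show ?thesis
      by (simp add: second_deriv[OF x] lor_simps lor.sum_left 1 2 gram[OF x] sum.distrib partial_eq_dd)
  qed
  have "lor (dd (axis k 1) (dd (axis i 1) (\<phi> j)) x) (\<phi> w x) = lor (dd (axis i 1) (dd (axis k 1) (\<phi> j)) x) (\<phi> w x)"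
    using dd_commute[OF W x smooth_\<phi>] by metis
  then show ?thesis
    unfolding e by (simp add: curvature_def sum_subtractf algebra_simps sum.distrib sum_distrib_right sum_distrib_left)
qed

text \<open>The component of the same symmetry along \<open>\<nu>\<close>. Because
  \<open>\<nu>\<close> is orthogonal to the frame and to all \<open>A i j\<close>, the connection
  terms drop out and the derivative falls on \<open>\<nu>\<close>.\<close>

lemma codazzi:
  assumes x: "x \<in> W" and \<nu>: "smooth_on \<nu> W"
    and n: "\<And>y w. y \<in> W \<Longrightarrow> lor (\<phi> w y) (\<nu> y) = 0" "\<And>y i j. y \<in> W \<Longrightarrow> lor (A i j y) (\<nu> y) = 0"
  shows "lor (A i j x) (dd (axis k 1) \<nu> x) = lor (A k j x) (dd (axis i 1) \<nu> x)"
proof -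
  have e: "lor (dd (axis k 1) (dd (axis i 1) (\<phi> j)) x) (\<nu> x) = - lor (A i j x) (dd (axis k 1) \<nu> x)" for k i
  proof -
    have "lor (dd (axis k 1) (\<phi> l) x) (\<nu> x) = 0" for l
      by (simp add: deriv_\<phi>[OF x] lor_simps lor.sum_left n[OF x])
    then show ?thesis
      using deriv_A_paired[OF x smooth_on_differentiable[OF \<nu> x] n(2), where i = i and j = j and v = "axis k 1"]
      by (simp add: second_deriv[OF x] lor_simps lor.sum_left n[OF x])
  qed
  show ?thesis using e[of k i] e[of i k] dd_commute[OF W x smooth_\<phi>, of "axis k 1" "axis i 1" j] by simp
qed

end

section \<open>Smoothness of Christoffel symbols and curvature\<close>

lemma smooth_on_det:
  fixes M :: "'e::euclidean_space \<Rightarrow> real^'n^'n"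
  assumes "open S" "\<And>i j. smooth_on (\<lambda>x. M x $ i $ j) S"
  shows "smooth_on (\<lambda>x. det (M x)) S"
  unfolding det_def by (intro smooth_on_sum smooth_on_mult smooth_on_const smooth_on_prod assms)

text \<open>\<open>matrix_inv\<close> is defined by choice; Cramer's formula exhibits its entries as
  rational functions of those of \<open>A\<close>, hence as smooth.\<close>

lemma matrix_inv_cramer:
  fixes A :: "real^'n^'n"
  assumes "det A \<noteq> 0"
  shows "matrix_inv A $ k $ l = det (\<chi> i j. if j = k then axis l 1 $ i else A $ i $ j) / det A"
    and "matrix_inv A ** A = mat 1" "A ** matrix_inv A = mat 1"
proof -
  have "\<exists>B. A ** B = mat 1 \<and> B ** A = mat 1"
    using assms invertible_det_nz[of A] by (simp add: invertible_def)
  then have "A ** matrix_inv A = mat 1 \<and> matrix_inv A ** A = mat 1"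
    unfolding matrix_inv_def by (rule someI_ex)
  then show i: "matrix_inv A ** A = mat 1" "A ** matrix_inv A = mat 1" by auto
  have "A *v (matrix_inv A *v axis l 1) = axis l 1" by (simp add: matrix_vector_mul_assoc i)
  then have "(matrix_inv A *v axis l 1) $ k = det (\<chi> i j. if j = k then axis l 1 $ i else A $ i $ j) / det A"
    using cramer[OF assms, of "matrix_inv A *v axis l 1" "axis l 1"] by simp
  then show "matrix_inv A $ k $ l = det (\<chi> i j. if j = k then axis l 1 $ i else A $ i $ j) / det A"
    by (simp add: matrix_vector_mult_basis column_def)
qed

lemma linear_zero_axis:
  fixes f :: "real^'d \<Rightarrow> 'b::real_vector"
  assumes "linear f" "\<And>i. f (axis i 1) = 0"
  shows "f x = 0"
proof -
  have "f x = (\<lambda>x. 0) x"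
    by (rule linear_eq_stdbasis[OF assms(1), THEN fun_cong])
       (use assms(2) in \<open>auto simp: Basis_vec_def intro!: linearI\<close>)
  then show ?thesis by simp
qed

lemma vec_expand: "(x :: real^'d) = (\<Sum>i\<in>UNIV. x $ i *\<^sub>R axis i 1)"
  using basis_expansion[of x] by (simp add: scalar_mult_eq_scaleR)

lemma dd_expand:
  fixes f :: "real^'d::finite \<Rightarrow> 'f::real_normed_vector"
  shows "f differentiable (at x) \<Longrightarrow> dd v f x = (\<Sum>i\<in>UNIV. v $ i *\<^sub>R dd (axis i 1) f x)"
  by (subst vec_expand[of v]) (rule dd_sum_dir)

lemma det_positive_definite:
  fixes A :: "real^'n^'n"
  assumes "\<And>v. v \<noteq> 0 \<Longrightarrow> v \<bullet> (A *v v) > 0"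
  shows "det A \<noteq> 0"
proof -
  have "A *v v = 0 \<longrightarrow> v = 0" for v by (metis assms inner_zero_right less_irrefl)
  then have "\<exists>B. B ** A = mat 1" using matrix_left_invertible_ker by blast
  then show ?thesis using invertible_left_inverse invertible_det_nz by blast
qed

lemma smooth_on_christoffel:
  assumes W: "open W" and g: "smooth_on g W" and det: "\<And>x. x \<in> W \<Longrightarrow> det (g x) \<noteq> 0"
  shows "smooth_on (christoffel g k i j) W"
proof -
  have ge: "smooth_on (\<lambda>x. g x $ i $ j) W" for i j
    by (rule smooth_on_vec_nth[OF W smooth_on_vec_nth[OF W g]])
  have inv: "smooth_on (\<lambda>x. matrix_inv (g x) $ k $ l) W" for l
  proof -
    have "smooth_on (\<lambda>x. det (\<chi> i j. if j = k then axis l 1 $ i else g x $ i $ j) / det (g x)) W"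
    proof (intro smooth_on_divide W smooth_on_det ge det)
      fix i j
      show "smooth_on (\<lambda>x. (\<chi> i j. if j = k then axis l 1 $ i else g x $ i $ j) $ i $ j) W"
        by (cases "j = k") (simp_all add: smooth_on_const ge)
    qed
    then show ?thesis
      using smooth_on_cong[OF W, of "\<lambda>x. matrix_inv (g x) $ k $ l"] matrix_inv_cramer(1)[OF det] by (simp cong: smooth_on_cong)
  qed
  show ?thesis
    unfolding christoffel_def[abs_def] partial_eq_dd
    by (intro smooth_on_divide smooth_on_const smooth_on_sum smooth_on_mult smooth_on_add smooth_on_diff
        smooth_on_dd ge inv W) simp
qed

lemma smooth_on_curvature:
  assumes W: "open W" and g: "smooth_on g W" and det: "\<And>x. x \<in> W \<Longrightarrow> det (g x) \<noteq> 0"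
  shows "smooth_on (curvature g l i j k) W"
  unfolding curvature_def[abs_def] partial_eq_dd
  by (intro smooth_on_add smooth_on_diff smooth_on_sum smooth_on_mult smooth_on_dd smooth_on_christoffel W g det)

section \<open>Structure equations of an isometric lift in one chart\<close>

locale conformal_chart =
  fixes W :: "(real^'d::finite) set" and g Jc :: "real^'d \<Rightarrow> real^'d^'d" and F :: "real^'d \<Rightarrow> 'm::finite lspace"
  assumes W: "open W"
    and smooth_g: "smooth_on g W" and g_sym: "\<And>x. x \<in> W \<Longrightarrow> transpose (g x) = g x"
    and g_pos: "\<And>x v. x \<in> W \<Longrightarrow> v \<noteq> 0 \<Longrightarrow> v \<bullet> (g x *v v) > 0"
    and smooth_J: "smooth_on Jc W" and J_square: "\<And>x. x \<in> W \<Longrightarrow> Jc x ** Jc x = - mat 1"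
    and J_orth: "\<And>x. x \<in> W \<Longrightarrow> transpose (Jc x) ** g x ** Jc x = g x"
    and J_parallel: "\<And>x k i j. x \<in> W \<Longrightarrow> covariant_deriv_endo g Jc k i j x = 0"
    and smooth_F: "smooth_on F W" and F_null: "\<And>x. x \<in> W \<Longrightarrow> lor (F x) (F x) = 0"
    and F_metric: "\<And>x v w. x \<in> W \<Longrightarrow> lor (dd v F x) (dd w F x) = v \<bullet> (g x *v w)"
    and dims: "CARD('m) = CARD('d) + 2" "CARD('d) \<ge> 10"
    and nonflat: "\<And>x. x \<in> W \<Longrightarrow> \<exists>l i j k. curvature g l i j k x \<noteq> 0"
begin

abbreviation "e \<equiv> \<lambda>i::'d. axis i (1::real)"
abbreviation "\<Gamma> \<equiv> christoffel g"

lemma smooth_g_entry: "smooth_on (\<lambda>x. g x $ i $ j) W"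
  by (rule smooth_on_vec_nth[OF W smooth_on_vec_nth[OF W smooth_g]])

lemma smooth_J_entry: "smooth_on (\<lambda>x. Jc x $ i $ j) W"
  by (rule smooth_on_vec_nth[OF W smooth_on_vec_nth[OF W smooth_J]])

lemma det_g: "x \<in> W \<Longrightarrow> det (g x) \<noteq> 0"
  using det_positive_definite g_pos by blast

lemma smooth_\<Gamma>: "smooth_on (\<Gamma> k i j) W"
  by (rule smooth_on_christoffel[OF W smooth_g det_g])

definition "dF i x = dd (e i) F x"

text \<open>The second derivative of \<open>F\<close> minus its Levi-Civita part;
  \<open>sff_normal\<close> shows that this is the normal component, that is the second fundamental
  form in coordinates.\<close>

definition "sff i j x = dd (e i) (dF j) x - (\<Sum>k\<in>UNIV. \<Gamma> k i j x *\<^sub>R dF k x)"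

lemma smooth_dF: "smooth_on (dF i) W"
  unfolding dF_def[abs_def] by (rule smooth_on_dd[OF smooth_F])

lemma smooth_sff: "smooth_on (sff i j) W"
  unfolding sff_def[abs_def] by (intro smooth_on_diff smooth_on_sum smooth_on_scaleR smooth_\<Gamma> smooth_dF smooth_on_dd W)

lemma diff_F: "x \<in> W \<Longrightarrow> F differentiable (at x)"
  by (rule smooth_on_differentiable[OF smooth_F])

lemma dd_F: "x \<in> W \<Longrightarrow> dd v F x = (\<Sum>i\<in>UNIV. v $ i *\<^sub>R dF i x)"
  unfolding dF_def by (rule dd_expand[OF diff_F])

lemma dF_gram: "x \<in> W \<Longrightarrow> lor (dF i x) (dF j x) = g x $ i $ j"
  unfolding dF_def by (simp add: F_metric matrix_vector_mult_basis column_def inner_axis')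

lemma g_entry_sym: "x \<in> W \<Longrightarrow> g x $ i $ j = g x $ j $ i"
  using arg_cong[OF g_sym[of x], of "\<lambda>A. A $ j $ i"] by (simp add: transpose_def)

lemma dF_commute: "x \<in> W \<Longrightarrow> dd (e i) (dF j) x = dd (e j) (dF i) x"
  unfolding dF_def[abs_def] by (rule dd_commute[OF W _ smooth_F])

lemma sff_sym: "x \<in> W \<Longrightarrow> sff i j x = sff j i x"
proof -
  assume x: "x \<in> W"
  have sw: "dd (e b) (\<lambda>y. g y $ c $ a) x = dd (e b) (\<lambda>y. g y $ a $ c) x" for a b c
    by (rule dd_cong_open[OF W x g_entry_sym])
  have "\<Gamma> k i j x = \<Gamma> k j i x" for k
    unfolding christoffel_def partial_eq_dd using sw[of _ i j] by (simp add: add.commute)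
  then show ?thesis by (simp add: sff_def dF_commute[OF x])
qed

lemma dd_gram:
  assumes x: "x \<in> W"
  shows "dd (e k) (\<lambda>y. g y $ i $ j) x = lor (dF i x) (dd (e k) (dF j) x) + lor (dd (e k) (dF i) x) (dF j x)"
proof -
  have "dd (e k) (\<lambda>y. g y $ i $ j) x = dd (e k) (\<lambda>y. lor (dF i y) (dF j y)) x"
    by (rule dd_cong_open[OF W x]) (simp add: dF_gram)
  then show ?thesis
    using dd_bilinear[OF lor_bilinear smooth_on_differentiable[OF smooth_dF x] smooth_on_differentiable[OF smooth_dF x]] by simp
qed

text \<open>Koszul's formula: differentiating the Gram matrix and using the symmetry of second
  derivatives determines the tangential part, and the Christoffel symbols are the same expression
  with an index raised by the inverse of \<open>g\<close>.\<close>

lemma sff_normal: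
  assumes x: "x \<in> W" shows "lor (sff i j x) (dF w x) = 0"
proof -
  have "lor (dd (e i) (dF j) x) (dF w x) =
    (dd (e i) (\<lambda>y. g y $ j $ w) x + dd (e j) (\<lambda>y. g y $ i $ w) x - dd (e w) (\<lambda>y. g y $ i $ j) x) / 2"
    unfolding dd_gram[OF x]
    using dF_commute[OF x, of i j] dF_commute[OF x, of i w] dF_commute[OF x, of j w]
    by (simp add: lor_sym)
  moreover have "lor (\<Sum>k\<in>UNIV. \<Gamma> k i j x *\<^sub>R dF k x) (dF w x) =
    (dd (e i) (\<lambda>y. g y $ j $ w) x + dd (e j) (\<lambda>y. g y $ i $ w) x - dd (e w) (\<lambda>y. g y $ i $ j) x) / 2"
  proof -
    let ?K = "\<lambda>l. dd (e i) (\<lambda>y. g y $ j $ l) x + dd (e j) (\<lambda>y. g y $ i $ l) x - dd (e l) (\<lambda>y. g y $ i $ j) x"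
    have "lor (\<Sum>k\<in>UNIV. \<Gamma> k i j x *\<^sub>R dF k x) (dF w x) = (\<Sum>k\<in>UNIV. \<Gamma> k i j x * g x $ k $ w)"
      by (simp add: lor.sum_left lor_simps dF_gram[OF x])
    also have "\<dots> = (\<Sum>k\<in>UNIV. (\<Sum>l\<in>UNIV. matrix_inv (g x) $ k $ l * ?K l) / 2 * g x $ k $ w)"
      by (simp add: christoffel_def partial_eq_dd)
    also have "\<dots> = (\<Sum>k\<in>UNIV. \<Sum>l\<in>UNIV. ?K l / 2 * (g x $ w $ k * matrix_inv (g x) $ k $ l))"
      by (simp add: sum_divide_distrib sum_distrib_right sum_distrib_left g_entry_sym[OF x, of _ w] mult_ac)
    also have "\<dots> = (\<Sum>l\<in>UNIV. ?K l / 2 * (\<Sum>k\<in>UNIV. g x $ w $ k * matrix_inv (g x) $ k $ l))"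
      by (subst sum.swap) (simp add: sum_distrib_left)
    also have "\<dots> = (\<Sum>l\<in>UNIV. ?K l / 2 * (g x ** matrix_inv (g x)) $ w $ l)"
      by (simp add: matrix_matrix_mult_def)
    also have "\<dots> = ?K w / 2"
      by (simp add: matrix_inv_cramer(3)[OF det_g[OF x]] mat_def if_distrib if_distribR sum.delta cong: if_cong)
    finally show ?thesis .
  qed
  ultimately show ?thesis by (simp add: sff_def lor_simps)
qed

sublocale af: adapted_frame W g dF sff
  by unfold_locales (simp_all add: W smooth_\<Gamma> smooth_dF smooth_sff sff_normal dF_gram, simp add: sff_def)

definition "jF j x = (\<Sum>k\<in>UNIV. Jc x $ k $ j *\<^sub>R dF k x)"
definition "jsff i j x = (\<Sum>k\<in>UNIV. Jc x $ k $ j *\<^sub>R sff i k x)"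

text \<open>This is where parallelism of \<open>J\<close> enters: the derivative of its matrix
  cancels one Christoffel term and supplies the other, so \<open>jF\<close> satisfies the structure
  equation with the same connection as \<open>dF\<close>. Both frames thus share one curvature
  tensor.\<close>

lemma jF_deriv:
  assumes x: "x \<in> W"
  shows "dd (e i) (jF j) x = (\<Sum>l\<in>UNIV. \<Gamma> l i j x *\<^sub>R jF l x) + jsff i j x"
proof -
  have dJ: "(\<lambda>y. Jc y $ k $ j) differentiable (at x)" and ddF: "dF k differentiable (at x)" for k
    by (rule smooth_on_differentiable[OF smooth_J_entry x] smooth_on_differentiable[OF smooth_dF x])+
  have dp: "(\<lambda>y. Jc y $ k $ j *\<^sub>R dF k y) differentiable (at x)" for k
    by (rule smooth_on_differentiable[OF smooth_on_scaleR[OF W smooth_J_entry smooth_dF] x])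
  have J': "dd (e i) (\<lambda>y. Jc y $ k $ j) x = (\<Sum>l\<in>UNIV. \<Gamma> l i j x * Jc x $ k $ l) - (\<Sum>l\<in>UNIV. \<Gamma> k i l x * Jc x $ l $ j)" for k
    using J_parallel[OF x, of k i j] by (simp add: covariant_deriv_endo_def partial_eq_dd sum_subtractf algebra_simps)
  have 1: "(\<Sum>k\<in>UNIV. (\<Sum>l\<in>UNIV. \<Gamma> l i j x * Jc x $ k $ l) *\<^sub>R dF k x) = (\<Sum>l\<in>UNIV. \<Gamma> l i j x *\<^sub>R jF l x)"
    unfolding jF_def scaleR_sum_left scaleR_sum_right by (subst sum.swap) simp
  have 2: "(\<Sum>k\<in>UNIV. Jc x $ k $ j *\<^sub>R (\<Sum>l\<in>UNIV. \<Gamma> l i k x *\<^sub>R dF l x)) = (\<Sum>k\<in>UNIV. (\<Sum>l\<in>UNIV. \<Gamma> k i l x * Jc x $ l $ j) *\<^sub>R dF k x)"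
    unfolding scaleR_sum_left scaleR_sum_right by (subst sum.swap) (simp add: mult.commute)
  have "dd (e i) (jF j) x = (\<Sum>k\<in>UNIV. Jc x $ k $ j *\<^sub>R dd (e i) (dF k) x + dd (e i) (\<lambda>y. Jc y $ k $ j) x *\<^sub>R dF k x)"
    unfolding jF_def[abs_def]
    by (subst dd_sum[OF dp]) (rule sum.cong[OF refl], rule dd_bilinear[OF bounded_bilinear_scaleR dJ ddF])
  also have "\<dots> = (\<Sum>k\<in>UNIV. Jc x $ k $ j *\<^sub>R (sff i k x + (\<Sum>l\<in>UNIV. \<Gamma> l i k x *\<^sub>R dF l x))) +
      (\<Sum>k\<in>UNIV. (\<Sum>l\<in>UNIV. \<Gamma> l i j x * Jc x $ k $ l) *\<^sub>R dF k x) - (\<Sum>k\<in>UNIV. (\<Sum>l\<in>UNIV. \<Gamma> k i l x * Jc x $ l $ j) *\<^sub>R dF k x)"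
    by (simp add: J' sff_def sum.distrib scaleR_diff_left sum_subtractf)
  also have "\<dots> = (\<Sum>l\<in>UNIV. \<Gamma> l i j x *\<^sub>R jF l x) + jsff i j x"
    by (simp add: scaleR_add_right sum.distrib 1 2 jsff_def)
  finally show ?thesis .
qed

lemma jF_gram:
  assumes x: "x \<in> W" shows "lor (jF l x) (jF w x) = g x $ l $ w"
proof -
  have "lor (jF l x) (jF w x) = (\<Sum>k\<in>UNIV. \<Sum>m\<in>UNIV. Jc x $ k $ w * (Jc x $ m $ l * g x $ m $ k))"
    by (simp add: jF_def lor.sum_left lor.sum_right lor_simps dF_gram[OF x] sum_distrib_left)
  also have "\<dots> = (\<Sum>k\<in>UNIV. (\<Sum>m\<in>UNIV. Jc x $ m $ l * g x $ m $ k) * Jc x $ k $ w)"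
    by (simp add: sum_distrib_left mult_ac)
  also have "\<dots> = (transpose (Jc x) ** g x ** Jc x) $ l $ w"
    by (simp add: matrix_matrix_mult_def transpose_def)
  finally show ?thesis by (simp add: J_orth[OF x])
qed

sublocale jaf: adapted_frame W g jF jsff
proof
  show "smooth_on (jF j) W" for j
    unfolding jF_def[abs_def] by (intro smooth_on_sum smooth_on_scaleR smooth_J_entry smooth_dF W)
  show "smooth_on (jsff i j) W" for i j
    unfolding jsff_def[abs_def] by (intro smooth_on_sum smooth_on_scaleR smooth_J_entry smooth_sff W)
  show "lor (jsff i j x) (jF w x) = 0" if "x \<in> W" for x i j w
    by (simp add: jsff_def jF_def lor.sum_left lor.sum_right lor_simps sff_normal[OF that])
qed (simp_all add: W smooth_\<Gamma> jF_deriv jF_gram)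

definition "al x v w = (\<Sum>i\<in>UNIV. \<Sum>j\<in>UNIV. (v $ i * w $ j) *\<^sub>R sff i j x)"
definition "J x v = Jc x *v v"
definition "G x v w = v \<bullet> (g x *v w)"
definition "N x = {p. \<forall>v. lor p (dd v F x) = 0}"

lemma al_bilinear: "bounded_bilinear (al x)"
proof -
  have "bilinear (al x)" unfolding bilinear_def al_def
    by (auto intro!: linearI simp: algebra_simps sum.distrib scaleR_sum_right)
  then show ?thesis by (simp add: bilinear_conv_bounded_bilinear)
qed

lemma al_axis: "al x (e i) (e j) = sff i j x"
proof -
  have "al x (e i) (e j) = (\<Sum>i'\<in>UNIV. \<Sum>j'\<in>UNIV. if i' = i \<and> j' = j then sff i' j' x else 0)"
    unfolding al_def by (intro sum.cong refl) (simp add: axis_def)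
  also have "\<dots> = (\<Sum>i'\<in>UNIV. if i' = i then sff i' j x else 0)"
    by (intro sum.cong refl) (auto simp: sum.delta)
  finally show ?thesis by (simp add: sum.delta)
qed

lemma al_J_axis: "al x (e i) (J x (e j)) = jsff i j x"
proof -
  have "J x (e j) = (\<Sum>k\<in>UNIV. Jc x $ k $ j *\<^sub>R e k)"
    by (subst vec_expand) (simp add: J_def matrix_vector_mult_basis column_def)
  then show ?thesis
    by (simp add: bounded_bilinear.sum_right[OF al_bilinear] bounded_bilinear.scaleR_right[OF al_bilinear] al_axis jsff_def)
qed

lemma J_linear: "linear (J x)"
  unfolding J_def by (rule matrix_vector_mul_linear)

lemma G_bilinear: "bounded_bilinear (G x)"
proof -
  have "bilinear (G x)" unfolding bilinear_def G_def
    by (auto intro!: linearI simp: inner_add_left inner_add_right matrix_vector_right_distrib matrix_vector_mult_scaleR)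
  then show ?thesis by (simp add: bilinear_conv_bounded_bilinear)
qed

lemma dF_F: "x \<in> W \<Longrightarrow> lor (dd v F x) (F x) = 0"
proof -
  assume x: "x \<in> W"
  have "dd v (\<lambda>y. lor (F y) (F y)) x = 0"
    using dd_cong_open[OF W x, of "\<lambda>y. lor (F y) (F y)" "\<lambda>_. 0" v] F_null by simp
  then show ?thesis using dd_bilinear[OF lor_bilinear diff_F[OF x] diff_F[OF x], of v] lor_sym[of "F x" "dd v F x"] by simp
qed

lemma F_in_N: "x \<in> W \<Longrightarrow> F x \<in> N x"
  by (simp add: N_def lor_sym[of "F x"] dF_F)

lemma sff_in_N: "x \<in> W \<Longrightarrow> sff i j x \<in> N x"
  by (simp add: N_def dd_F lor.sum_right lor_simps sff_normal)

lemma N_subspace: "subspace (N x)"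
  by (auto simp: N_def subspace_def lor_simps)

lemma al_in_N: "x \<in> W \<Longrightarrow> al x v w \<in> N x"
  unfolding al_def by (intro subspace_sum[OF N_subspace] subspace_scale[OF N_subspace] sff_in_N)

lemma sff_F: "x \<in> W \<Longrightarrow> lor (sff i j x) (F x) = - g x $ i $ j"
proof -
  assume x: "x \<in> W"
  have "dd (e i) (\<lambda>y. lor (dF j y) (F y)) x = 0"
    using dd_cong_open[OF W x, of "\<lambda>y. lor (dF j y) (F y)" "\<lambda>_. 0" "e i"] dF_F by (simp add: dF_def)
  then have "lor (dF j x) (dF i x) + lor (dd (e i) (dF j) x) (F x) = 0"
    using dd_bilinear[OF lor_bilinear smooth_on_differentiable[OF smooth_dF x] diff_F[OF x], of "e i" j]
    by (simp add: dF_def)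
  moreover have "lor (dF k x) (F x) = 0" for k using dF_F[OF x] by (simp add: dF_def)
  ultimately show ?thesis
    using g_entry_sym[OF x, of i j] by (simp add: sff_def lor_simps lor.sum_left dF_gram[OF x])
qed

lemma G_expand: "G x v w = (\<Sum>i\<in>UNIV. \<Sum>j\<in>UNIV. v $ i * w $ j * g x $ i $ j)"
  by (simp add: G_def inner_vec_def matrix_vector_mult_def sum_distrib_left mult_ac)

lemma al_F: "x \<in> W \<Longrightarrow> lor (al x v w) (F x) = - G x v w"
  by (simp add: al_def lor.sum_left lor_simps sff_F G_expand sum_negf)

lemma G_sym: "x \<in> W \<Longrightarrow> G x v w = G x w v"
  unfolding G_expand by (subst sum.swap) (simp add: g_entry_sym[of x] mult_ac)

lemma al_sym: "x \<in> W \<Longrightarrow> al x v w = al x w v"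
  unfolding al_def by (subst sum.swap) (simp add: sff_sym[of x] mult_ac)

lemma J_J: "x \<in> W \<Longrightarrow> J x (J x v) = - v"
  using matrix_vector_mult_diff_rdistrib[of 0 "mat 1" v] by (simp add: J_def matrix_vector_mul_assoc J_square)

lemma G_J: "x \<in> W \<Longrightarrow> G x (J x v) (J x w) = G x v w"
proof -
  assume x: "x \<in> W"
  have "G x v w = v \<bullet> ((transpose (Jc x) ** g x ** Jc x) *v w)" by (simp add: G_def J_orth[OF x])
  also have "\<dots> = v \<bullet> (transpose (Jc x) *v (g x *v (Jc x *v w)))"
    by (simp add: matrix_vector_mul_assoc matrix_mul_assoc)
  also have "\<dots> = (Jc x *v v) \<bullet> (g x *v (Jc x *v w))"
    using dot_lmul_matrix[of v "transpose (Jc x)"] by simp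
  finally show ?thesis by (simp add: G_def J_def)
qed

lemma dim_N: assumes x: "x \<in> W" shows "dim (N x) \<le> 4"
proof -
  \<comment> \<open>\<open>sh\<close> represents \<open>lor\<close> by the inner product, which
    turns \<open>N x\<close> into the orthogonal complement of a space of dimension
    \<open>CARD('d)\<close> inside one of dimension \<open>CARD('d) + 4\<close>.\<close>
  define sh :: "'m lspace \<Rightarrow> 'm lspace" where "sh p = (fst p, - snd (snd p), - fst (snd p))" for p
  have sh: "lor p q = sh q \<bullet> p" for p q
    by (simp add: sh_def lor_def inner_prod_def inner_commute algebra_simps)
  have lsh: "linear sh" by (rule linearI) (simp_all add: sh_def)
  let ?D = "\<lambda>v. dd v F x"
  have lD: "linear ?D" by (rule dd_linear_dir[OF diff_F[OF x]])
  have l: "linear (\<lambda>v. sh (?D v))" using linear_compose[OF lD lsh] by (simp add: o_def)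
  have "inj (\<lambda>v. sh (?D v))"
  proof (rule linear_injective_0[OF l, THEN iffD2], intro allI impI)
    fix v assume "sh (?D v) = 0"
    then have "lor (?D v) (?D v) = 0" by (simp add: sh)
    then show "v = 0" using F_metric[OF x, of v v] g_pos[OF x, of v] by auto
  qed
  then have "dim (range (\<lambda>v. sh (?D v))) = dim (UNIV :: (real^'d) set)"
    using dim_image_eq[OF l, of UNIV] by (simp add: inj_on_subset)
  then have 1: "dim (range (\<lambda>v. sh (?D v))) = CARD('d)" by simp
  have "N x = {y \<in> UNIV. \<forall>q\<in>range (\<lambda>v. sh (?D v)). orthogonal q y}"
    by (auto simp: N_def sh orthogonal_def)
  then have "dim (N x) + CARD('d) = dim (UNIV :: 'm lspace set)"
    using dim_subspace_orthogonal_to_vectors[of "range (\<lambda>v. sh (?D v))" UNIV] linear_subspace_image[OF l] 1 by simp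
  then show ?thesis using dims by simp
qed

text \<open>On basis vectors the two sides are the right-hand sides of the Gauss equations of
  \<open>jF\<close> and \<open>dF\<close>, whose left-hand sides coincide; multilinearity extends
  this to all vectors.\<close>

lemma al_kaehler:
  assumes x: "x \<in> W"
  shows "lor (al x u (J x w)) (al x v (J x z)) - lor (al x u (J x z)) (al x v (J x w))
     = lor (al x u w) (al x v z) - lor (al x u z) (al x v w)"
proof -
  interpret al: bounded_bilinear "al x" by (rule al_bilinear)
  note Jl = linear_add[OF J_linear] linear_scale[OF J_linear]
  define f where "f u v z w = lor (al x u (J x w)) (al x v (J x z)) - lor (al x u (J x z)) (al x v (J x w))
     - (lor (al x u w) (al x v z) - lor (al x u z) (al x v w))" for u v z w
  have l: "linear (\<lambda>u. f u v z w)" "linear (\<lambda>v. f u v z w)" "linear (\<lambda>z. f u v z w)" "linear (\<lambda>w. f u v z w)" for u v z w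
    unfolding f_def
    by (rule linearI; simp add: al.add_left al.add_right al.scaleR_left al.scaleR_right lor_simps Jl algebra_simps)+
  have "f (e i) (e k) (e w) (e j) = 0" for i k w j
    using af.gauss[OF x, of k i j w] jaf.gauss[OF x, of k i j w]
    by (simp add: f_def al_axis al_J_axis lor_sym[of "jsff i w x" "jsff k j x"] lor_sym[of "sff i w x" "sff k j x"])
  then have "f (e i) (e k) (e m) w = 0" for i k m w by (rule linear_zero_axis[OF l(4)])
  then have "f (e i) (e k) z w = 0" for i k z w by (rule linear_zero_axis[OF l(3)])
  then have "f (e i) v z w = 0" for i v z w by (rule linear_zero_axis[OF l(2)])
  then have "f u v z w = 0" by (rule linear_zero_axis[OF l(1)])
  then show ?thesis by (simp add: f_def)
qed

lemma kaehler_sff_at: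
  assumes x: "x \<in> W" shows "kaehler_sff (N x) (F x) (G x) (J x) (al x)"
proof (rule kaehler_sff.intro)
  show "0 < G x v v" if "v \<noteq> 0" for v using g_pos[OF x that] by (simp add: G_def)
qed (fact N_subspace dim_N[OF x] F_in_N[OF x] F_null[OF x] G_bilinear G_sym[OF x] J_linear J_J[OF x] G_J[OF x]
    al_bilinear al_sym[OF x] al_in_N[OF x] al_F[OF x] al_kaehler[OF x])+

text \<open>A vanishing Gauss expression kills the curvature with its upper index lowered, and
  positive definiteness of \<open>g x\<close> lets the index be raised again.\<close>

lemma al_nonflat:
  assumes x: "x \<in> W"
  shows "\<exists>u v z w. lor (al x u w) (al x v z) - lor (al x u z) (al x v w) \<noteq> 0"
proof (rule ccontr)
  assume "\<not> ?thesis"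
  then have z: "lor (al x u w) (al x v z) - lor (al x u z) (al x v w) = 0" for u v z w by blast
  obtain l i j k where R: "curvature g l i j k x \<noteq> 0" using nonflat[OF x] by blast
  define r where "r = (\<chi> m. curvature g m i j k x)"
  have "(g x *v r) $ w = 0" for w
    using af.gauss[OF x, of i j k w] z[of "e j" "e k" "e i" "e w"]
    by (simp add: lor_sym[of "sff j w x" "sff i k x"] r_def matrix_vector_mult_def al_axis g_entry_sym[OF x, of w] mult.commute)
  then have "g x *v r = 0" by (simp add: vec_eq_iff)
  then have "r = 0" using g_pos[OF x, of r] by auto
  then show False using R by (simp add: r_def vec_eq_iff)
qed

lemma dd_dd_F_normal:
  assumes x: "x \<in> W" and p: "p \<in> N x"
  shows "lor (dd v (dd w F) x) p = lor (al x v w) p"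
proof -
  have n: "lor (dF k x) p = 0" for k using p by (simp add: N_def dF_def lor_sym)
  have "dd v (dd w F) x = (\<Sum>i\<in>UNIV. v $ i *\<^sub>R dd (e i) (dd w F) x)"
    by (rule dd_expand[OF smooth_on_differentiable[OF smooth_on_dd[OF smooth_F] x]])
  moreover have "dd (e i) (dd w F) x = (\<Sum>j\<in>UNIV. w $ j *\<^sub>R dd (e i) (dF j) x)" for i
  proof -
    have "dd (e i) (dd w F) x = dd (e i) (\<lambda>y. \<Sum>j\<in>UNIV. w $ j *\<^sub>R dF j y) x"
      by (rule dd_cong_open[OF W x dd_F])
    also have "\<dots> = (\<Sum>j\<in>UNIV. dd (e i) (\<lambda>y. w $ j *\<^sub>R dF j y) x)"
      by (rule dd_sum) (rule smooth_on_differentiable[OF smooth_on_scaleR[OF W smooth_on_const smooth_dF] x])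
    also have "\<dots> = (\<Sum>j\<in>UNIV. w $ j *\<^sub>R dd (e i) (dF j) x)"
      by (intro sum.cong refl dd_linear[OF bounded_linear_scaleR_right smooth_on_differentiable[OF smooth_dF x]])
    finally show ?thesis .
  qed
  moreover have "lor (dd (e i) (dF j) x) p = lor (sff i j x) p" for i j
    by (simp add: sff_def lor_simps lor.sum_left n)
  ultimately show ?thesis
    by (simp add: al_def lor.sum_left lor_simps sum_distrib_left mult.assoc)
qed

end

section \<open>A smooth null normal and its derivative\<close>

lemma sum_UNIV_prod: "(\<Sum>ij\<in>(UNIV :: ('a::finite \<times> 'b::finite) set). f ij) = (\<Sum>i\<in>UNIV. \<Sum>j\<in>UNIV. f (i, j))"
  unfolding sum.cartesian_product by (simp add: case_prod_unfold)

locale conformal_chart_normal = conformal_chart W g Jc F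
  for W :: "(real^'d::finite) set" and g Jc :: "real^'d \<Rightarrow> real^'d^'d" and F :: "real^'d \<Rightarrow> 'm::finite lspace" +
  fixes \<eta> :: "real^'d \<Rightarrow> 'm lspace"
  assumes smooth_\<eta>: "smooth_on \<eta> W"
    and \<eta>_null: "\<And>x. x \<in> W \<Longrightarrow> lor (\<eta> x) (\<eta> x) = 0" and \<eta>_F: "\<And>x. x \<in> W \<Longrightarrow> lor (\<eta> x) (F x) = -1"
    and \<eta>_N: "\<And>x. x \<in> W \<Longrightarrow> \<eta> x \<in> N x" and al_\<eta>: "\<And>x v w. x \<in> W \<Longrightarrow> lor (al x v w) (\<eta> x) = 0"

context conformal_chart
begin

lemma conformal_chart_subset:
  assumes "open W'" "W' \<subseteq> W" shows "conformal_chart W' g Jc F"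
  by (rule conformal_chart.intro)
    (use assms(2) in \<open>auto intro: assms(1) smooth_on_subset[OF smooth_g] smooth_on_subset[OF smooth_J]
      smooth_on_subset[OF smooth_F] g_sym g_pos J_square J_orth J_parallel F_null F_metric nonflat subsetD simp: dims\<close>)

text \<open>The conditions \<open>lor \<eta> (sff k l) = 0\<close> and \<open>lor \<eta> F = -1\<close> are linear in the coefficients of \<open>\<eta>\<close> as a combination
  of the \<open>sff i j\<close>; the extra coordinate \<open>None\<close> makes them homogeneous, so that a smooth solution is a kernel
  section.\<close>

lemma exists_null_normal:
  assumes "W \<noteq> {}"
  obtains W' \<eta> where "W' \<noteq> {}" "W' \<subseteq> W" "conformal_chart_normal W' g Jc F \<eta>"
proof -
  define comb where "comb x c = (\<Sum>ij\<in>UNIV. c $ Some ij *\<^sub>R sff (fst ij) (snd ij) x)" for x and c :: "real^('d \<times> 'd) option"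
  define A where "A x c = ((\<chi> k l. lor (comb x c) (sff k l x)) :: real^'d^'d,
      (\<Sum>ij\<in>UNIV. c $ Some ij * g x $ fst ij $ snd ij) - c $ None)" for x and c :: "real^('d \<times> 'd) option"
  have lcomb: "linear (comb x)" for x
    by (rule linearI) (simp_all add: comb_def algebra_simps sum.distrib scaleR_sum_right)
  have lA: "linear (A x)" for x
    by (rule linearI)
      (simp_all add: A_def linear_add[OF lcomb] linear_scale[OF lcomb] lor_simps vec_eq_iff algebra_simps sum.distrib sum_distrib_left)
  have sA: "smooth_on (\<lambda>x. A x c) W" for c
    unfolding A_def comb_def
    by (intro smooth_on_Pair smooth_on_vec smooth_on_diff smooth_on_sum smooth_on_bilinear[OF lor_bilinear]
        smooth_on_scaleR smooth_on_mult smooth_on_const smooth_sff smooth_g_entry W)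
  obtain x1 where "x1 \<in> W" using assms by blast
  then obtain x0 where x0: "x0 \<in> W" and max: "\<And>x. x \<in> W \<Longrightarrow> dim (range (A x)) \<le> dim (range (A x0))"
    using max_dim_point[of x1 W "\<lambda>x. range (A x)"] by blast
  obtain t where t: "G x0 t t = 1" "\<And>v w. lor (al x0 v w) (al x0 t t + al x0 (J x0 t) (J x0 t)) = 0"
    using kaehler_sff.null_normal_exists[OF kaehler_sff_at[OF x0] dims(2)] by blast
  define s where "s = J x0 t"
  \<comment> \<open>The solution at \<open>x0\<close>: \<open>None\<close> carries 1, and the other
    entries make \<open>comb x0 c0\<close> half of \<open>al x0 t t + al x0 s s\<close>, the null
    normal of \<open>null_normal_exists\<close>.\<close>
  define c0 :: "real^('d \<times> 'd) option" where
    "c0 = (\<chi> o'. case o' of None \<Rightarrow> 1 | Some ij \<Rightarrow> (t $ fst ij * t $ snd ij + s $ fst ij * s $ snd ij) / 2)"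
  have comb0: "comb x0 c0 = (1/2) *\<^sub>R (al x0 t t + al x0 s s)"
    by (simp add: comb_def c0_def sum_UNIV_prod al_def scaleR_add_right scaleR_sum_right sum.distrib[symmetric]
        scaleR_add_left[symmetric] add_divide_distrib)
  have "(\<Sum>ij\<in>UNIV. c0 $ Some ij * g x0 $ fst ij $ snd ij) = (G x0 t t + G x0 s s) / 2"
    by (simp add: c0_def sum_UNIV_prod G_expand sum.distrib[symmetric] sum_divide_distrib add_divide_distrib[symmetric] distrib_right[symmetric])
  also have "\<dots> = 1" using t(1) G_J[OF x0, of t t] by (simp add: s_def)
  finally have g0: "(\<Sum>ij\<in>UNIV. c0 $ Some ij * g x0 $ fst ij $ snd ij) = 1" .
  have "lor (comb x0 c0) (sff k l x0) = 0" for k l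
    using t(2)[of "e k" "e l"] by (simp add: comb0 s_def al_axis lor_simps lor_sym[of _ "sff k l x0"])
  then have A0: "A x0 c0 = 0" using g0 by (simp add: A_def c0_def vec_eq_iff zero_prod_def)
  obtain U Y where U: "open U" "x0 \<in> U" "U \<subseteq> W" and Y: "smooth_on Y U" "Y x0 = c0" "\<And>x. x \<in> U \<Longrightarrow> A x (Y x) = 0"
    using kernel_section[OF W x0 lA sA max A0] by blast
  have sY: "smooth_on (\<lambda>x. Y x $ o') U" for o' by (rule smooth_on_vec_nth[OF U(1) Y(1)])
  \<comment> \<open>Where the homogenising coordinate stays positive it can be divided out, which
    restores the normalisation \<open>lor \<eta> F = -1\<close>.\<close>
  define W' where "W' = U \<inter> (\<lambda>x. Y x $ None) -` {0<..}"
  have W'o: "open W'" unfolding W'_def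
    by (rule continuous_open_preimage[OF smooth_on_continuous[OF sY] U(1) open_greaterThan])
  have W'U: "W' \<subseteq> U" and W'W: "W' \<subseteq> W" using U by (auto simp: W'_def)
  have x0W': "x0 \<in> W'" using U Y(2) by (simp add: W'_def c0_def)
  have pos: "Y x $ None > 0" if "x \<in> W'" for x using that by (simp add: W'_def)
  define \<eta> where "\<eta> x = (1 / Y x $ None) *\<^sub>R comb x (Y x)" for x
  interpret W': conformal_chart W' g Jc F by (rule conformal_chart_subset[OF W'o W'W])
  have \<eta>s: "lor (\<eta> x) (sff k l x) = 0" if "x \<in> W'" for x k l
    using Y(3)[of x] that W'U by (auto simp: A_def \<eta>_def lor_simps vec_eq_iff zero_prod_def)
  have \<eta>al: "lor (al x v w) (\<eta> x) = 0" if "x \<in> W'" for x v w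
  proof -
    have "lor (sff k l x) (\<eta> x) = 0" for k l using \<eta>s[OF that, of k l] by (simp add: lor_sym)
    then show ?thesis by (simp add: al_def lor.sum_left lor_simps)
  qed
  have "conformal_chart_normal W' g Jc F \<eta>"
  proof (rule conformal_chart_normal.intro[OF W'.conformal_chart_axioms], unfold_locales)
    show "smooth_on \<eta> W'"
      unfolding \<eta>_def[abs_def] comb_def
      by (intro smooth_on_scaleR smooth_on_divide smooth_on_const smooth_on_sum smooth_on_subset[OF sY W'U]
          smooth_on_subset[OF smooth_sff W'W] W'o) (use pos in force)
    fix x assume x: "x \<in> W'"
    then have xW: "x \<in> W" using W'W by blast
    \<comment> \<open>The quadratic condition is automatic: \<open>\<eta>\<close> is a combination
      of the \<open>sff i j\<close>, to each of which it is orthogonal.\<close>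
    show "lor (\<eta> x) (\<eta> x) = 0"
    proof -
      have "lor (\<eta> x) (comb x (Y x)) = 0" by (simp add: comb_def lor.sum_right lor_simps \<eta>s[OF x])
      then show ?thesis by (subst (2) \<eta>_def) (simp add: lor_simps)
    qed
    have "(\<Sum>ij\<in>UNIV. Y x $ Some ij * g x $ fst ij $ snd ij) = Y x $ None"
      using Y(3)[of x] x W'U by (auto simp: A_def zero_prod_def)
    then have "lor (comb x (Y x)) (F x) = - Y x $ None"
      by (simp add: comb_def lor.sum_left lor_simps sff_F[OF xW] sum_negf)
    then show "lor (\<eta> x) (F x) = - 1" using pos[OF x] by (simp add: \<eta>_def lor_simps)
    show "\<eta> x \<in> N x" unfolding \<eta>_def comb_def
      by (intro subspace_scale[OF N_subspace] subspace_sum[OF N_subspace] sff_in_N xW)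
    show "lor (al x v w) (\<eta> x) = 0" for v w by (rule \<eta>al[OF x])
  qed
  then show ?thesis using that x0W' W'W by blast
qed

end

context conformal_chart_normal
begin

lemma diff_\<eta>: "x \<in> W \<Longrightarrow> \<eta> differentiable (at x)"
  by (rule smooth_on_differentiable[OF smooth_\<eta>])

lemma d\<eta>_\<eta>: assumes x: "x \<in> W" shows "lor (dd v \<eta> x) (\<eta> x) = 0"
proof -
  have "dd v (\<lambda>y. lor (\<eta> y) (\<eta> y)) x = 0"
    using dd_cong_open[OF W x, of "\<lambda>y. lor (\<eta> y) (\<eta> y)" "\<lambda>_. 0" v] \<eta>_null by simp
  then show ?thesis using dd_bilinear[OF lor_bilinear diff_\<eta>[OF x] diff_\<eta>[OF x], of v] lor_sym[of "\<eta> x" "dd v \<eta> x"] by simp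
qed

lemma \<eta>_dF: "x \<in> W \<Longrightarrow> lor (\<eta> x) (dd v F x) = 0"
  using \<eta>_N by (simp add: N_def)

lemma d\<eta>_F: assumes x: "x \<in> W" shows "lor (dd v \<eta> x) (F x) = 0"
proof -
  have "dd v (\<lambda>y. lor (\<eta> y) (F y)) x = 0"
    using dd_cong_open[OF W x, of "\<lambda>y. lor (\<eta> y) (F y)" "\<lambda>_. -1" v] \<eta>_F by simp
  then show ?thesis using dd_bilinear[OF lor_bilinear diff_\<eta>[OF x] diff_F[OF x], of v] \<eta>_dF[OF x] by simp
qed

text \<open>The tangential part of the derivative of \<open>\<eta>\<close> is its shape operator,
  which is zero because \<open>al\<close> is orthogonal to \<open>\<eta>\<close>; so the full
  derivative is already the normal one.\<close>

lemma d\<eta>_N: assumes x: "x \<in> W" shows "dd v \<eta> x \<in> N x"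
proof -
  have "lor (dd v \<eta> x) (dd w F x) = 0" for w
  proof -
    have "dd v (\<lambda>y. lor (\<eta> y) (dd w F y)) x = 0"
      using dd_cong_open[OF W x, of "\<lambda>y. lor (\<eta> y) (dd w F y)" "\<lambda>_. 0" v] \<eta>_dF by simp
    moreover have "lor (\<eta> x) (dd v (dd w F) x) = 0"
      using dd_dd_F_normal[OF x \<eta>_N[OF x], of v w] al_\<eta>[OF x, of v w] by (simp add: lor_sym)
    ultimately show ?thesis
      using dd_bilinear[OF lor_bilinear diff_\<eta>[OF x] smooth_on_differentiable[OF smooth_on_dd[OF smooth_F] x], of v w] by simp
  qed
  then show ?thesis by (simp add: N_def)
qed

lemma linear_d\<eta>: "x \<in> W \<Longrightarrow> linear (\<lambda>v. dd v \<eta> x)"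
  by (rule dd_linear_dir[OF diff_\<eta>])

lemma codazzi_\<eta>:
  assumes x: "x \<in> W"
  shows "lor (dd u \<eta> x) (al x v z) = lor (dd v \<eta> x) (al x u z)"
proof -
  interpret al: bounded_bilinear "al x" by (rule al_bilinear)
  note wl = linear_add[OF linear_d\<eta>[OF x]] linear_scale[OF linear_d\<eta>[OF x]]
  define f where "f u v z = lor (dd u \<eta> x) (al x v z) - lor (dd v \<eta> x) (al x u z)" for u v z
  have l: "linear (\<lambda>u. f u v z)" "linear (\<lambda>v. f u v z)" "linear (\<lambda>z. f u v z)" for u v z
    unfolding f_def
    by (rule linearI; simp add: al.add_left al.add_right al.scaleR_left al.scaleR_right lor_simps wl algebra_simps)+
  have s: "lor (sff i j y) (\<eta> y) = 0" if "y \<in> W" for y i j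
    using al_\<eta>[OF that, of "e i" "e j"] by (simp add: al_axis)
  have d: "lor (dF w y) (\<eta> y) = 0" if "y \<in> W" for y w
    using \<eta>_dF[OF that, of "e w"] by (simp add: dF_def lor_sym)
  have "f (e i) (e k) (e j) = 0" for i k j
    using af.codazzi[OF x smooth_\<eta> d s, where i = i and j = j and k = k]
    by (simp add: f_def al_axis lor_sym[of "dd _ \<eta> x"])
  then have "f (e i) (e k) z = 0" for i k z by (rule linear_zero_axis[OF l(3)])
  then have "f (e i) v z = 0" for i v z by (rule linear_zero_axis[OF l(2)])
  then have "f u v z = 0" by (rule linear_zero_axis[OF l(1)])
  then show ?thesis by (simp add: f_def)
qed

lemma codazzi_at:
  assumes x: "x \<in> W"
  shows "kaehler_sff_codazzi (N x) (F x) (G x) (J x) (al x) (\<eta> x) (\<lambda>v. dd v \<eta> x)"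
proof -
  interpret kaehler_sff "N x" "F x" "G x" "J x" "al x" by (rule kaehler_sff_at[OF x])
  show ?thesis
  proof (rule kaehler_sff_codazzi.intro[OF kaehler_sff_axioms], rule kaehler_sff_codazzi_axioms.intro)
    show "\<exists>u v z w. S u v z w \<noteq> 0" unfolding S_def by (rule al_nonflat[OF x])
  qed (fact dims \<eta>_N[OF x] \<eta>_null[OF x] \<eta>_F[OF x] al_\<eta>[OF x] linear_d\<eta>[OF x] d\<eta>_N[OF x] d\<eta>_F[OF x]
      d\<eta>_\<eta>[OF x] codazzi_\<eta>[OF x])+
qed

definition "cov_deriv i Z x = (\<chi> k. dd (e i) (\<lambda>y. Z y $ k) x + (\<Sum>l\<in>UNIV. \<Gamma> k i l x * Z x $ l))"

lemma cov_deriv_J: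
  assumes U: "open U" "U \<subseteq> W" "x \<in> U" and Z: "smooth_on Z U"
  shows "cov_deriv i (\<lambda>y. J y (Z y)) x = J x (cov_deriv i Z x)"
proof -
  have x: "x \<in> W" using U by blast
  have dJ: "(\<lambda>y. Jc y $ k $ m) differentiable (at x)" for k m
    by (rule smooth_on_differentiable[OF smooth_J_entry x])
  have dZ: "(\<lambda>y. Z y $ m) differentiable (at x)" for m
    by (rule smooth_on_differentiable[OF smooth_on_vec_nth[OF U(1) Z] U(3)])
  have dp: "(\<lambda>y. Jc y $ k $ m * Z y $ m) differentiable (at x)" for k m
    by (rule smooth_on_differentiable[OF smooth_on_mult[OF U(1) smooth_on_subset[OF smooth_J_entry U(2)] smooth_on_vec_nth[OF U(1) Z]] U(3)])
  have J': "dd (e i) (\<lambda>y. Jc y $ k $ m) x = (\<Sum>l\<in>UNIV. \<Gamma> l i m x * Jc x $ k $ l) - (\<Sum>l\<in>UNIV. \<Gamma> k i l x * Jc x $ l $ m)" for k m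
    using J_parallel[OF x, of k i m] by (simp add: covariant_deriv_endo_def partial_eq_dd sum_subtractf algebra_simps)
  have "cov_deriv i (\<lambda>y. J y (Z y)) x $ k = J x (cov_deriv i Z x) $ k" for k
  proof -
    have "dd (e i) (\<lambda>y. J y (Z y) $ k) x = (\<Sum>m\<in>UNIV. dd (e i) (\<lambda>y. Jc y $ k $ m * Z y $ m) x)"
      by (simp add: J_def matrix_vector_mult_def dd_sum[OF dp])
    also have "\<dots> = (\<Sum>m\<in>UNIV. Jc x $ k $ m * dd (e i) (\<lambda>y. Z y $ m) x + dd (e i) (\<lambda>y. Jc y $ k $ m) x * Z x $ m)"
      by (intro sum.cong refl dd_bilinear[OF bounded_bilinear_mult dJ dZ])
    also have "\<dots> = (\<Sum>m\<in>UNIV. Jc x $ k $ m * dd (e i) (\<lambda>y. Z y $ m) x)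
        + (\<Sum>m\<in>UNIV. \<Sum>l\<in>UNIV. \<Gamma> l i m x * Jc x $ k $ l * Z x $ m) - (\<Sum>m\<in>UNIV. \<Sum>l\<in>UNIV. \<Gamma> k i l x * Jc x $ l $ m * Z x $ m)"
      by (simp add: J' left_diff_distrib sum.distrib sum_subtractf sum_distrib_right)
    also have "(\<Sum>m\<in>UNIV. \<Sum>l\<in>UNIV. \<Gamma> l i m x * Jc x $ k $ l * Z x $ m) = (\<Sum>l\<in>UNIV. Jc x $ k $ l * (\<Sum>m\<in>UNIV. \<Gamma> l i m x * Z x $ m))"
      by (subst sum.swap) (simp add: sum_distrib_left mult_ac)
    also have "(\<Sum>m\<in>UNIV. \<Sum>l\<in>UNIV. \<Gamma> k i l x * Jc x $ l $ m * Z x $ m) = (\<Sum>l\<in>UNIV. \<Gamma> k i l x * J x (Z x) $ l)"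
      by (subst sum.swap) (simp add: J_def matrix_vector_mult_def sum_distrib_left mult_ac)
    finally show ?thesis
      by (simp add: cov_deriv_def J_def matrix_vector_mult_def distrib_left sum.distrib)
  qed
  then show ?thesis by (simp add: vec_eq_iff)
qed

text \<open>Let \<open>z\<close> be the image of \<open>Z\<close> under the derivative of
  \<open>F\<close>. By \<open>null\<close>, the derivative of \<open>z\<close> along
  \<open>e i\<close> is the image of the covariant derivative of \<open>Z\<close> plus
  \<open>G x (Z x) (e i)\<close> times \<open>\<eta>\<close>. The identity is the symmetry of second
  derivatives of \<open>z\<close>, paired with a normal \<open>p\<close> orthogonal to
  \<open>\<eta>\<close>.\<close>

lemma nullity_second_order:
  assumes U: "open U" "U \<subseteq> W" "x \<in> U" and Z: "smooth_on Z U"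
    and null: "\<And>y v. y \<in> U \<Longrightarrow> al y (Z y) v = G y (Z y) v *\<^sub>R \<eta> y"
    and p: "p \<in> N x" "lor (\<eta> x) p = 0"
  shows "lor (al x (e k) (cov_deriv i Z x)) p + G x (Z x) (e i) * lor (dd (e k) \<eta> x) p
       = lor (al x (e i) (cov_deriv k Z x)) p + G x (Z x) (e k) * lor (dd (e i) \<eta> x) p"
proof -
  have x: "x \<in> W" using U by blast
  define z where "z y = (\<Sum>m\<in>UNIV. Z y $ m *\<^sub>R dF m y)" for y
  have sZ: "smooth_on (\<lambda>y. Z y $ m) U" for m by (rule smooth_on_vec_nth[OF U(1) Z])
  note sub = smooth_on_subset[OF _ U(2)]
  have sz: "smooth_on z U" unfolding z_def[abs_def] by (intro smooth_on_sum smooth_on_scaleR sZ sub smooth_dF U)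
  have snab: "smooth_on (\<lambda>y. cov_deriv i Z y $ m) U" for i m
    unfolding cov_deriv_def by (simp, intro smooth_on_add smooth_on_sum smooth_on_mult smooth_on_dd sZ sub smooth_\<Gamma> U)
  have sG: "smooth_on (\<lambda>y. G y (Z y) (e i)) U" for i
    unfolding G_expand by (intro smooth_on_sum smooth_on_mult smooth_on_const sZ sub smooth_g_entry U)
  have d1: "dd (e i) z y = (\<Sum>m\<in>UNIV. cov_deriv i Z y $ m *\<^sub>R dF m y) + G y (Z y) (e i) *\<^sub>R \<eta> y" if y: "y \<in> U" for y i
  proof -
    have yW: "y \<in> W" using y U by blast
    have dZ: "(\<lambda>y. Z y $ m) differentiable (at y)" and ddF: "dF m differentiable (at y)"
      and dp: "(\<lambda>y. Z y $ m *\<^sub>R dF m y) differentiable (at y)" for m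
      by (rule smooth_on_differentiable[OF sZ y] smooth_on_differentiable[OF smooth_dF yW]
          smooth_on_differentiable[OF smooth_on_scaleR[OF U(1) sZ sub[OF smooth_dF]] y])+
    have al_ei: "al y (e i) (Z y) = (\<Sum>m\<in>UNIV. Z y $ m *\<^sub>R sff i m y)"
      by (subst vec_expand[of "Z y"])
        (simp only: bounded_bilinear.sum_right[OF al_bilinear] bounded_bilinear.scaleR_right[OF al_bilinear] al_axis)
    have "dd (e i) z y = (\<Sum>m\<in>UNIV. Z y $ m *\<^sub>R dd (e i) (dF m) y + dd (e i) (\<lambda>y. Z y $ m) y *\<^sub>R dF m y)"
      unfolding z_def[abs_def]
      by (subst dd_sum[OF dp]) (rule sum.cong[OF refl], rule dd_bilinear[OF bounded_bilinear_scaleR dZ ddF])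
    also have "\<dots> = (\<Sum>m\<in>UNIV. Z y $ m *\<^sub>R (\<Sum>l\<in>UNIV. \<Gamma> l i m y *\<^sub>R dF l y)) + (\<Sum>m\<in>UNIV. Z y $ m *\<^sub>R sff i m y)
        + (\<Sum>m\<in>UNIV. dd (e i) (\<lambda>y. Z y $ m) y *\<^sub>R dF m y)"
      by (simp add: af.deriv_\<phi>[OF yW] scaleR_add_right sum.distrib)
    also have "(\<Sum>m\<in>UNIV. Z y $ m *\<^sub>R (\<Sum>l\<in>UNIV. \<Gamma> l i m y *\<^sub>R dF l y)) = (\<Sum>l\<in>UNIV. (\<Sum>m\<in>UNIV. \<Gamma> l i m y * Z y $ m) *\<^sub>R dF l y)"
      unfolding scaleR_sum_left scaleR_sum_right by (subst sum.swap) (simp add: mult.commute)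
    also have "(\<Sum>m\<in>UNIV. Z y $ m *\<^sub>R sff i m y) = G y (Z y) (e i) *\<^sub>R \<eta> y"
      using null[OF y, of "e i"] al_sym[OF yW, of "e i" "Z y"] by (simp add: al_ei)
    finally show ?thesis by (simp add: cov_deriv_def scaleR_add_left sum.distrib)
  qed
  have d2: "lor (dd (e k) (dd (e i) z) x) p = lor (al x (e k) (cov_deriv i Z x)) p + G x (Z x) (e i) * lor (dd (e k) \<eta> x) p" for i k
  proof -
    have dn: "(\<lambda>y. cov_deriv i Z y $ m) differentiable (at x)" and ddF: "dF m differentiable (at x)"
      and dp: "(\<lambda>y. cov_deriv i Z y $ m *\<^sub>R dF m y) differentiable (at x)" for m
      by (rule smooth_on_differentiable[OF snab U(3)] smooth_on_differentiable[OF smooth_dF x]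
          smooth_on_differentiable[OF smooth_on_scaleR[OF U(1) snab sub[OF smooth_dF]] U(3)])+
    have dG: "(\<lambda>y. G y (Z y) (e i)) differentiable (at x)" by (rule smooth_on_differentiable[OF sG U(3)])
    have dG\<eta>: "(\<lambda>y. G y (Z y) (e i) *\<^sub>R \<eta> y) differentiable (at x)"
      by (rule smooth_on_differentiable[OF smooth_on_scaleR[OF U(1) sG sub[OF smooth_\<eta>]] U(3)])
    have dS: "(\<lambda>y. \<Sum>m\<in>UNIV. cov_deriv i Z y $ m *\<^sub>R dF m y) differentiable (at x)"
      by (rule smooth_on_differentiable[OF smooth_on_sum[OF U(1) smooth_on_scaleR[OF U(1) snab sub[OF smooth_dF]]] U(3)])
    have n: "lor (dF m x) p = 0" for m using p(1) by (simp add: N_def dF_def lor_sym)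
    have s: "lor (dd (e k) (dF m) x) p = lor (sff k m x) p" for m
      by (simp add: sff_def lor_simps lor.sum_left n)
    have al_ek: "al x (e k) v = (\<Sum>m\<in>UNIV. v $ m *\<^sub>R sff k m x)" for v
      by (subst vec_expand[of v])
        (simp only: bounded_bilinear.sum_right[OF al_bilinear] bounded_bilinear.scaleR_right[OF al_bilinear] al_axis)
    have "dd (e k) (dd (e i) z) x = dd (e k) (\<lambda>y. (\<Sum>m\<in>UNIV. cov_deriv i Z y $ m *\<^sub>R dF m y) + G y (Z y) (e i) *\<^sub>R \<eta> y) x"
      by (rule dd_cong_open[OF U(1,3) d1])
    also have "\<dots> = (\<Sum>m\<in>UNIV. dd (e k) (\<lambda>y. cov_deriv i Z y $ m *\<^sub>R dF m y) x) + dd (e k) (\<lambda>y. G y (Z y) (e i) *\<^sub>R \<eta> y) x"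
      by (simp add: dd_add[OF dS dG\<eta>] dd_sum[OF dp])
    also have "lor \<dots> p = (\<Sum>m\<in>UNIV. cov_deriv i Z x $ m * lor (sff k m x) p) + G x (Z x) (e i) * lor (dd (e k) \<eta> x) p"
      by (simp add: dd_bilinear[OF bounded_bilinear_scaleR dn ddF] dd_bilinear[OF bounded_bilinear_scaleR dG diff_\<eta>[OF x]]
          lor.sum_left lor_simps n s p(2))
    finally show ?thesis by (simp add: al_ek lor.sum_left lor_simps)
  qed
  show ?thesis using d2[of k i] d2[of i k] dd_commute[OF U(1,3) sz, of "e k" "e i"] by simp
qed

text \<open>Contracting one index of \<open>nullity_second_order\<close> with \<open>Y\<close>
  annihilates its right-hand side: \<open>al x Y\<close> takes values in multiples of
  \<open>\<eta>\<close>, which are orthogonal to \<open>p\<close>, and the derivative of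
  \<open>\<eta>\<close> along \<open>Y\<close> is zero.\<close>

lemma nullity_contracted:
  assumes U: "open U" "U \<subseteq> W" "x \<in> U" and Z: "smooth_on Z U"
    and null: "\<And>y v. y \<in> U \<Longrightarrow> al y (Z y) v = G y (Z y) v *\<^sub>R \<eta> y"
    and Y: "\<And>v. al x Y v = G x Y v *\<^sub>R \<eta> x" "dd Y \<eta> x = 0"
    and p: "p \<in> N x" "lor (\<eta> x) p = 0"
  shows "lor (al x v (\<Sum>i\<in>UNIV. Y $ i *\<^sub>R cov_deriv i Z x)) p + G x (Z x) Y * lor (dd v \<eta> x) p = 0"
proof -
  have x: "x \<in> W" using U by blast
  interpret al: bounded_bilinear "al x" by (rule al_bilinear)
  interpret G: bounded_bilinear "G x" by (rule G_bilinear)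
  note wl = linear_add[OF linear_d\<eta>[OF x]] linear_scale[OF linear_d\<eta>[OF x]]
  let ?V = "\<Sum>i\<in>UNIV. Y $ i *\<^sub>R cov_deriv i Z x"
  let ?f = "\<lambda>v. lor (al x v ?V) p + G x (Z x) Y * lor (dd v \<eta> x) p"
  have "linear ?f"
    by (rule linearI) (simp_all add: al.add_left al.scaleR_left lor_simps wl algebra_simps)
  moreover have "?f (e k) = 0" for k
  proof -
    have GY: "G x (Z x) Y = (\<Sum>i\<in>UNIV. Y $ i * G x (Z x) (e i))"
      by (subst vec_expand[of Y]) (simp only: G.sum_right G.scaleR_right real_scaleR_def)
    have aY: "(\<Sum>i\<in>UNIV. Y $ i * lor (al x (e i) q) p) = lor (al x Y q) p" for q
      by (subst (2) vec_expand[of Y]) (simp add: al.sum_left al.scaleR_left lor.sum_left lor_simps)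
    have wY: "(\<Sum>i\<in>UNIV. Y $ i * lor (dd (e i) \<eta> x) p) = lor (dd Y \<eta> x) p"
      by (simp add: dd_expand[OF diff_\<eta>[OF x], of Y] lor.sum_left lor_simps)
    have "?f (e k) = (\<Sum>i\<in>UNIV. Y $ i * (lor (al x (e k) (cov_deriv i Z x)) p + G x (Z x) (e i) * lor (dd (e k) \<eta> x) p))"
      by (simp add: GY al.sum_right al.scaleR_right lor.sum_left lor_simps distrib_left sum.distrib sum_distrib_right mult.assoc)
    also have "\<dots> = (\<Sum>i\<in>UNIV. Y $ i * (lor (al x (e i) (cov_deriv k Z x)) p + G x (Z x) (e k) * lor (dd (e i) \<eta> x) p))"
      by (simp add: nullity_second_order[OF U Z null p, of k])
    also have "\<dots> = lor (al x Y (cov_deriv k Z x)) p + G x (Z x) (e k) * lor (dd Y \<eta> x) p"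
      unfolding aY[symmetric] wY[symmetric] by (simp add: distrib_left sum.distrib sum_distrib_left mult_ac)
    also have "\<dots> = 0" by (simp add: Y lor_simps p(2))
    finally show ?thesis .
  qed
  ultimately show ?thesis by (rule linear_zero_axis)
qed

text \<open>Let \<open>V\<close> be the covariant derivative of \<open>Y\<close> along itself. For
  the field \<open>Y\<close>, \<open>nullity_contracted\<close> shows that
  \<open>\<alpha>' V\<close> is minus the squared length of \<open>Y\<close> times the derivative of
  \<open>\<eta>\<close>. The field \<open>J Y\<close> is orthogonal to \<open>Y\<close> and has
  covariant derivative \<open>J V\<close> along \<open>Y\<close>, so for it the result is
  \<open>\<alpha>' (J V) = 0\<close>. These are the hypotheses of \<open>\<omega>_rank_one\<close>,
  and \<open>V\<close> also witnesses the second claim.\<close>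

lemma rank_one_from_nullity:
  assumes U: "open U" "U \<subseteq> W" "x \<in> U" and Y: "smooth_on Y U" "Y x \<noteq> 0"
    and null: "\<And>y v. y \<in> U \<Longrightarrow> al y (Y y) v = G y (Y y) v *\<^sub>R \<eta> y"
      "\<And>y v. y \<in> U \<Longrightarrow> al y (J y (Y y)) v = G y (J y (Y y)) v *\<^sub>R \<eta> y"
    and \<omega>Y: "dd (Y x) \<eta> x = 0" and u: "dd u \<eta> x \<noteq> 0"
  shows "dd w \<eta> x = (lor (dd u \<eta> x) (dd w \<eta> x) / lor (dd u \<eta> x) (dd u \<eta> x)) *\<^sub>R dd u \<eta> x"
    and "\<exists>v. lor (dd u (dd v F) x) (dd u \<eta> x) \<noteq> 0"
proof -
  have x: "x \<in> W" using U by blast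
  interpret K: kaehler_sff_codazzi "N x" "F x" "G x" "J x" "al x" "\<eta> x" "\<lambda>v. dd v \<eta> x" by (rule codazzi_at[OF x])
  let ?c = "G x (Y x) (Y x)"
  define V where "V = (\<Sum>i\<in>UNIV. Y x $ i *\<^sub>R cov_deriv i Y x)"
  have JY: "smooth_on (\<lambda>y. J y (Y y)) U"
    unfolding J_def matrix_vector_mult_def
    by (intro smooth_on_vec smooth_on_sum smooth_on_mult smooth_on_subset[OF smooth_J_entry U(2)] smooth_on_vec_nth[OF U(1) Y(1)] U)
  have JV: "(\<Sum>i\<in>UNIV. Y x $ i *\<^sub>R cov_deriv i (\<lambda>y. J y (Y y)) x) = J x V"
    by (simp add: V_def cov_deriv_J[OF U Y(1)] linear_sum[OF J_linear] linear_scale[OF J_linear])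
  have c: "?c > 0" using K.G(3)[OF Y(2)] .
  have pair: "p = 0" if "p \<in> N x" "lor p (F x) = 0" "lor p (\<eta> x) = 0" "lor p p = 0" for p
    using lor_perp_pos(2)[OF F_null[OF x] \<eta>_F[OF x]] that by blast
  have V1: "K.\<alpha>' V v = - (?c *\<^sub>R dd v \<eta> x)" for v
  proof -
    \<comment> \<open>Pairing the identity with the very vector that should vanish makes that vector
      isotropic in a positive definite space.\<close>
    let ?p = "K.\<alpha>' V v + ?c *\<^sub>R dd v \<eta> x"
    have p: "?p \<in> N x" "lor ?p (F x) = 0" "lor ?p (\<eta> x) = 0"
      using K.\<alpha>'_normal[of V v] K.\<omega>(2-4)[of v] subspace_add[OF N_subspace] subspace_scale[OF N_subspace]
      by (auto simp: lor_simps)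
    have p': "lor (\<eta> x) ?p = 0" using p(3) by (simp add: lor_sym)
    have "lor (al x v V) ?p + ?c * lor (dd v \<eta> x) ?p = 0"
      by (rule nullity_contracted[OF U Y(1) null(1) null(1)[OF U(3)] \<omega>Y p(1) p', folded V_def])
    moreover have "lor (K.\<alpha>' V v) ?p = lor (al x v V) ?p"
      by (subst K.\<alpha>'_def) (simp add: lor.diff_left lor.scaleR_left p' al_sym[OF x, of V v])
    ultimately have "lor ?p ?p = 0" by (simp only: lor.add_left lor.scaleR_left real_scaleR_def)
    from pair[OF p this] show ?thesis by (simp add: eq_neg_iff_add_eq_0)
  qed
  have V2: "K.\<alpha>' (J x V) v = 0" for v
  proof -
    let ?p = "K.\<alpha>' (J x V) v"
    note p = K.\<alpha>'_normal[of "J x V" v]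
    have p': "lor (\<eta> x) ?p = 0" using p(3) by (simp add: lor_sym)
    have "lor (al x v (J x V)) ?p + G x (J x (Y x)) (Y x) * lor (dd v \<eta> x) ?p = 0"
      by (rule nullity_contracted[OF U JY null(2) null(1)[OF U(3)] \<omega>Y p(1) p', unfolded JV])
    then have "lor (al x v (J x V)) ?p = 0" by (simp add: K.G_self_J)
    moreover have "lor ?p ?p = lor (al x v (J x V)) ?p"
      by (subst K.\<alpha>'_def) (simp add: lor.diff_left lor.scaleR_left p' al_sym[OF x, of "J x V" v])
    ultimately have "lor ?p ?p = 0" by simp
    from pair[OF p this] show ?thesis .
  qed
  show "dd w \<eta> x = (lor (dd u \<eta> x) (dd w \<eta> x) / lor (dd u \<eta> x) (dd u \<eta> x)) *\<^sub>R dd u \<eta> x"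
    by (rule K.\<omega>_rank_one[OF V1 c V2 u])
  have "lor (al x u V) (dd u \<eta> x) = lor (K.\<alpha>' V u) (dd u \<eta> x)"
    by (simp add: K.\<alpha>'_def lor_simps al_sym[OF x, of V u] lor_sym[of "\<eta> x"] d\<eta>_\<eta>[OF x])
  also have "\<dots> = - (?c * lor (dd u \<eta> x) (dd u \<eta> x))" by (simp add: V1 lor_simps)
  finally have "lor (al x u V) (dd u \<eta> x) \<noteq> 0" using c K.\<omega>_pos[OF u] by simp
  then show "\<exists>v. lor (dd u (dd v F) x) (dd u \<eta> x) \<noteq> 0"
    using dd_dd_F_normal[OF x d\<eta>_N[OF x], of u V u] by metis
qed


text \<open>All requirements on \<open>Y\<close> other than \<open>Y x \<noteq> 0\<close> are
  linear, and \<open>exists_null_direction\<close> solves them wherever the derivative of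
  \<open>\<eta>\<close> is nonzero; \<open>kernel_section\<close> makes the solution smooth near a
  point of maximal rank.\<close>

lemma exists_nullity_field:
  assumes x1: "x1 \<in> W" "dd u1 \<eta> x1 \<noteq> 0"
  obtains U Y where "open U" "U \<noteq> {}" "U \<subseteq> W" "smooth_on Y U" "\<And>x. x \<in> U \<Longrightarrow> Y x \<noteq> 0"
    "\<And>x v. x \<in> U \<Longrightarrow> al x (Y x) v = G x (Y x) v *\<^sub>R \<eta> x"
    "\<And>x v. x \<in> U \<Longrightarrow> al x (J x (Y x)) v = G x (J x (Y x)) v *\<^sub>R \<eta> x"
    "\<And>x. x \<in> U \<Longrightarrow> dd (Y x) \<eta> x = 0" "\<And>x. x \<in> U \<Longrightarrow> dd u1 \<eta> x \<noteq> 0"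
proof -
  \<comment> \<open>The rank is maximised only over points with \<open>dd u1 \<eta>\<close> nonzero,
    so that a nonzero solution exists at the point found.\<close>
  define W1 where "W1 = W \<inter> dd u1 \<eta> -` (- {0})"
  have W1: "open W1" unfolding W1_def
    by (rule continuous_open_preimage[OF smooth_on_continuous[OF smooth_on_dd[OF smooth_\<eta>]] W])
      (rule open_Compl[OF closed_singleton])
  have W1W: "W1 \<subseteq> W" by (auto simp: W1_def)
  note sub = smooth_on_subset[OF _ W1W]
  define A where "A x y = ((\<chi> k. al x y (e k) - G x y (e k) *\<^sub>R \<eta> x) :: 'm lspace ^ 'd,
     (\<chi> k. al x (J x y) (e k) - G x (J x y) (e k) *\<^sub>R \<eta> x) :: 'm lspace ^ 'd,
     (\<Sum>i\<in>UNIV. y $ i *\<^sub>R dd (e i) \<eta> x), (\<Sum>i\<in>UNIV. J x y $ i *\<^sub>R dd (e i) \<eta> x))" for x y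
  have lA: "linear (A x)" for x
  proof -
    interpret al: bounded_bilinear "al x" by (rule al_bilinear)
    interpret G: bounded_bilinear "G x" by (rule G_bilinear)
    note Jl = linear_add[OF J_linear, of x] linear_scale[OF J_linear, of x]
    show ?thesis
      by (rule linearI)
        (simp_all add: A_def Jl al.add_left al.scaleR_left G.add_left G.scaleR_left vec_eq_iff algebra_simps
          sum.distrib scaleR_sum_right)
  qed
  have sJ: "smooth_on (\<lambda>x. J x y $ i) W1" for y i
    unfolding J_def matrix_vector_mult_def
    by (simp, intro smooth_on_sum smooth_on_mult smooth_on_const sub smooth_J_entry W1)
  have sA: "smooth_on (\<lambda>x. A x y) W1" for y
    unfolding A_def al_def G_expand
    by (intro smooth_on_Pair smooth_on_vec smooth_on_diff smooth_on_sum smooth_on_scaleR smooth_on_mult smooth_on_const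
        sJ sub[OF smooth_sff] sub[OF smooth_g_entry] sub[OF smooth_\<eta>] sub[OF smooth_on_dd[OF smooth_\<eta>]] W1)
  have x1W: "x1 \<in> W1" using x1 by (simp add: W1_def)
  obtain x0 where x0: "x0 \<in> W1" and max: "\<And>x. x \<in> W1 \<Longrightarrow> dim (range (A x)) \<le> dim (range (A x0))"
    using max_dim_point[OF x1W, of "\<lambda>x. range (A x)"] by blast
  have x0W: "x0 \<in> W" and u0: "dd u1 \<eta> x0 \<noteq> 0" using x0 by (auto simp: W1_def)
  interpret K: kaehler_sff_codazzi "N x0" "F x0" "G x0" "J x0" "al x0" "\<eta> x0" "\<lambda>v. dd v \<eta> x0" by (rule codazzi_at[OF x0W])
  obtain y where y: "y \<noteq> 0" "\<And>z. K.\<alpha>' y z = 0" "\<And>z. K.\<alpha>' (J x0 y) z = 0" "dd y \<eta> x0 = 0" "dd (J x0 y) \<eta> x0 = 0"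
    using K.exists_null_direction[OF u0] by blast
  have ex: "(\<Sum>i\<in>UNIV. y $ i *\<^sub>R dd (e i) \<eta> x) = dd y \<eta> x" if "x \<in> W" for x y
    by (rule dd_expand[OF diff_\<eta>[OF that], symmetric])
  have A0: "A x0 y = 0"
    using y(2-5) by (simp add: A_def ex[OF x0W] K.\<alpha>'_def zero_prod_def vec_eq_iff)
  obtain U0 Y where U0: "open U0" "x0 \<in> U0" "U0 \<subseteq> W1" and Y: "smooth_on Y U0" "Y x0 = y" "\<And>x. x \<in> U0 \<Longrightarrow> A x (Y x) = 0"
    using kernel_section[OF W1 x0 lA sA max A0] by blast
  define U where "U = U0 \<inter> Y -` (- {0})"
  have U: "open U" unfolding U_def
    by (rule continuous_open_preimage[OF smooth_on_continuous[OF Y(1)] U0(1)]) (rule open_Compl[OF closed_singleton])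
  have UU: "U \<subseteq> U0" "U \<subseteq> W" using U0 W1W by (auto simp: U_def)
  have axis: "al x z v = G x z v *\<^sub>R \<eta> x" if "\<And>k. al x z (e k) = G x z (e k) *\<^sub>R \<eta> x" for x z v
  proof -
    interpret al: bounded_bilinear "al x" by (rule al_bilinear)
    interpret G: bounded_bilinear "G x" by (rule G_bilinear)
    have "al x z v - G x z v *\<^sub>R \<eta> x = 0"
      by (rule linear_zero_axis[where f = "\<lambda>v. al x z v - G x z v *\<^sub>R \<eta> x"])
        (auto intro!: linearI simp: that al.add_right al.scaleR_right G.add_right G.scaleR_right algebra_simps)
    then show ?thesis by simp
  qed
  have AY: "al x (Y x) (e k) = G x (Y x) (e k) *\<^sub>R \<eta> x" "al x (J x (Y x)) (e k) = G x (J x (Y x)) (e k) *\<^sub>R \<eta> x"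
    "dd (Y x) \<eta> x = 0" if "x \<in> U" for x k
  proof -
    have "x \<in> U0" "x \<in> W" using that UU by auto
    then show "al x (Y x) (e k) = G x (Y x) (e k) *\<^sub>R \<eta> x" "al x (J x (Y x)) (e k) = G x (J x (Y x)) (e k) *\<^sub>R \<eta> x"
      "dd (Y x) \<eta> x = 0"
      using arg_cong[OF Y(3), of x fst] arg_cong[OF Y(3), of x "\<lambda>a. fst (snd a)"]
        arg_cong[OF Y(3), of x "\<lambda>a. fst (snd (snd a))"] by (auto simp: A_def vec_eq_iff ex)
  qed
  show ?thesis
  proof (rule that[OF U _ UU(2) smooth_on_subset[OF Y(1) UU(1)]])
    show "U \<noteq> {}" using U0(2) Y(2) y(1) by (auto simp: U_def)
    show "Y x \<noteq> 0" if "x \<in> U" for x using that by (simp add: U_def)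
    show "dd u1 \<eta> x \<noteq> 0" if "x \<in> U" for x using that UU U0 by (auto simp: W1_def)
  qed (use axis AY in blast)+
qed

text \<open>The alternative is not pointwise: the first case holds on all of \<open>W\<close>, the
  second on some smaller open set, which suffices because good sets are only sought inside every
  open set.\<close>

theorem dichotomy:
  assumes "W \<noteq> {}"
  obtains (parallel) "\<And>x v. x \<in> W \<Longrightarrow> dd v \<eta> x = 0"
  | (rank_one) U u where "open U" "U \<noteq> {}" "U \<subseteq> W"
     "\<And>x. x \<in> U \<Longrightarrow> dd u \<eta> x \<noteq> 0"
     "\<And>x w. x \<in> U \<Longrightarrow> dd w \<eta> x = (lor (dd u \<eta> x) (dd w \<eta> x) / lor (dd u \<eta> x) (dd u \<eta> x)) *\<^sub>R dd u \<eta> x"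
     "\<And>x. x \<in> U \<Longrightarrow> \<exists>v. lor (dd u (dd v F) x) (dd u \<eta> x) \<noteq> 0"
proof (cases "\<forall>x\<in>W. \<forall>v. dd v \<eta> x = 0")
  case True
  then show ?thesis using parallel by blast
next
  case False
  then obtain x1 u where x1: "x1 \<in> W" "dd u \<eta> x1 \<noteq> 0" by blast
  obtain U Y where U: "open U" "U \<noteq> {}" "U \<subseteq> W" and Y: "smooth_on Y U" "\<And>x. x \<in> U \<Longrightarrow> Y x \<noteq> 0"
    and n: "\<And>x v. x \<in> U \<Longrightarrow> al x (Y x) v = G x (Y x) v *\<^sub>R \<eta> x"
    "\<And>x v. x \<in> U \<Longrightarrow> al x (J x (Y x)) v = G x (J x (Y x)) v *\<^sub>R \<eta> x"
    "\<And>x. x \<in> U \<Longrightarrow> dd (Y x) \<eta> x = 0" "\<And>x. x \<in> U \<Longrightarrow> dd u \<eta> x \<noteq> 0"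
    using exists_nullity_field[OF x1] by blast
  note r = rank_one_from_nullity[OF U(1,3) _ Y n(1,2,3,4)]
  show ?thesis
    by (rule rank_one[OF U n(4)]) (use r in blast)+
qed

end

section \<open>Null curves with a parallel frame\<close>

text \<open>The next vector has to be orthogonal to \<open>P\<close>, \<open>Q\<close>,
  \<open>R\<close> and the \<open>k\<close> vectors found, which is possible as long as
  \<open>k + 3\<close> is below the dimension \<open>CARD('m) + 2\<close>. Orthogonality to
  \<open>P\<close> and \<open>Q\<close> makes it spacelike, so it can be normalised.\<close>

lemma orthonormal_complement:
  fixes P Q R :: "'m::finite lspace"
  assumes PQ: "lor P P = 0" "lor Q P = -1"
  shows "k + 3 \<le> CARD('m) + 2 \<Longrightarrow> \<exists>xs. length xs = k \<and> sorted_wrt (\<lambda>u v. lor u v = 0) xs \<and>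
     (\<forall>u\<in>set xs. lor u u = 1 \<and> lor u P = 0 \<and> lor u Q = 0 \<and> lor u R = 0)"
proof (induction k)
  case 0
  show ?case by (intro exI[of _ "[]"]) simp
next
  case (Suc k)
  then obtain xs where xs: "length xs = k" "sorted_wrt (\<lambda>u v. lor u v = 0) xs"
    "\<forall>u\<in>set xs. lor u u = 1 \<and> lor u P = 0 \<and> lor u Q = 0 \<and> lor u R = 0" by auto
  let ?ys = "P # Q # R # xs"
  let ?\<Phi> = "(\<lambda>w v. lor v w) ` set ?ys"
  have "card ?\<Phi> \<le> length ?ys" by (intro order_trans[OF card_image_le] card_length) simp
  also have "\<dots> < DIM('m lspace)" using Suc.prems xs(1) by simp
  finally have c: "card ?\<Phi> < DIM('m lspace)" .
  have f: "finite ?\<Phi>" by simp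
  have l: "linear \<phi>" if "\<phi> \<in> ?\<Phi>" for \<phi>
  proof -
    have lw: "linear (\<lambda>v. lor v w)" for w :: "'m lspace"
      by (rule bounded_linear.linear[OF lor.bounded_linear_left])
    show ?thesis using that by (elim imageE) (simp only: lw)
  qed
  obtain v where v: "v \<noteq> 0" "\<And>\<phi>. \<phi> \<in> ?\<Phi> \<Longrightarrow> \<phi> v = 0" using common_zero[OF f c l] by blast
  have v0: "lor v w = 0" if "w \<in> set ?ys" for w using v(2)[of "\<lambda>v. lor v w"] that by blast
  have vv: "lor v v > 0"
    using lor_perp_pos[OF PQ, of v] v0[of P] v0[of Q] v(1) by (smt (verit) list.set_intros)
  let ?v = "(1 / sqrt (lor v v)) *\<^sub>R v"
  have "lor ?v ?v = 1" using vv by (simp add: lor_simps)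
  then show ?case
    using xs v0 by (intro exI[of _ "?v # xs"]) (simp add: lor_simps)
qed

locale null_curve =
  fixes T :: "real set" and c :: "real \<Rightarrow> 'm::finite lspace"
  assumes T: "open T" and smooth_c: "smooth_on c T"
    and c_null: "\<And>t. t \<in> T \<Longrightarrow> lor (c t) (c t) = 0"
    and c_regular: "\<And>t. t \<in> T \<Longrightarrow> lor (dd 1 c t) (dd 1 c t) > 0"
begin

abbreviation "c1 \<equiv> dd 1 c"
abbreviation "c2 \<equiv> dd 1 (dd 1 c)"
abbreviation "c3 \<equiv> dd 1 (dd 1 (dd 1 c))"

lemma smooth_c123: "smooth_on c1 T" "smooth_on c2 T" "smooth_on c3 T"
  by (intro smooth_on_dd smooth_c)+

lemma diff_c: assumes "t \<in> T" shows "c differentiable (at t)" "c1 differentiable (at t)" "c2 differentiable (at t)"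
  using smooth_on_differentiable[OF smooth_c assms] smooth_on_differentiable[OF smooth_c123(1) assms]
    smooth_on_differentiable[OF smooth_c123(2) assms] by auto

lemma c_c1: assumes t: "t \<in> T" shows "lor (c t) (c1 t) = 0" "lor (c1 t) (c t) = 0"
proof -
  have "dd 1 (\<lambda>t. lor (c t) (c t)) t = 0"
    using dd_cong_open[OF T t, of "\<lambda>t. lor (c t) (c t)" "\<lambda>_. 0" 1] c_null by simp
  then show "lor (c t) (c1 t) = 0" "lor (c1 t) (c t) = 0"
    using dd_bilinear[OF lor_bilinear diff_c(1)[OF t] diff_c(1)[OF t], of 1] lor_sym[of "c t" "c1 t"] by simp_all
qed

lemma c_c2: assumes t: "t \<in> T" shows "lor (c t) (c2 t) = - lor (c1 t) (c1 t)"
proof -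
  have "dd 1 (\<lambda>t. lor (c t) (c1 t)) t = 0"
    using dd_cong_open[OF T t, of "\<lambda>t. lor (c t) (c1 t)" "\<lambda>_. 0" 1] c_c1 by simp
  then show ?thesis
    using dd_bilinear[OF lor_bilinear diff_c(1)[OF t] diff_c(2)[OF t], of 1] by simp
qed

text \<open>Transport along the curve that is parallel in the bundle \<open>{c, c1}\<^sup>\<bottom> / c\<close>.\<close>
definition "transport t e = - (lor e (c2 t) / lor (c1 t) (c1 t)) *\<^sub>R c1 t"

text \<open>Differential equation inside, continuity up to the ends: conserved pairings can then be
  evaluated at \<open>t0\<close>, where the initial data are given.\<close>

definition "solution t0 \<delta> y \<longleftrightarrow> continuous_on {t0..t0 + \<delta>} y \<and> smooth_on y {t0<..<t0 + \<delta>} \<and>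
   (\<forall>t\<in>{t0<..<t0 + \<delta>}. (y has_vector_derivative transport t (y t)) (at t))"

lemma solutions_exist:
  assumes "t0 \<in> T"
  obtains \<delta> where "\<delta> > 0" "{t0..t0 + \<delta>} \<subseteq> T" "\<And>e. \<exists>y. y t0 = e \<and> solution t0 \<delta> y"
proof -
  have l: "linear (transport t)" for t
    by (rule linearI) (simp_all add: transport_def lor_simps add_divide_distrib algebra_simps)
  have s: "smooth_on (\<lambda>t. transport t v) T" for v
    unfolding transport_def
    by (intro smooth_on_scaleR smooth_on_minus smooth_on_divide smooth_on_bilinear[OF lor_bilinear] smooth_c123 smooth_on_const T)
      (use c_regular in force)
  obtain \<delta> where "\<delta> > 0" "{t0..t0 + \<delta>} \<subseteq> T"
    "\<And>e. \<exists>y. y t0 = e \<and> continuous_on {t0..t0 + \<delta>} y \<and> smooth_on y {t0<..<t0 + \<delta>} \<and>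
       (\<forall>t\<in>{t0<..<t0 + \<delta>}. (y has_vector_derivative transport t (y t)) (at t))"
    using linear_ode[OF T assms l s] by blast
  then show ?thesis using that unfolding solution_def by blast
qed

context
  fixes t0 \<delta> :: real
  assumes \<delta>: "\<delta> > 0" "{t0..t0 + \<delta>} \<subseteq> T"
begin

lemma pairing_constant:
  assumes y: "continuous_on {t0..t0 + \<delta>} y" "continuous_on {t0..t0 + \<delta>} z"
    and d: "\<And>t. t \<in> {t0<..<t0 + \<delta>} \<Longrightarrow> (y has_vector_derivative y' t) (at t)"
      "\<And>t. t \<in> {t0<..<t0 + \<delta>} \<Longrightarrow> (z has_vector_derivative z' t) (at t)"
    and 0: "\<And>t. t \<in> {t0<..<t0 + \<delta>} \<Longrightarrow> lor (y t) (z' t) + lor (y' t) (z t) = 0"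
    and t: "t \<in> {t0..t0 + \<delta>}"
  shows "lor (y t) (z t) = lor (y t0) (z t0)"
proof (rule DERIV_isconst2[of t0 "t0 + \<delta>" "\<lambda>t. lor (y t) (z t)"])
  show "continuous_on {t0..t0 + \<delta>} (\<lambda>t. lor (y t) (z t))"
    by (rule lor.continuous_on[OF y])
  fix t assume "t0 < t" "t < t0 + \<delta>"
  then have t: "t \<in> {t0<..<t0 + \<delta>}" by simp
  have "((\<lambda>t. lor (y t) (z t)) has_vector_derivative lor (y t) (z' t) + lor (y' t) (z t)) (at t)"
    by (rule bounded_bilinear.has_vector_derivative[OF lor_bilinear d(1)[OF t] d(2)[OF t]])
  then show "DERIV (\<lambda>t. lor (y t) (z t)) t :> 0"
    by (simp add: 0[OF t] has_real_derivative_iff_has_vector_derivative)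
qed (use \<delta> t in auto)

lemma c_vector_derivative:
  assumes "t \<in> T"
  shows "(c has_vector_derivative c1 t) (at t)" "(c1 has_vector_derivative c2 t) (at t)"
  using line_has_vector_derivative[of c 0 t 1] line_has_vector_derivative[of c1 0 t 1] diff_c[OF assms] by simp_all

lemma continuous_c: "continuous_on {t0..t0 + \<delta>} c" "continuous_on {t0..t0 + \<delta>} c1"
  using continuous_on_subset[OF smooth_on_continuous[OF smooth_c] \<delta>(2)]
    continuous_on_subset[OF smooth_on_continuous[OF smooth_c123(1)] \<delta>(2)] by auto

lemma in_T: "t \<in> {t0<..<t0 + \<delta>} \<Longrightarrow> t \<in> T"
  using \<delta>(2) by (auto simp: subset_iff)

text \<open>The coefficient in \<open>transport\<close> is chosen such that
  \<open>lor (transport s (y s)) (c1 s)\<close> cancels \<open>lor (y s) (c2 s)\<close>.\<close>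

lemma solution_c1:
  assumes y: "solution t0 \<delta> y" "lor (y t0) (c1 t0) = 0" and t: "t \<in> {t0..t0 + \<delta>}"
  shows "lor (y t) (c1 t) = 0"
proof -
  have "lor (y t) (c1 t) = lor (y t0) (c1 t0)"
  proof (rule pairing_constant[OF _ continuous_c(2) _ _ _ t])
    show "(y has_vector_derivative transport s (y s)) (at s)" if "s \<in> {t0<..<t0 + \<delta>}" for s
      using y(1) that by (simp add: solution_def)
    show "(c1 has_vector_derivative c2 s) (at s)" if "s \<in> {t0<..<t0 + \<delta>}" for s
      by (rule c_vector_derivative[OF in_T[OF that]])
    show "lor (y s) (c2 s) + lor (transport s (y s)) (c1 s) = 0" if "s \<in> {t0<..<t0 + \<delta>}" for s
      using c_regular[OF in_T[OF that]] by (simp add: transport_def lor_simps)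
  qed (use y in \<open>simp add: solution_def\<close>)
  then show ?thesis using y(2) by simp
qed

lemma solution_c:
  assumes y: "solution t0 \<delta> y" "lor (y t0) (c1 t0) = 0" and t: "t \<in> {t0..t0 + \<delta>}"
  shows "lor (y t) (c t) = lor (y t0) (c t0)"
proof (rule pairing_constant[OF _ continuous_c(1) _ _ _ t])
  show "(y has_vector_derivative transport s (y s)) (at s)" if "s \<in> {t0<..<t0 + \<delta>}" for s
    using y(1) that by (simp add: solution_def)
  show "(c has_vector_derivative c1 s) (at s)" if "s \<in> {t0<..<t0 + \<delta>}" for s
    by (rule c_vector_derivative[OF in_T[OF that]])
  show "lor (y s) (c1 s) + lor (transport s (y s)) (c s) = 0" if "s \<in> {t0<..<t0 + \<delta>}" for s
    using solution_c1[OF y, of s] that c_c1[OF in_T[OF that]] by (simp add: transport_def lor_simps)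
qed (use y in \<open>simp add: solution_def\<close>)

lemma solution_solution:
  assumes y: "solution t0 \<delta> y" "lor (y t0) (c1 t0) = 0" and z: "solution t0 \<delta> z" "lor (z t0) (c1 t0) = 0"
    and t: "t \<in> {t0..t0 + \<delta>}"
  shows "lor (y t) (z t) = lor (y t0) (z t0)"
proof (rule pairing_constant[OF _ _ _ _ _ t])
  show "(y has_vector_derivative transport s (y s)) (at s)" if "s \<in> {t0<..<t0 + \<delta>}" for s
    using y(1) that by (simp add: solution_def)
  show "(z has_vector_derivative transport s (z s)) (at s)" if "s \<in> {t0<..<t0 + \<delta>}" for s
    using z(1) that by (simp add: solution_def)
  show "lor (y s) (transport s (z s)) + lor (transport s (y s)) (z s) = 0" if "s \<in> {t0<..<t0 + \<delta>}" for s
    using solution_c1[OF y, of s] solution_c1[OF z, of s] that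
    by (simp add: transport_def lor_simps lor_sym[of "c1 s" "z s"])
qed (use y z in \<open>simp_all add: solution_def\<close>)

end

end

locale framed_null_curve = null_curve T c for T and c :: "real \<Rightarrow> 'm::finite lspace" +
  fixes \<zeta> :: "real \<Rightarrow> 'm lspace" and E :: "'h::finite \<Rightarrow> real \<Rightarrow> 'm lspace"
  assumes smooth_\<zeta>: "smooth_on \<zeta> T" and smooth_E: "\<And>i. smooth_on (E i) T"
    and deriv_\<zeta>: "\<And>t. t \<in> T \<Longrightarrow> dd 1 \<zeta> t = transport t (\<zeta> t)"
    and deriv_E: "\<And>t i. t \<in> T \<Longrightarrow> dd 1 (E i) t = transport t (E i t)"
    and \<zeta>: "\<And>t. t \<in> T \<Longrightarrow> lor (\<zeta> t) (\<zeta> t) = 0" "\<And>t. t \<in> T \<Longrightarrow> lor (\<zeta> t) (c t) = -1" "\<And>t. t \<in> T \<Longrightarrow> lor (\<zeta> t) (c1 t) = 0"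
      "\<And>t i. t \<in> T \<Longrightarrow> lor (\<zeta> t) (E i t) = 0"
    and E: "\<And>t i j. t \<in> T \<Longrightarrow> lor (E i t) (E j t) = (if i = j then 1 else 0)" "\<And>t i. t \<in> T \<Longrightarrow> lor (E i t) (c t) = 0"
      "\<And>t i. t \<in> T \<Longrightarrow> lor (E i t) (c1 t) = 0"
    and dims: "CARD('m) = CARD('h) + 1"

text \<open>\<open>F0\<close> serves as initial value of \<open>\<zeta>\<close>, and an orthonormal
  family in the complement of \<open>F0\<close>, \<open>c t0\<close> and \<open>c1 t0\<close> as
  initial value of \<open>E\<close>; transport preserves all products. The interval lies to the
  right of \<open>t0\<close> and excludes it.\<close>

lemma (in null_curve) exists_frame:
  fixes F0 :: "'m lspace"
  assumes t0: "t0 \<in> T" and F0: "lor F0 F0 = 0" "lor F0 (c t0) = -1" "lor F0 (c1 t0) = 0"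
    and dims: "CARD('m) = CARD('h::finite) + 1"
  obtains \<delta> \<zeta> and E :: "'h::finite \<Rightarrow> real \<Rightarrow> 'm lspace" where "\<delta> > 0" "{t0<..<t0 + \<delta>} \<subseteq> T"
    "framed_null_curve {t0<..<t0 + \<delta>} c \<zeta> E"
proof -
  obtain \<delta> where \<delta>: "\<delta> > 0" "{t0..t0 + \<delta>} \<subseteq> T" and ex: "\<And>e. \<exists>y. y t0 = e \<and> solution t0 \<delta> y"
    by (rule solutions_exist[OF t0]) blast
  let ?I = "{t0<..<t0 + \<delta>}"
  have IT: "?I \<subseteq> T" using \<delta>(2) by force
  have cF: "lor (c t0) F0 = -1" using F0(2) by (simp add: lor_sym)
  obtain xs where xs: "length xs = CARD('h)" "sorted_wrt (\<lambda>u v. lor u v = 0) xs"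
    "\<And>u. u \<in> set xs \<Longrightarrow> lor u u = 1 \<and> lor u F0 = 0 \<and> lor u (c t0) = 0 \<and> lor u (c1 t0) = 0"
    using orthonormal_complement[OF F0(1) cF, of "CARD('h)" "c1 t0"] dims by auto
  obtain idx :: "'h \<Rightarrow> nat" where idx: "bij_betw idx UNIV {0..<CARD('h)}"
    using ex_bij_betw_finite_nat[of "UNIV :: 'h set"] by auto
  have idx_less: "idx i < length xs" for i using bij_betwE[OF idx] xs(1) by auto
  have idx_inj: "idx i = idx j \<longleftrightarrow> i = j" for i j using bij_betw_imp_inj_on[OF idx] by (auto simp: inj_def)
  define E0 where "E0 i = xs ! idx i" for i
  have E0: "lor (E0 i) (E0 i) = 1" "lor (E0 i) F0 = 0" "lor (E0 i) (c t0) = 0" "lor (E0 i) (c1 t0) = 0" for i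
    using xs(3)[of "E0 i"] nth_mem[OF idx_less, of i] by (auto simp: E0_def)
  have E0': "lor (E0 i) (E0 j) = 0" if "i \<noteq> j" for i j
  proof -
    have "idx i < idx j \<or> idx j < idx i" using that idx_inj by (meson linorder_neqE_nat)
    then show ?thesis
      using xs(2) idx_less lor_sym[of "E0 i" "E0 j"] unfolding sorted_wrt_iff_nth_less E0_def by fastforce
  qed
  obtain \<zeta> where \<zeta>: "\<zeta> t0 = F0" "solution t0 \<delta> \<zeta>" using ex by blast
  have "\<exists>E. \<forall>i. E i t0 = E0 i \<and> solution t0 \<delta> (E i)" using ex by (intro choice allI) blast
  then obtain E where E: "\<And>i. E i t0 = E0 i" "\<And>i. solution t0 \<delta> (E i)" by blast
  have \<zeta>1: "lor (\<zeta> t0) (c1 t0) = 0" using F0 \<zeta> by simp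
  have E1: "lor (E i t0) (c1 t0) = 0" for i using E0 E by simp
  have in_cl: "t \<in> {t0..t0 + \<delta>}" if "t \<in> ?I" for t using that by simp
  have dv: "dd 1 y t = transport t (y t)" if "solution t0 \<delta> y" "t \<in> ?I" for y t
    using dd_eq[of y "\<lambda>x. x *\<^sub>R transport t (y t)" t 1] that by (simp add: solution_def has_vector_derivative_def)
  have nc: "null_curve ?I c"
    by unfold_locales (use smooth_on_subset[OF smooth_c IT] c_null c_regular IT in auto)
  interpret I: null_curve ?I c by (rule nc)
  have "framed_null_curve ?I c \<zeta> E"
  proof (rule framed_null_curve.intro[OF nc], rule framed_null_curve_axioms.intro)
    show "smooth_on \<zeta> ?I" "smooth_on (E i) ?I" for i using \<zeta>(2) E(2) by (simp_all add: solution_def)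
    fix t assume t: "t \<in> ?I"
    show "dd 1 \<zeta> t = transport t (\<zeta> t)" "dd 1 (E i) t = transport t (E i t)" for i
      using dv \<zeta>(2) E(2) t by auto
    show "lor (\<zeta> t) (\<zeta> t) = 0"
      using solution_solution[OF \<delta> \<zeta>(2) \<zeta>1 \<zeta>(2) \<zeta>1 in_cl[OF t]] \<zeta>(1) F0 by simp
    show "lor (\<zeta> t) (c t) = -1" using solution_c[OF \<delta> \<zeta>(2) \<zeta>1 in_cl[OF t]] \<zeta>(1) F0 by simp
    show "lor (\<zeta> t) (c1 t) = 0" by (rule solution_c1[OF \<delta> \<zeta>(2) \<zeta>1 in_cl[OF t]])
    show "lor (\<zeta> t) (E i t) = 0" for i
      using solution_solution[OF \<delta> \<zeta>(2) \<zeta>1 E(2) E1 in_cl[OF t], of i] \<zeta>(1) E(1) E0(2)[of i] by (simp add: lor_sym)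
    show "lor (E i t) (E j t) = (if i = j then 1 else 0)" for i j
      using solution_solution[OF \<delta> E(2) E1 E(2) E1 in_cl[OF t], of i j] E(1) E0(1) E0' by simp
    show "lor (E i t) (c t) = 0" for i using solution_c[OF \<delta> E(2) E1 in_cl[OF t], of i] E(1) E0(3) by simp
    show "lor (E i t) (c1 t) = 0" for i by (rule solution_c1[OF \<delta> E(2) E1 in_cl[OF t]])
  qed (rule dims)
  then show ?thesis using that[OF \<delta>(1) IT] by blast
qed

context framed_null_curve
begin

text \<open>\<open>c\<close>, \<open>\<zeta>\<close>, \<open>c1\<close> and the frame together have
  \<open>CARD('m) + 2\<close> members. The remainder \<open>?q\<close> is orthogonal to all of them;
  if nonzero it would give one more non-null orthogonal vector than the dimension allows.\<close>

lemma expansion: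
  assumes t: "t \<in> T" and p: "lor p (c t) = 0" "lor p (c1 t) = 0"
  shows "p = (\<Sum>i\<in>UNIV. lor p (E i t) *\<^sub>R E i t) - lor p (\<zeta> t) *\<^sub>R c t"
proof (rule ccontr)
  assume ne: "\<not> ?thesis"
  let ?q = "p - (\<Sum>i\<in>UNIV. lor p (E i t) *\<^sub>R E i t) + lor p (\<zeta> t) *\<^sub>R c t"
  have sy: "lor (c t) (\<zeta> t) = -1" "lor (c t) (E i t) = 0" "lor (c1 t) (\<zeta> t) = 0" "lor (c1 t) (E i t) = 0" "lor (E i t) (\<zeta> t) = 0" for i
    using \<zeta>[OF t] E[OF t] by (simp_all add: lor_sym[of "c t"] lor_sym[of "c1 t"] lor_sym[of "E i t" "\<zeta> t"])
  have qE: "lor ?q (E j t) = 0" for j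
    by (simp add: lor_simps lor.sum_left E[OF t] sy if_distrib sum.delta cong: if_cong)
  have q\<zeta>: "lor ?q (\<zeta> t) = 0" by (simp add: lor_simps lor.sum_left sy)
  have qc: "lor ?q (c t) = 0" by (simp add: lor_simps lor.sum_left E[OF t] p c_null[OF t])
  have qc1: "lor ?q (c1 t) = 0" by (simp add: lor_simps lor.sum_left E[OF t] p c_c1[OF t])
  have "?q \<noteq> 0" using ne by (auto simp: algebra_simps)
  then have qq: "lor ?q ?q \<noteq> 0" using lor_perp_pos(2)[OF \<zeta>(1)[OF t] sy(1) q\<zeta> qc] by blast
  obtain hs :: "'h list" where hs: "distinct hs" "set hs = UNIV" using finite_distinct_list[OF finite[of "UNIV :: 'h set"]] by blast
  have lhs: "length hs = CARD('h)" using distinct_card[OF hs(1)] hs(2) by simp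
  let ?ys = "?q # (\<zeta> t + c t) # (\<zeta> t - c t) # c1 t # map (\<lambda>i. E i t) hs"
  have oE: "sorted_wrt (\<lambda>u v. lor u v = 0) (map (\<lambda>i. E i t) hs)"
    using hs(1) by (auto simp: sorted_wrt_map sorted_wrt_iff_nth_less E[OF t] nth_eq_iff_index_eq)
  have "length ?ys \<le> dim (UNIV :: 'm lspace set)"
  proof (rule lor_orthogonal_family)
    show "sorted_wrt (\<lambda>u v. lor u v = 0) ?ys"
      using oE qE q\<zeta> qc qc1 by (auto simp: lor.add_right lor.diff_right lor.add_left[of "\<zeta> t" "c t"] lor.diff_left[of "\<zeta> t" "c t"]
        sy \<zeta>[OF t] c_null[OF t] c_c1[OF t])
    show "lor u u \<noteq> 0" if "u \<in> set ?ys" for u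
      using that qq c_regular[OF t] by (auto simp: E[OF t] lor.add_right lor.diff_right lor.add_left[of "\<zeta> t" "c t"]
          lor.diff_left[of "\<zeta> t" "c t"] sy \<zeta>[OF t] c_null[OF t])
  qed simp
  then show False using lhs dims by simp
qed

lemma parseval:
  assumes t: "t \<in> T" and p: "lor p (c t) = 0" "lor p (c1 t) = 0" and q: "lor q (c t) = 0"
  shows "lor p q = (\<Sum>i\<in>UNIV. lor p (E i t) * lor q (E i t))"
proof -
  have "lor p q = lor ((\<Sum>i\<in>UNIV. lor p (E i t) *\<^sub>R E i t) - lor p (\<zeta> t) *\<^sub>R c t) q"
    using expansion[OF t p] by simp
  also have "\<dots> = (\<Sum>i\<in>UNIV. lor p (E i t) * lor (E i t) q)"
    using q by (simp add: lor_simps lor.sum_left lor_sym[of "c t" q])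
  finally show ?thesis by (simp add: lor_sym[of _ q])
qed

text \<open>The null vector \<open>y\<close> with \<open>lor y (c t) = -1\<close>, \<open>lor y (c1 t) = 0\<close> and frame coordinates \<open>z\<close>.\<close>

definition "Y z t = \<zeta> t + (\<Sum>i\<in>UNIV. z $ i *\<^sub>R E i t) + (z \<bullet> z / 2) *\<^sub>R c t" for z :: "real^'h"

lemma Y_pair:
  assumes t: "t \<in> T"
  shows "lor (Y z t) (c t) = -1" "lor (Y z t) (c1 t) = 0" "lor (Y z t) (E j t) = z $ j" "lor (Y z t) (Y z t) = 0"
proof -
  have sy: "lor (c t) (\<zeta> t) = -1" "lor (c t) (E i t) = 0" "lor (E i t) (\<zeta> t) = 0" for i
    using \<zeta>[OF t] E[OF t] by (simp_all add: lor_sym[of "c t"] lor_sym[of "E i t" "\<zeta> t"])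
  show 1: "lor (Y z t) (c t) = -1" by (simp add: Y_def lor_simps lor.sum_left \<zeta>[OF t] E[OF t] c_null[OF t])
  show "lor (Y z t) (c1 t) = 0" by (simp add: Y_def lor_simps lor.sum_left \<zeta>[OF t] E[OF t] c_c1[OF t])
  show 2: "lor (Y z t) (E j t) = z $ j" for j
    by (simp add: Y_def lor_simps lor.sum_left \<zeta>[OF t] E[OF t] sy if_distrib sum.delta cong: if_cong)
  have 3: "lor (Y z t) (\<zeta> t) = - (z \<bullet> z / 2)" by (simp add: Y_def lor_simps lor.sum_left \<zeta>[OF t] sy)
  have "lor (Y z t) (Y z t) = lor (Y z t) (\<zeta> t) + (\<Sum>i\<in>UNIV. z $ i * lor (Y z t) (E i t)) + (z \<bullet> z / 2) * lor (Y z t) (c t)"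
    by (subst (2) Y_def) (simp add: lor.add_right lor.sum_right lor.scaleR_right)
  then show "lor (Y z t) (Y z t) = 0" by (simp add: 1 2 3 inner_vec_def)
qed

text \<open>By \<open>expansion\<close> the difference of \<open>p\<close> and the candidate is a
  multiple of \<open>c\<close>; since both are null and pair to -1 with \<open>c\<close>, the
  multiple is zero.\<close>

lemma Y_unique:
  assumes t: "t \<in> T" and p: "lor p p = 0" "lor p (c t) = -1" "lor p (c1 t) = 0"
  shows "p = Y (\<chi> i. lor p (E i t)) t"
proof -
  let ?Y = "Y (\<chi> i. lor p (E i t)) t"
  have "p - ?Y = (\<Sum>i\<in>UNIV. lor (p - ?Y) (E i t) *\<^sub>R E i t) - lor (p - ?Y) (\<zeta> t) *\<^sub>R c t"
    by (rule expansion[OF t]) (simp_all add: lor_simps Y_pair[OF t] p)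
  then have pY: "p = ?Y - lor (p - ?Y) (\<zeta> t) *\<^sub>R c t"
    by (simp add: lor.diff_left[of p ?Y "E _ t"] Y_pair[OF t] algebra_simps)
  define k where "k = lor (p - ?Y) (\<zeta> t)"
  have e: "p = ?Y - k *\<^sub>R c t" using pY unfolding k_def .
  have "lor p p = 2 * k" by (subst (1 2) e) (simp add: lor_simps Y_pair[OF t] c_null[OF t] lor_sym[of "c t" ?Y])
  then show ?thesis using p(1) e by simp
qed

lemma smooth_Y: "smooth_on (\<lambda>w. Y (fst w) (snd w)) (UNIV \<times> T)"
proof -
  have o: "open (UNIV \<times> T :: ((real^'h) \<times> real) set)" by (intro open_Times open_UNIV T)
  have s: "smooth_on (\<lambda>w. f (snd w)) (UNIV \<times> T :: ((real^'h) \<times> real) set)" if "smooth_on f T" for f :: "real \<Rightarrow> 'm lspace"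
    by (rule smooth_on_compose[OF that o T _ smooth_on_linear[OF bounded_linear_snd]]) auto
  show ?thesis
    unfolding Y_def
    by (intro smooth_on_add smooth_on_sum smooth_on_scaleR smooth_on_divide smooth_on_inner smooth_on_const smooth_on_vec_nth
        smooth_on_linear[OF bounded_linear_fst] s smooth_\<zeta> smooth_E smooth_c o) simp
qed

text \<open>As \<open>lor c c2 = - lor c1 c1\<close>, the curve itself satisfies
  \<open>c1 = transport c\<close>, and the transport equation passes to combinations of
  \<open>\<zeta>\<close>, \<open>E\<close> and \<open>c\<close> with constant coefficients. In
  particular \<open>Y z\<close> is stationary at \<open>t\<close> when
  \<open>lor (Y z t) (c2 t) = 0\<close>.\<close>

lemma dd_Y_t:
  assumes t: "t \<in> T"
  shows "dd 1 (Y z) t = - (lor (Y z t) (c2 t) / lor (c1 t) (c1 t)) *\<^sub>R c1 t"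
proof -
  have d: "\<zeta> differentiable (at t)" "E i differentiable (at t)" for i
    using smooth_on_differentiable[OF smooth_\<zeta> t] smooth_on_differentiable[OF smooth_E t] by auto
  have "dd 1 (Y z) t = dd 1 \<zeta> t + (\<Sum>i\<in>UNIV. z $ i *\<^sub>R dd 1 (E i) t) + (z \<bullet> z / 2) *\<^sub>R c1 t"
    unfolding Y_def[abs_def]
    by (rule dd_eq) (intro has_derivative_add has_derivative_sum has_derivative_scaleR_right differentiable_has_dd d diff_c t)
  also have "\<dots> = - (lor (Y z t) (c2 t) / lor (c1 t) (c1 t)) *\<^sub>R c1 t"
    using c_regular[OF t]
    by (simp add: deriv_\<zeta>[OF t] deriv_E[OF t] transport_def Y_def lor_simps lor.sum_left c_c2[OF t] add_divide_distrib
        scaleR_add_left scaleR_sum_left sum_divide_distrib sum_negf diff_divide_distrib scaleR_diff_left)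
  finally show ?thesis .
qed

lemma dd_Y_z: "dd a (\<lambda>z. Y z t) z = (\<Sum>i\<in>UNIV. a $ i *\<^sub>R E i t) + (z \<bullet> a) *\<^sub>R c t"
proof (rule dd_eq)
  show "((\<lambda>z. Y z t) has_derivative (\<lambda>a. (\<Sum>i\<in>UNIV. a $ i *\<^sub>R E i t) + (z \<bullet> a) *\<^sub>R c t)) (at z)"
    unfolding Y_def by (auto intro!: derivative_eq_intros bounded_linear.has_derivative[OF bounded_linear_vec_nth] simp: inner_commute)
qed

end

section \<open>Conformal immersions in a chart\<close>

text \<open>The frame along the curve exists only for parameters above \<open>\<tau> x0\<close>, so
  a point of \<open>B\<close> with such a parameter is needed; moving along \<open>u\<close> or
  against it, according to the sign of the derivative, provides one.\<close>

lemma value_above: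
  fixes \<tau> :: "'e::euclidean_space \<Rightarrow> real"
  assumes B: "open B" "x0 \<in> B" and \<tau>: "smooth_on \<tau> B" "dd u \<tau> x0 \<noteq> 0" and \<delta>: "\<delta> > 0"
  obtains x where "x \<in> B" "\<tau> x0 < \<tau> x" "\<tau> x < \<tau> x0 + \<delta>"
proof -
  let ?f = "\<lambda>h. \<tau> (x0 + h *\<^sub>R u)"
  have D: "DERIV ?f 0 :> dd u \<tau> x0"
    using line_DERIV[of \<tau> x0 0 u] smooth_on_differentiable[OF \<tau>(1) B(2)] by simp
  have "isCont \<tau> x0" using smooth_on_continuous[OF \<tau>(1)] B by (simp add: continuous_on_eq_continuous_at)
  then obtain d1 where d1: "d1 > 0" "\<And>y. dist y x0 < d1 \<Longrightarrow> dist (\<tau> y) (\<tau> x0) < \<delta>"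
    using \<delta> unfolding continuous_at_eps_delta by blast
  obtain d2 where d2: "d2 > 0" "ball x0 d2 \<subseteq> B" using B open_contains_ball by blast
  define d where "d = min d1 d2 / (norm u + 1)"
  have n: "norm u + 1 > 0" by (smt (verit) norm_ge_zero)
  have d: "d > 0" using d1 d2 n by (simp add: d_def)
  have close: "x0 + h *\<^sub>R u \<in> B \<and> \<tau> (x0 + h *\<^sub>R u) < \<tau> x0 + \<delta>" if "\<bar>h\<bar> < d" for h
  proof -
    have "\<bar>h\<bar> * norm u \<le> \<bar>h\<bar> * (norm u + 1)" by (intro mult_left_mono) auto
    also have "\<dots> < d * (norm u + 1)" using that n by (intro mult_strict_right_mono)
    also have "\<dots> = min d1 d2" using n by (simp add: d_def)
    finally have "dist (x0 + h *\<^sub>R u) x0 < min d1 d2" by (simp add: dist_norm)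
    then show ?thesis using d1(2)[of "x0 + h *\<^sub>R u"] d2(2) by (auto simp: dist_real_def dist_commute)
  qed
  have "\<exists>h. \<bar>h\<bar> < d \<and> \<tau> x0 < ?f h"
  proof (cases "dd u \<tau> x0 > 0")
    case True
    then obtain e where e: "e > 0" "\<And>h. 0 < h \<Longrightarrow> h < e \<Longrightarrow> ?f 0 < ?f (0 + h)"
      using DERIV_pos_inc_right[OF D] by blast
    show ?thesis using e(1) e(2)[of "min d e / 2"] d by (intro exI[of _ "min d e / 2"]) (auto simp: min_def)
  next
    case False
    then have "dd u \<tau> x0 < 0" using \<tau>(2) by simp
    then obtain e where e: "e > 0" "\<And>h. 0 < h \<Longrightarrow> h < e \<Longrightarrow> ?f 0 < ?f (0 - h)"
      using DERIV_neg_dec_left[OF D] by blast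
    show ?thesis using e(1) e(2)[of "min d e / 2"] d by (intro exI[of _ "- (min d e / 2)"]) (auto simp: min_def)
  qed
  then show ?thesis using close that by blast
qed

context conformal_chart_normal
begin

text \<open>A constant rank theorem by hand. A component \<open>\<tau>\<close> of
  \<open>\<eta>\<close> with nonzero derivative along \<open>u\<close> serves as parameter, and
  \<open>pt x t\<close> is a point of the line through \<open>x\<close> in direction
  \<open>u\<close> where \<open>\<tau>\<close> equals \<open>t\<close>. As
  \<open>dd w \<eta>\<close> is a multiple of \<open>dd u \<eta>\<close>, it vanishes with
  \<open>dd w \<tau>\<close>, so \<open>\<eta> (pt x t)\<close> does not depend on
  \<open>x\<close>.\<close>

lemma factor_through_curve:
  assumes U: "open U" "U \<noteq> {}" "U \<subseteq> W" and ne: "\<And>x. x \<in> U \<Longrightarrow> dd u \<eta> x \<noteq> 0"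
    and r1: "\<And>x w. x \<in> U \<Longrightarrow> \<exists>r. dd w \<eta> x = r *\<^sub>R dd u \<eta> x"
  obtains T c B \<tau> x0 where "null_curve T c" "open B" "B \<subseteq> U" "x0 \<in> B" "smooth_on \<tau> B"
    "\<And>x. x \<in> B \<Longrightarrow> \<tau> x \<in> T" "\<And>x. x \<in> B \<Longrightarrow> \<eta> x = c (\<tau> x)" "\<And>x. x \<in> B \<Longrightarrow> dd u \<tau> x \<noteq> 0"
proof -
  obtain x0 where x0: "x0 \<in> U" using U(2) by blast
  obtain k where k: "dd u \<eta> x0 \<bullet> k \<noteq> 0" using ne[OF x0] euclidean_eq_iff[of "dd u \<eta> x0" 0] by auto
  define \<tau> where "\<tau> x = \<eta> x \<bullet> k" for x
  have s\<eta>: "smooth_on \<eta> U" by (rule smooth_on_subset[OF smooth_\<eta> U(3)])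
  have s\<tau>: "smooth_on \<tau> U" unfolding \<tau>_def[abs_def] by (intro smooth_on_inner smooth_on_const s\<eta> U(1))
  have dd\<tau>: "dd v \<tau> x = dd v \<eta> x \<bullet> k" if "x \<in> U" for x v
    unfolding \<tau>_def[abs_def] by (rule dd_linear[OF bounded_linear_inner_left smooth_on_differentiable[OF s\<eta> that]])
  define U1 where "U1 = U \<inter> dd u \<tau> -` (- {0})"
  have U1: "open U1" unfolding U1_def
    by (rule continuous_open_preimage[OF smooth_on_continuous[OF smooth_on_dd[OF s\<tau>]] U(1)]) (rule open_Compl[OF closed_singleton])
  have U1U: "U1 \<subseteq> U" by (auto simp: U1_def)
  have x0U1: "x0 \<in> U1" using x0 k by (simp add: U1_def dd\<tau>)
  have s\<tau>1: "smooth_on \<tau> U1" and s\<eta>1: "smooth_on \<eta> U1" using smooth_on_subset U1U s\<tau> s\<eta> by blast+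
  \<comment> \<open>For \<open>w = ((x, t), s)\<close> the equation \<open>\<Phi> w = 0\<close>
    reads \<open>\<tau> (x + s *\<^sub>R u) = t\<close>, to be solved for \<open>s\<close>.\<close>
  define P where "P w = fst (fst w) + snd w *\<^sub>R u" for w :: "((real^'d) \<times> real) \<times> real"
  have blP: "bounded_linear P"
    by (rule linear_conv_bounded_linear[THEN iffD1], rule linearI) (simp_all add: P_def algebra_simps)
  define S where "S = P -` U1"
  have S: "open S" unfolding S_def
    by (rule open_vimage[OF U1]) (rule linear_continuous_on[OF blP])
  define \<Phi> where "\<Phi> w = \<tau> (P w) - snd (fst w)" for w
  have s\<Phi>: "smooth_on \<Phi> S" unfolding \<Phi>_def[abs_def]
  proof (rule smooth_on_diff[OF S])
    show "smooth_on (\<lambda>w. \<tau> (P w)) S"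
      by (rule smooth_on_compose[OF s\<tau>1 S U1 _ smooth_on_linear[OF blP]]) (auto simp: S_def)
    show "smooth_on (\<lambda>w :: ((real^'d) \<times> real) \<times> real. snd (fst w)) S"
      by (rule smooth_on_linear) (rule bounded_linear_compose[OF bounded_linear_snd bounded_linear_fst])
  qed
  have w0: "((x0, \<tau> x0), 0) \<in> S" using x0U1 by (simp add: S_def P_def)
  have \<Phi>0: "\<Phi> ((x0, \<tau> x0), 0) = 0" by (simp add: \<Phi>_def P_def)
  have d0: "dd (0, 1) \<Phi> ((x0, \<tau> x0), 0) = dd u \<tau> x0"
  proof -
    have 1: "(P has_derivative P) (at ((x0, \<tau> x0), 0))" by (rule bounded_linear_imp_has_derivative[OF blP])
    have 2: "(\<tau> has_derivative (\<lambda>v. dd v \<tau> x0)) (at (P ((x0, \<tau> x0), 0)))"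
      using smooth_on_has_derivative[OF s\<tau> x0] by (simp add: P_def)
    have 3: "((\<lambda>w :: ((real^'d) \<times> real) \<times> real. snd (fst w)) has_derivative (\<lambda>w. snd (fst w))) (at ((x0, \<tau> x0), 0))"
      by (rule bounded_linear_imp_has_derivative[OF bounded_linear_compose[OF bounded_linear_snd bounded_linear_fst]])
    show ?thesis unfolding \<Phi>_def[abs_def]
      using dd_eq[OF has_derivative_diff[OF has_derivative_compose[OF 1 2] 3], of "(0, 1)"] by (simp add: P_def)
  qed
  have d0_ne: "dd (0, 1) \<Phi> ((x0, \<tau> x0), 0) \<noteq> 0" using d0 k dd\<tau>[OF x0] by simp
  obtain U2 I \<sigma> where U2: "open U2" "(x0, \<tau> x0) \<in> U2" and I: "open I" "0 \<in> I" and U2I: "U2 \<times> I \<subseteq> S"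
    and \<sigma>: "smooth_on \<sigma> U2" "\<And>p. p \<in> U2 \<Longrightarrow> \<sigma> p \<in> I" "\<And>p. p \<in> U2 \<Longrightarrow> \<Phi> (p, \<sigma> p) = 0"
      "\<And>p s. p \<in> U2 \<Longrightarrow> s \<in> I \<Longrightarrow> \<Phi> (p, s) = 0 \<Longrightarrow> s = \<sigma> p"
    by (rule implicit_scalar[OF S w0 s\<Phi> \<Phi>0 d0_ne]) blast
  obtain A T where AT: "open A" "open T" "x0 \<in> A" "\<tau> x0 \<in> T" "A \<times> T \<subseteq> U2"
    by (rule open_prod_elim[OF U2]) (auto intro: that)
  obtain \<epsilon> where \<epsilon>: "\<epsilon> > 0" "ball x0 \<epsilon> \<subseteq> A" using AT open_contains_ball by blast
  let ?B0 = "ball x0 \<epsilon>"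
  define pt where "pt x t = x + \<sigma> (x, t) *\<^sub>R u" for x t
  have xt: "(x, t) \<in> U2" if "x \<in> ?B0" "t \<in> T" for x t using that AT \<epsilon> by blast
  have ptU: "pt x t \<in> U1" if "x \<in> ?B0" "t \<in> T" for x t
    using U2I xt[OF that] \<sigma>(2)[OF xt[OF that]] by (auto simp: S_def P_def pt_def)
  have \<tau>pt: "\<tau> (pt x t) = t" if "x \<in> ?B0" "t \<in> T" for x t
    using \<sigma>(3)[OF xt[OF that]] by (simp add: \<Phi>_def P_def pt_def)
  have rank: "dd w \<eta> x = 0" if "x \<in> U1" "dd w \<tau> x = 0" for x w
  proof -
    have xU: "x \<in> U" using that U1U by blast
    obtain r where r: "dd w \<eta> x = r *\<^sub>R dd u \<eta> x" using r1[OF xU] by blast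
    then have "r * dd u \<tau> x = 0" using that(2) dd\<tau>[OF xU] by simp
    then show ?thesis using r that(1) by (simp add: U1_def)
  qed
  have dpt: "((\<lambda>x. pt x t) has_derivative (\<lambda>w. w + dd (w, 0) \<sigma> (x, t) *\<^sub>R u)) (at x)"
    if "x \<in> ?B0" "t \<in> T" for x t
  proof -
    have "((\<lambda>x. (x, t)) has_derivative (\<lambda>w. (w, 0))) (at x)"
      by (intro has_derivative_Pair has_derivative_ident has_derivative_const)
    note c = has_derivative_compose[OF this smooth_on_has_derivative[OF \<sigma>(1) xt[OF that]]]
    show ?thesis unfolding pt_def
      by (rule has_derivative_add[OF has_derivative_ident has_derivative_scaleR_left[OF c]])
  qed
  have const: "\<eta> (pt x t) = \<eta> (pt x0 t)" if x: "x \<in> ?B0" and t: "t \<in> T" for x t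
  proof -
    have "((\<lambda>x. \<eta> (pt x t)) has_derivative (\<lambda>h. 0)) (at y within ?B0)" if y: "y \<in> ?B0" for y
    proof -
      have yU: "pt y t \<in> U" using ptU[OF y t] U1U by blast
      note h = has_derivative_compose[OF dpt[OF y t] smooth_on_has_derivative[OF s\<eta> yU]]
      note h\<tau> = has_derivative_compose[OF dpt[OF y t] smooth_on_has_derivative[OF s\<tau> yU]]
      have "dd (w + dd (w, 0) \<sigma> (y, t) *\<^sub>R u) \<tau> (pt y t) = 0" for w
        using dd_eq[OF h\<tau>, of w] dd_cong_open[OF open_ball y, of "\<lambda>x. \<tau> (pt x t)" "\<lambda>_. t" w] \<tau>pt t by simp
      then have "dd (w + dd (w, 0) \<sigma> (y, t) *\<^sub>R u) \<eta> (pt y t) = 0" for w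
        by (rule rank[OF ptU[OF y t]])
      then show ?thesis using has_derivative_at_withinI[OF h] by simp
    qed
    then obtain a where "\<And>y. y \<in> ?B0 \<Longrightarrow> \<eta> (pt y t) = a"
      using has_derivative_zero_constant[OF convex_ball] by blast
    then show ?thesis using x \<epsilon>(1) by simp
  qed
  define c where "c t = \<eta> (pt x0 t)" for t
  have x0B0: "x0 \<in> ?B0" using \<epsilon> by simp
  have bl0: "(\<lambda>t. (x0, t)) ` T \<subseteq> U2" using xt[OF x0B0] by blast
  have s\<sigma>0: "smooth_on (\<lambda>t. \<sigma> (x0, t)) T"
    by (rule smooth_on_compose[OF \<sigma>(1) AT(2) U2(1) bl0]) (intro smooth_on_Pair smooth_on_const smooth_on_id AT)
  have spt: "smooth_on (\<lambda>t. pt x0 t) T" unfolding pt_def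
    by (intro smooth_on_add smooth_on_const smooth_on_scaleR s\<sigma>0 AT)
  have sc: "smooth_on c T" unfolding c_def
    by (rule smooth_on_compose[OF s\<eta>1 AT(2) U1 _ spt]) (use ptU[OF x0B0] in blast)
  have "null_curve T c"
  proof
    fix t assume t: "t \<in> T"
    have pU: "pt x0 t \<in> U" and pU1: "pt x0 t \<in> U1" using ptU[OF x0B0 t] U1U by auto
    then have pW: "pt x0 t \<in> W" using U by blast
    show "lor (c t) (c t) = 0" using \<eta>_null[OF pW] by (simp add: c_def)
    let ?s = "dd 1 (\<lambda>t. \<sigma> (x0, t)) t"
    have "((\<lambda>t. pt x0 t) has_derivative (\<lambda>r. dd r (\<lambda>t. \<sigma> (x0, t)) t *\<^sub>R u)) (at t)"
      unfolding pt_def using has_derivative_add[OF has_derivative_const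
          has_derivative_scaleR_left[OF smooth_on_has_derivative[OF s\<sigma>0 t]]] by simp
    note h = has_derivative_compose[OF this smooth_on_has_derivative[OF s\<eta> pU]]
      and h\<tau> = has_derivative_compose[OF this smooth_on_has_derivative[OF s\<tau> pU]]
    have "dd 1 (\<lambda>t. \<tau> (pt x0 t)) t = dd 1 (\<lambda>t. t) t"
      by (rule dd_cong_open[OF AT(2) t]) (rule \<tau>pt[OF x0B0])
    then have "dd (?s *\<^sub>R u) \<tau> (pt x0 t) = 1"
      using dd_eq[OF h\<tau>, of 1] dd_eq[OF has_derivative_ident, of 1 t] by simp
    then have s0: "?s \<noteq> 0"
      using linear_0[OF dd_linear_dir[OF smooth_on_differentiable[OF s\<tau> pU]]] by auto
    have c1: "dd 1 c t = ?s *\<^sub>R dd u \<eta> (pt x0 t)"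
      using dd_eq[OF h, of 1] linear_scale[OF dd_linear_dir[OF smooth_on_differentiable[OF s\<eta> pU]]]
      by (simp add: c_def[abs_def])
    interpret K: kaehler_sff_codazzi "N (pt x0 t)" "F (pt x0 t)" "G (pt x0 t)" "J (pt x0 t)" "al (pt x0 t)" "\<eta> (pt x0 t)"
      "\<lambda>v. dd v \<eta> (pt x0 t)" by (rule codazzi_at[OF pW])
    show "lor (dd 1 c t) (dd 1 c t) > 0"
    proof -
      have "?s * ?s > 0" using s0 by (metis not_real_square_gt_zero)
      from mult_pos_pos[OF this K.\<omega>_pos[OF ne[OF pU]]] show ?thesis by (simp add: c1 lor_simps mult.assoc)
    qed
  qed (rule AT(2), rule sc)
  define B where "B = (?B0 \<inter> U1) \<inter> \<tau> -` T"
  have B: "open B" unfolding B_def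
    by (rule continuous_open_preimage[OF continuous_on_subset[OF smooth_on_continuous[OF s\<tau>]] _ AT(2)]) (use U1 U1U in auto)
  have BU: "B \<subseteq> U" using U1U by (auto simp: B_def)
  have "\<eta> x = c (\<tau> x)" if "x \<in> B" for x
  proof -
    have x: "x \<in> ?B0" "\<tau> x \<in> T" using that by (auto simp: B_def)
    \<comment> \<open>\<open>s = 0\<close> solves the equation for the parameter
      \<open>\<tau> x\<close>, so uniqueness identifies \<open>pt x (\<tau> x)\<close> with
      \<open>x\<close>.\<close>
    have "0 = \<sigma> (x, \<tau> x)" by (rule \<sigma>(4)[OF xt[OF x] I(2)]) (simp add: \<Phi>_def P_def)
    then have "pt x (\<tau> x) = x" by (simp add: pt_def)
    then show ?thesis using const[OF x] by (simp add: c_def)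
  qed
  moreover have "x0 \<in> B" using x0B0 x0U1 AT by (simp add: B_def)
  moreover have "\<tau> x \<in> T" "dd u \<tau> x \<noteq> 0" if "x \<in> B" for x using that by (auto simp: B_def U1_def)
  ultimately show ?thesis
    using that[OF \<open>null_curve T c\<close> B BU _ smooth_on_subset[OF s\<tau> BU]] by blast
qed

text \<open>Along \<open>\<eta> = c \<circ> \<tau>\<close>, the map \<open>F\<close> takes values in the spheres cut out of the light cone by
  \<open>lor y c = -1\<close>, \<open>lor y c' = 0\<close> and \<open>lor y c'' = 0\<close>.\<close>

lemma curve_relations:
  assumes nc: "null_curve T c" and B: "open B" "B \<subseteq> W" and \<tau>: "smooth_on \<tau> B" "\<And>x. x \<in> B \<Longrightarrow> \<tau> x \<in> T"
    and \<eta>c: "\<And>x. x \<in> B \<Longrightarrow> \<eta> x = c (\<tau> x)" and u: "\<And>x. x \<in> B \<Longrightarrow> dd u \<tau> x \<noteq> 0"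
    and sec: "\<And>x. x \<in> B \<Longrightarrow> \<exists>v. lor (dd u (dd v F) x) (dd u \<eta> x) \<noteq> 0"
    and x: "x \<in> B"
  shows "lor (F x) (c (\<tau> x)) = -1" "lor (F x) (dd 1 c (\<tau> x)) = 0" "lor (F x) (dd 1 (dd 1 c) (\<tau> x)) = 0"
    "lor (dd v F x) (c (\<tau> x)) = 0" "lor (dd v F x) (dd 1 c (\<tau> x)) = 0"
    "lor (F x) (dd 1 (dd 1 (dd 1 c)) (\<tau> x)) \<noteq> 0"
proof -
  interpret null_curve T c by (rule nc)
  have xW: "x \<in> W" if "x \<in> B" for x using B that by blast
  have d\<tau>: "\<tau> differentiable (at x)" if "x \<in> B" for x by (rule smooth_on_differentiable[OF \<tau>(1) that])
  have comp: "dd v (\<lambda>x. q (\<tau> x)) x = dd v \<tau> x *\<^sub>R dd 1 q (\<tau> x)" "(\<lambda>x. q (\<tau> x)) differentiable (at x)"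
    if "q differentiable (at (\<tau> x))" "x \<in> B" for q :: "real \<Rightarrow> 'm lspace" and v x
  proof -
    have "dd v (\<lambda>x. q (\<tau> x)) x = dd (dd v \<tau> x) q (\<tau> x)" by (rule dd_compose[OF d\<tau>[OF that(2)] that(1)])
    then show "dd v (\<lambda>x. q (\<tau> x)) x = dd v \<tau> x *\<^sub>R dd 1 q (\<tau> x)"
      using linear_scale[OF dd_linear_dir[OF that(1)], of "dd v \<tau> x" 1] by simp
    show "(\<lambda>x. q (\<tau> x)) differentiable (at x)"
      using differentiable_chain_at[OF d\<tau>[OF that(2)] that(1)] by (simp add: o_def)
  qed
  have d\<eta>: "dd v \<eta> x = dd v \<tau> x *\<^sub>R c1 (\<tau> x)" if "x \<in> B" for x v
    using dd_cong_open[OF B(1) that, of \<eta> "\<lambda>x. c (\<tau> x)" v] \<eta>c comp(1)[OF diff_c(1)[OF \<tau>(2)[OF that]] that] by simp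
  have 1: "lor (F x) (c (\<tau> x)) = -1" if "x \<in> B" for x
    using \<eta>_F[OF xW[OF that]] \<eta>c[OF that] by (simp add: lor_sym)
  show "lor (F x) (c (\<tau> x)) = -1" by (rule 1[OF x])
  have 2: "lor (F x) (c1 (\<tau> x)) = 0" if "x \<in> B" for x
    using d\<eta>_F[OF xW[OF that], of u] u[OF that] by (simp add: d\<eta>[OF that] lor_simps lor_sym)
  show "lor (F x) (c1 (\<tau> x)) = 0" by (rule 2[OF x])
  show "lor (dd v F x) (c (\<tau> x)) = 0" using \<eta>_dF[OF xW[OF x], of v] \<eta>c[OF x] by (simp add: lor_sym)
  have 3: "lor (dd v F x) (c1 (\<tau> x)) = 0" if "x \<in> B" for x v
    using d\<eta>_N[OF xW[OF that], of u] u[OF that] by (simp add: N_def d\<eta>[OF that] lor_simps lor_sym)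
  show "lor (dd v F x) (c1 (\<tau> x)) = 0" by (rule 3[OF x])
  have deriv0: "lor (p x) (dd v \<tau> x *\<^sub>R dd 1 q (\<tau> x)) + lor (dd v p x) (q (\<tau> x)) = 0"
    if "x \<in> B" "p differentiable (at x)" "q differentiable (at (\<tau> x))" "\<And>y. y \<in> B \<Longrightarrow> lor (p y) (q (\<tau> y)) = 0"
    for p :: "real^'d \<Rightarrow> 'm lspace" and q :: "real \<Rightarrow> 'm lspace" and x v
    using dd_bilinear[OF lor_bilinear that(2) comp(2)[OF that(3,1)], of v] comp(1)[OF that(3,1), of v]
      dd_cong_open[OF B(1) that(1), of "\<lambda>y. lor (p y) (q (\<tau> y))" "\<lambda>_. 0" v] that(4) by simp
  have 4: "lor (F x) (c2 (\<tau> x)) = 0" if "x \<in> B" for x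
    using deriv0[OF that diff_F[OF xW[OF that]] diff_c(2)[OF \<tau>(2)[OF that]] 2, of u] u[OF that] 3[OF that]
    by (simp add: lor_simps)
  show "lor (F x) (c2 (\<tau> x)) = 0" by (rule 4[OF x])
  \<comment> \<open>The second-order hypothesis passes along the chain: with \<open>3\<close> it
    makes \<open>lor (dd v F x) (c2 (\<tau> x))\<close> nonzero, and with \<open>4\<close> the
    pairing of \<open>F x\<close> with \<open>c3\<close>.\<close>
  obtain v where v: "lor (dd u (dd v F) x) (dd u \<eta> x) \<noteq> 0" using sec[OF x] by blast
  have "lor (dd v F x) (c2 (\<tau> x)) \<noteq> 0"
    using deriv0[OF x smooth_on_differentiable[OF smooth_on_dd[OF smooth_F] xW[OF x]] diff_c(2)[OF \<tau>(2)[OF x]] 3, of v u] v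
    by (auto simp: d\<eta>[OF x] lor_simps)
  then show "lor (F x) (c3 (\<tau> x)) \<noteq> 0"
    using deriv0[OF x diff_F[OF xW[OF x]] diff_c(3)[OF \<tau>(2)[OF x]] 4, of v] by (auto simp: lor_simps)
qed

text \<open>The frame moves only along \<open>c1\<close>, to which \<open>F\<close> is orthogonal,
  so the frame coordinates \<open>gh\<close> of \<open>F\<close> can be differentiated as if the
  frame were constant, and \<open>parseval\<close> makes \<open>gh\<close> isometric. Conversely
  \<open>H z = Y z (\<theta> z)\<close>, where \<open>t = \<theta> z\<close> solves
  \<open>lor (Y z t) (c2 t) = 0\<close>; by \<open>dd_Y_t\<close> this equation also makes the
  derivative of \<open>Y\<close> in \<open>t\<close> vanish, so \<open>H\<close> is isometric as
  well.\<close>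

theorem hypersurface_case:
  assumes dims_h: "CARD('m) = CARD('h::finite) + 1"
    and U: "open U" "U \<noteq> {}" "U \<subseteq> W" and ne: "\<And>x. x \<in> U \<Longrightarrow> dd u \<eta> x \<noteq> 0"
    and r1: "\<And>x w. x \<in> U \<Longrightarrow> \<exists>r. dd w \<eta> x = r *\<^sub>R dd u \<eta> x"
    and sec: "\<And>x. x \<in> U \<Longrightarrow> \<exists>v. lor (dd u (dd v F) x) (dd u \<eta> x) \<noteq> 0"
  obtains B V and gh :: "real^'d \<Rightarrow> real^'h::finite" and H :: "real^'h \<Rightarrow> 'm lspace"
  where "open B" "B \<noteq> {}" "B \<subseteq> U" "smooth_on gh B"
    "\<And>x v w. x \<in> B \<Longrightarrow> dd v gh x \<bullet> dd w gh x = v \<bullet> (g x *v w)"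
    "open V" "gh ` B \<subseteq> V" "smooth_on H V" "\<And>z. z \<in> V \<Longrightarrow> lor (H z) (H z) = 0"
    "\<And>z a b. z \<in> V \<Longrightarrow> lor (dd a H z) (dd b H z) = a \<bullet> b" "\<And>x. x \<in> B \<Longrightarrow> H (gh x) = F x"
proof -
  obtain T0 c B0 \<tau> x0 where nc0: "null_curve T0 c" and B0: "open B0" "B0 \<subseteq> U" "x0 \<in> B0" and s\<tau>0: "smooth_on \<tau> B0"
    and \<tau>0: "\<And>x. x \<in> B0 \<Longrightarrow> \<tau> x \<in> T0" "\<And>x. x \<in> B0 \<Longrightarrow> \<eta> x = c (\<tau> x)" "\<And>x. x \<in> B0 \<Longrightarrow> dd u \<tau> x \<noteq> 0"
    by (rule factor_through_curve[OF U, of u], erule ne, erule r1, rule that) assumption+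
  have B0W: "B0 \<subseteq> W" using B0 U by blast
  have sec0: "\<exists>v. lor (dd u (dd v F) x) (dd u \<eta> x) \<noteq> 0" if "x \<in> B0" for x using sec that B0 by blast
  have rel0: "lor (F x) (c (\<tau> x)) = -1" "lor (F x) (dd 1 c (\<tau> x)) = 0" "lor (F x) (dd 1 (dd 1 c) (\<tau> x)) = 0"
    "lor (dd v F x) (c (\<tau> x)) = 0" "lor (dd v F x) (dd 1 c (\<tau> x)) = 0"
    "lor (F x) (dd 1 (dd 1 (dd 1 c)) (\<tau> x)) \<noteq> 0" if "x \<in> B0" for x v
    by (rule curve_relations[OF nc0 B0(1) B0W s\<tau>0 \<tau>0 sec0 that]; assumption)+
  have x0W: "x0 \<in> W" using B0 B0W by blast
  obtain \<delta> \<zeta> and E :: "'h \<Rightarrow> real \<Rightarrow> 'm lspace" where \<delta>: "\<delta> > 0" and T: "{\<tau> x0<..<\<tau> x0 + \<delta>} \<subseteq> T0"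
    and fr: "framed_null_curve {\<tau> x0<..<\<tau> x0 + \<delta>} c \<zeta> E"
    by (rule null_curve.exists_frame[OF nc0 \<tau>0(1)[OF B0(3)] F_null[OF x0W] rel0(1,2)[OF B0(3)] dims_h])
  define T where "T = {\<tau> x0<..<\<tau> x0 + \<delta>}"
  interpret framed_null_curve T c \<zeta> E unfolding T_def by (rule fr)
  define B1 where "B1 = B0 \<inter> \<tau> -` T"
  have B1: "open B1" unfolding B1_def
    by (rule continuous_open_preimage[OF smooth_on_continuous[OF s\<tau>0] B0(1)]) (simp add: T_def)
  have B1B0: "B1 \<subseteq> B0" and B1W: "B1 \<subseteq> W" using B0W by (auto simp: B1_def)
  have s\<tau>: "smooth_on \<tau> B1" by (rule smooth_on_subset[OF s\<tau>0 B1B0])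
  have \<tau>T: "\<tau> x \<in> T" if "x \<in> B1" for x using that by (simp add: B1_def)
  have rel: "lor (F x) (c (\<tau> x)) = -1" "lor (F x) (c1 (\<tau> x)) = 0" "lor (F x) (c2 (\<tau> x)) = 0"
    "lor (dd v F x) (c (\<tau> x)) = 0" "lor (dd v F x) (c1 (\<tau> x)) = 0" "lor (F x) (c3 (\<tau> x)) \<noteq> 0" if "x \<in> B1" for x v
    using rel0 that B1B0 by blast+
  \<comment> \<open>\<open>x0\<close> itself lies outside \<open>B1\<close>, as the interval of the
    frame excludes \<open>\<tau> x0\<close>; the implicit function is centred at \<open>x1\<close>
    instead.\<close>
  obtain x1 where x1: "x1 \<in> B1"
    using value_above[OF B0(1,3) s\<tau>0 \<tau>0(3)[OF B0(3)] \<delta>] by (auto simp: B1_def T_def)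
  define gh :: "real^'d \<Rightarrow> real^'h" where "gh x = (\<chi> i. lor (F x) (E i (\<tau> x)))" for x
  have sE\<tau>: "smooth_on (\<lambda>x. E i (\<tau> x)) B1" for i
    by (rule smooth_on_compose[OF smooth_E B1 _ _ s\<tau>]) (use \<tau>T in \<open>auto simp: T_def\<close>)
  have sgi: "smooth_on (\<lambda>x. lor (F x) (E i (\<tau> x))) B1" for i
    by (intro smooth_on_bilinear[OF lor_bilinear] smooth_on_subset[OF smooth_F B1W] sE\<tau> B1)
  have sg: "smooth_on gh B1" unfolding gh_def by (intro smooth_on_vec sgi B1)
  have dg: "dd v gh x $ i = lor (dd v F x) (E i (\<tau> x))" if x: "x \<in> B1" for v x i
  proof -
    have xW: "x \<in> W" using x B1W by blast
    have 1: "dd v gh x $ i = dd v (\<lambda>x. lor (F x) (E i (\<tau> x))) x"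
      using dd_linear[OF bounded_linear_vec_nth smooth_on_differentiable[OF sg x], of v i] by (simp add: gh_def)
    have dE: "E i differentiable (at (\<tau> x))" by (rule smooth_on_differentiable[OF smooth_E \<tau>T[OF x]])
    have "dd v (\<lambda>x. E i (\<tau> x)) x = dd (dd v \<tau> x) (E i) (\<tau> x)"
      by (rule dd_compose[OF smooth_on_differentiable[OF s\<tau> x] dE])
    also have "\<dots> = dd v \<tau> x *\<^sub>R transport (\<tau> x) (E i (\<tau> x))"
      using linear_scale[OF dd_linear_dir[OF dE], of "dd v \<tau> x" 1] by (simp add: deriv_E[OF \<tau>T[OF x]])
    finally have "lor (F x) (dd v (\<lambda>x. E i (\<tau> x)) x) = 0" by (simp add: transport_def lor_simps rel(2)[OF x])
    then show ?thesis
      using 1 dd_bilinear[OF lor_bilinear diff_F[OF xW] smooth_on_differentiable[OF sE\<tau> x], of v] by simp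
  qed
  have iso: "dd v gh x \<bullet> dd w gh x = v \<bullet> (g x *v w)" if x: "x \<in> B1" for x v w
  proof -
    have xW: "x \<in> W" using x B1W by blast
    have "v \<bullet> (g x *v w) = lor (dd v F x) (dd w F x)" by (simp add: F_metric[OF xW])
    also have "\<dots> = (\<Sum>i\<in>UNIV. lor (dd v F x) (E i (\<tau> x)) * lor (dd w F x) (E i (\<tau> x)))"
      by (rule parseval[OF \<tau>T[OF x] rel(4,5)[OF x] rel(4)[OF x]])
    finally show ?thesis by (simp add: inner_vec_def dg[OF x])
  qed
  have FY: "F x = Y (gh x) (\<tau> x)" if x: "x \<in> B1" for x
    unfolding gh_def using Y_unique[OF \<tau>T[OF x] F_null rel(1,2)[OF x]] x B1W by blast
  define \<Phi> where "\<Phi> w = lor (Y (fst w) (snd w)) (c2 (snd w))" for w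
  let ?S = "UNIV \<times> T :: ((real^'h) \<times> real) set"
  have oS: "open ?S" by (intro open_Times open_UNIV T)
  have sc2: "smooth_on (\<lambda>w. c2 (snd w)) ?S"
    by (rule smooth_on_compose[OF smooth_c123(2) oS T _ smooth_on_linear[OF bounded_linear_snd]]) auto
  have s\<Phi>: "smooth_on \<Phi> ?S" unfolding \<Phi>_def[abs_def]
    by (rule smooth_on_bilinear[OF lor_bilinear oS smooth_Y sc2])
  have dpair: "((\<lambda>t. (z, t)) has_derivative (\<lambda>r. (0, r))) (at t)" for z :: "real^'h" and t
    by (intro has_derivative_Pair has_derivative_ident has_derivative_const)
  have Yd: "Y z differentiable (at t)" if "t \<in> T" for z t
  proof -
    have "(\<lambda>t. Y (fst (z, t)) (snd (z, t))) differentiable (at t)"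
      using has_derivative_compose[OF dpair smooth_on_has_derivative[OF smooth_Y, of "(z, t)"]] that
      unfolding differentiable_def by auto
    then show ?thesis by simp
  qed
  \<comment> \<open>At a zero of \<open>\<Phi>\<close> the motion of \<open>Y\<close> drops out and
    only the pairing with \<open>c3\<close> remains, which \<open>curve_relations\<close> shows to
    be nonzero at \<open>x1\<close>.\<close>
  have d\<Phi>: "dd (0, 1) \<Phi> (z, t) = lor (Y z t) (c3 t)" if t: "t \<in> T" and 0: "\<Phi> (z, t) = 0" for z t
  proof -
    have "((\<lambda>t. \<Phi> (z, t)) has_derivative (\<lambda>r. dd (0, r) \<Phi> (z, t))) (at t)"
      using has_derivative_compose[OF dpair smooth_on_has_derivative[OF s\<Phi>, of "(z, t)"]] t by simp
    then have "dd (0, 1) \<Phi> (z, t) = dd 1 (\<lambda>t. \<Phi> (z, t)) t" by (simp add: dd_eq)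
    also have "\<dots> = lor (Y z t) (c3 t) + lor (dd 1 (Y z) t) (c2 t)"
      using dd_bilinear[OF lor_bilinear Yd[OF t] diff_c(3)[OF t], of 1 z] by (simp add: \<Phi>_def)
    also have "\<dots> = lor (Y z t) (c3 t)" using 0 by (simp add: dd_Y_t[OF t] \<Phi>_def lor_simps)
    finally show ?thesis .
  qed
  have \<Phi>x: "\<Phi> (gh x, \<tau> x) = 0" if "x \<in> B1" for x using rel(3)[OF that] FY[OF that] by (simp add: \<Phi>_def)
  have in_S: "(gh x, \<tau> x) \<in> ?S" if "x \<in> B1" for x using \<tau>T[OF that] by simp
  have "dd (0, 1) \<Phi> (gh x1, \<tau> x1) \<noteq> 0"
    using d\<Phi>[OF \<tau>T[OF x1] \<Phi>x[OF x1]] rel(6)[OF x1] FY[OF x1] by simp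
  then obtain V I \<theta> where V: "open V" "gh x1 \<in> V" and I: "open I" "\<tau> x1 \<in> I" and VI: "V \<times> I \<subseteq> ?S"
    and \<theta>: "smooth_on \<theta> V" "\<And>z. z \<in> V \<Longrightarrow> \<theta> z \<in> I" "\<And>z. z \<in> V \<Longrightarrow> \<Phi> (z, \<theta> z) = 0"
      "\<And>z s. z \<in> V \<Longrightarrow> s \<in> I \<Longrightarrow> \<Phi> (z, s) = 0 \<Longrightarrow> s = \<theta> z"
    by (rule implicit_scalar[OF oS in_S[OF x1] s\<Phi> \<Phi>x[OF x1]]) blast
  have \<theta>T: "\<theta> z \<in> T" if "z \<in> V" for z using VI \<theta>(2)[OF that] that by blast
  define H where "H z = Y z (\<theta> z)" for z
  have sub: "(\<lambda>z. (z, \<theta> z)) ` V \<subseteq> ?S" using \<theta>T by auto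
  have szt: "smooth_on (\<lambda>z. (z, \<theta> z)) V" by (intro smooth_on_Pair smooth_on_id \<theta> V)
  have sH: "smooth_on H V"
    using smooth_on_compose[OF smooth_Y V(1) oS sub szt] by (simp add: H_def[abs_def])
  have dH: "dd a H z = (\<Sum>i\<in>UNIV. a $ i *\<^sub>R E i (\<theta> z)) + (z \<bullet> a) *\<^sub>R c (\<theta> z)" if z: "z \<in> V" for a z
  proof -
    let ?Y = "\<lambda>w. Y (fst w) (snd w)"
    have zS: "(z, \<theta> z) \<in> ?S" using \<theta>T[OF z] by simp
    have h1: "((\<lambda>z. (z, \<theta> z)) has_derivative (\<lambda>a. (a, dd a \<theta> z))) (at z)"
      by (intro has_derivative_Pair has_derivative_ident smooth_on_has_derivative[OF \<theta>(1) z])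
    have l: "linear (\<lambda>v. dd v ?Y (z, \<theta> z))" by (rule dd_linear_dir[OF smooth_on_differentiable[OF smooth_Y zS]])
    have "dd a H z = dd (a, dd a \<theta> z) ?Y (z, \<theta> z)"
      using dd_eq[OF has_derivative_compose[OF h1 smooth_on_has_derivative[OF smooth_Y zS]]] by (simp add: H_def[abs_def])
    also have "\<dots> = dd (a, 0) ?Y (z, \<theta> z) + dd a \<theta> z *\<^sub>R dd (0, 1) ?Y (z, \<theta> z)"
      using linear_add[OF l, of "(a, 0)" "dd a \<theta> z *\<^sub>R (0, 1)"] linear_scale[OF l, of "dd a \<theta> z" "(0, 1)"] by simp
    also have "dd (0, 1) ?Y (z, \<theta> z) = dd 1 (Y z) (\<theta> z)"
      using dd_eq[OF has_derivative_compose[OF dpair smooth_on_has_derivative[OF smooth_Y zS]], of 1] by simp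
    also have "\<dots> = 0" using \<theta>(3)[OF z] by (simp add: dd_Y_t[OF \<theta>T[OF z]] \<Phi>_def)
    also have "dd (a, 0) ?Y (z, \<theta> z) = dd a (\<lambda>z. Y z (\<theta> z')) z" if "z' = z" for z'
    proof -
      have "((\<lambda>y. (y, \<theta> z)) has_derivative (\<lambda>a. (a, 0))) (at z)"
        by (intro has_derivative_Pair has_derivative_ident has_derivative_const)
      from dd_eq[OF has_derivative_compose[OF this smooth_on_has_derivative[OF smooth_Y zS]], of a] show ?thesis
        by (simp add: that)
    qed
    finally show ?thesis by (simp add: dd_Y_z)
  qed
  define B where "B = (B1 \<inter> gh -` V) \<inter> (B1 \<inter> \<tau> -` I)"
  have B: "open B" unfolding B_def
    by (intro open_Int continuous_open_preimage[OF smooth_on_continuous[OF sg] B1 V(1)]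
        continuous_open_preimage[OF smooth_on_continuous[OF s\<tau>] B1 I(1)])
  have BB1: "B \<subseteq> B1" by (auto simp: B_def)
  show ?thesis
  proof (rule that[OF B _ _ smooth_on_subset[OF sg BB1] iso V(1) _ sH])
    show "B \<noteq> {}" using x1 V(2) I(2) by (auto simp: B_def)
    show "B \<subseteq> U" using BB1 B1B0 B0 by blast
    show "x \<in> B1" if "x \<in> B" for x using that BB1 by blast
    show "gh ` B \<subseteq> V" by (auto simp: B_def)
    show "lor (H z) (H z) = 0" if "z \<in> V" for z unfolding H_def by (rule Y_pair(4)[OF \<theta>T[OF that]])
    show "lor (dd a H z) (dd b H z) = a \<bullet> b" if "z \<in> V" for z a b
    proof -
      have t: "\<theta> z \<in> T" by (rule \<theta>T[OF that])
      have sy: "lor (c (\<theta> z)) (E i (\<theta> z)) = 0" for i using E(2)[OF t] by (simp add: lor_sym)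
      show ?thesis
        by (simp add: dH[OF that] lor_simps lor.sum_left lor.sum_right E[OF t] sy c_null[OF t] inner_vec_def
            if_distrib sum.delta mult.commute cong: if_cong)
    qed
    show "H (gh x) = F x" if "x \<in> B" for x
    proof -
      have x: "x \<in> B1" "gh x \<in> V" "\<tau> x \<in> I" using that by (auto simp: B_def)
      have "\<tau> x = \<theta> (gh x)" by (rule \<theta>(4)[OF x(2,3) \<Phi>x[OF x(1)]])
      then show ?thesis using FY[OF x(1)] by (simp add: H_def)
    qed
  qed
qed

end

section \<open>The lift of a conformal immersion and the Moebius alternative\<close>

definition lift :: "('e \<Rightarrow> real^'m) \<Rightarrow> ('e \<Rightarrow> real) \<Rightarrow> 'e \<Rightarrow> 'm::finite lspace" where
  "lift f lam x = (1 / lam x) *\<^sub>R (f x, 1, f x \<bullet> f x / 2)"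

lemma lift_null: "lor (lift f lam x) (lift f lam x) = 0"
  by (simp add: lift_def lor_def)

lemma smooth_lift:
  fixes f :: "'e::euclidean_space \<Rightarrow> real^'m::finite"
  assumes "open S" "smooth_on f S" "smooth_on lam S" "\<And>x. x \<in> S \<Longrightarrow> lam x \<noteq> 0"
  shows "smooth_on (lift f lam) S"
  unfolding lift_def[abs_def]
  by (intro smooth_on_scaleR smooth_on_divide smooth_on_Pair smooth_on_inner smooth_on_const assms) auto

lemma dd_lift:
  fixes f :: "'e::euclidean_space \<Rightarrow> real^'m::finite"
  assumes S: "open S" "smooth_on f S" "smooth_on lam S" "\<And>x. x \<in> S \<Longrightarrow> lam x \<noteq> 0" and x: "x \<in> S"
  shows "dd v (lift f lam) x = dd v (\<lambda>x. 1 / lam x) x *\<^sub>R (f x, 1, f x \<bullet> f x / 2)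
     + (1 / lam x) *\<^sub>R (dd v f x, 0, f x \<bullet> dd v f x)"
proof -
  have f: "(f has_derivative (\<lambda>v. dd v f x)) (at x)" by (rule smooth_on_has_derivative[OF S(2) x])
  have l: "((\<lambda>x. 1 / lam x) has_derivative (\<lambda>v. dd v (\<lambda>x. 1 / lam x) x)) (at x)"
    by (rule smooth_on_has_derivative[OF smooth_on_divide[OF S(1) smooth_on_const S(3,4)] x])
  have i: "((\<lambda>x. f x \<bullet> f x / 2) has_derivative (\<lambda>v. (f x \<bullet> dd v f x + dd v f x \<bullet> f x) / 2)) (at x)"
    by (rule bounded_linear.has_derivative[OF bounded_linear_divide has_derivative_inner[OF f f]])
  show ?thesis
    unfolding lift_def[abs_def]
    using dd_eq[OF has_derivative_scaleR[OF l has_derivative_Pair[OF f has_derivative_Pair[OF has_derivative_const[of "1 :: real"] i]]], of v]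
    by (simp add: inner_commute add.commute)
qed

text \<open>The derivative of \<open>1 / lam\<close> multiplies the cone vector, which is null and
  orthogonal to all vectors \<open>(dd v f x, 0, f x \<bullet> dd v f x)\<close>; only the product
  of two of the latter survives.\<close>

lemma lift_metric:
  fixes f :: "'e::euclidean_space \<Rightarrow> real^'m::finite"
  assumes S: "open S" "smooth_on f S" "smooth_on lam S" "\<And>x. x \<in> S \<Longrightarrow> lam x \<noteq> 0" and x: "x \<in> S"
  shows "lor (dd v (lift f lam) x) (dd w (lift f lam) x) = (dd v f x \<bullet> dd w f x) / (lam x)\<^sup>2"
proof -
  have 1: "lor (f x, 1, f x \<bullet> f x / 2) (f x, 1, f x \<bullet> f x / 2) = 0"
    "lor (f x, 1, f x \<bullet> f x / 2) (dd w f x, 0, f x \<bullet> dd w f x) = 0"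
    "lor (dd v f x, 0, f x \<bullet> dd v f x) (f x, 1, f x \<bullet> f x / 2) = 0"
    "lor (dd v f x, 0, f x \<bullet> dd v f x) (dd w f x, 0, f x \<bullet> dd w f x) = dd v f x \<bullet> dd w f x"
    by (simp_all add: lor_def inner_commute)
  have d: "dd u (lift f lam) x = dd u (\<lambda>x. 1 / lam x) x *\<^sub>R (f x, 1, f x \<bullet> f x / 2)
     + (1 / lam x) *\<^sub>R (dd u f x, 0, f x \<bullet> dd u f x)" for u
    by (rule dd_lift[OF assms])
  show ?thesis
    unfolding d lor_simps 1 by (simp add: power2_eq_square)
qed

text \<open>The complement of a null vector modulo that vector is Euclidean; subtracting
  \<open>q / b\<close> times the null vector to clear the first null coordinate realises the
  isometry.\<close>

lemma lor_perp_projection: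
  assumes "lor (a, b, k) (a, b, k) = 0" "b \<noteq> 0" "lor (p, q, r) (a, b, k) = 0" "lor (p', q', r') (a, b, k) = 0"
  shows "lor (p, q, r) (p', q', r') = (p - (q / b) *\<^sub>R a) \<bullet> (p' - (q' / b) *\<^sub>R a)"
proof -
  have 1: "a \<bullet> a = 2 * b * k" "p \<bullet> a = q * k + r * b" "a \<bullet> p' = q' * k + r' * b"
    using assms by (simp_all add: lor_def inner_commute)
  show ?thesis
    using assms(2) by (simp add: lor_def inner_diff_left inner_diff_right 1 field_simps)
qed

text \<open>Homotheties are Moebius transformations.\<close>

lemma two_inversions:
  fixes x :: "'e::euclidean_space"
  assumes "k > 0"
  shows "(sphere_inversion 0 1 \<circ> (sphere_inversion 0 (sqrt k) \<circ> (\<lambda>y. y))) (Some x) = Some ((1 / k) *\<^sub>R x)"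
proof (cases "x = 0")
  case False
  then have n: "norm x \<noteq> 0" by simp
  have "(k / (norm x)\<^sup>2) *\<^sub>R x \<noteq> 0" using assms False by simp
  moreover have "(1 / (norm ((k / (norm x)\<^sup>2) *\<^sub>R x))\<^sup>2) * (k / (norm x)\<^sup>2) = 1 / k"
    using assms n by (simp add: power_mult_distrib power_divide power2_eq_square field_simps)
  ultimately show ?thesis using assms False by (simp add: sphere_inversion_def)
qed (simp add: sphere_inversion_def)

text \<open>\<open>lor \<eta> (lift f lam x) = -1\<close> determines \<open>lam\<close> as a
  polynomial in \<open>f\<close>. With \<open>\<eta> = (a, b, k)\<close> null, either
  \<open>b = 0\<close> and \<open>lam\<close> is the constant \<open>k\<close>, which calls for a
  homothety, or \<open>lam\<close> is \<open>b / 2\<close> times the squared distance of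
  \<open>f\<close> from \<open>y0 = a / b\<close>; its inverse is the conformal factor of the
  inversion centred at \<open>y0\<close> of radius \<open>sqrt (2 / b)\<close>.\<close>

lemma moebius_case:
  fixes f :: "'e::euclidean_space \<Rightarrow> real^'m::finite" and \<eta> :: "'m lspace"
  assumes S: "open S" "S \<noteq> {}" "smooth_on f S" "smooth_on lam S" "\<And>x. x \<in> S \<Longrightarrow> lam x > 0"
    and \<eta>: "lor \<eta> \<eta> = 0" "\<And>x. x \<in> S \<Longrightarrow> lor \<eta> (lift f lam x) = -1"
  obtains \<tau> h where "moebius \<tau>" "\<And>x. x \<in> S \<Longrightarrow> \<tau> (Some (f x)) = Some (h x)" "smooth_on h S"
    "\<And>x v w. x \<in> S \<Longrightarrow> dd v h x \<bullet> dd w h x = (dd v f x \<bullet> dd w f x) / (lam x)\<^sup>2"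
proof -
  obtain a b k where e: "\<eta> = (a, b, k)" by (cases \<eta>)
  have ak: "a \<bullet> a = 2 * b * k" using \<eta>(1) by (simp add: e lor_def)
  have lam: "lam x = b * (f x \<bullet> f x) / 2 - a \<bullet> f x + k" if "x \<in> S" for x
  proof -
    have "lor \<eta> (lift f lam x) = (1 / lam x) * (a \<bullet> f x - b * (f x \<bullet> f x / 2) - k)"
      unfolding lift_def lor.scaleR_right by (simp add: e lor_def)
    then have "a \<bullet> f x - b * (f x \<bullet> f x / 2) - k = - lam x"
      using \<eta>(2)[OF that] S(5)[OF that] by (auto simp: eq_divide_eq divide_eq_eq)
    then show ?thesis by simp
  qed
  have lam0: "lam x \<noteq> 0" if "x \<in> S" for x using S(5)[OF that] by simp
  show ?thesis
  proof (cases "b = 0")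
    case True
    then have a: "a = 0" using ak by simp
    have lk: "lam x = k" if "x \<in> S" for x using lam[OF that] True a by simp
    then have k: "k > 0" using S(2,5) by fastforce
    show ?thesis
    proof (rule that)
      show "moebius (sphere_inversion 0 1 \<circ> (sphere_inversion 0 (sqrt k) \<circ> (\<lambda>y :: (real^'m) option. y)))"
        using k by (intro moebius_inversion moebius_id) auto
      show "(sphere_inversion 0 1 \<circ> (sphere_inversion 0 (sqrt k) \<circ> (\<lambda>y. y))) (Some (f x)) = Some ((1 / k) *\<^sub>R f x)" for x
        by (rule two_inversions[OF k])
      show "smooth_on (\<lambda>x. (1 / k) *\<^sub>R f x) S" by (intro smooth_on_scaleR smooth_on_const S)
      show "dd v (\<lambda>x. (1 / k) *\<^sub>R f x) x \<bullet> dd w (\<lambda>x. (1 / k) *\<^sub>R f x) x = (dd v f x \<bullet> dd w f x) / (lam x)\<^sup>2" if "x \<in> S" for x v w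
        using dd_linear[OF bounded_linear_scaleR_right smooth_on_differentiable[OF S(3) that]] lk[OF that] k
        by (simp add: power2_eq_square)
    qed
  next
    case False
    define y0 where "y0 = (1 / b) *\<^sub>R a"
    have lam': "lam x = (b / 2) * ((f x - y0) \<bullet> (f x - y0))" if "x \<in> S" for x
    proof -
      have "(f x - y0) \<bullet> (f x - y0) = f x \<bullet> f x - (2 / b) * (a \<bullet> f x) + (1 / b) * (1 / b) * (a \<bullet> a)"
        by (simp add: y0_def inner_diff_left inner_diff_right inner_commute algebra_simps)
      then show ?thesis using False by (simp add: lam[OF that] ak field_simps)
    qed
    obtain x1 where x1: "x1 \<in> S" using S(2) by blast
    have b: "b > 0" using S(5)[OF x1] lam'[OF x1] inner_ge_zero[of "f x1 - y0"] by (smt (verit) mult_nonneg_nonneg mult_nonpos_nonneg divide_nonpos_pos)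
    have ne: "f x \<noteq> y0" if "x \<in> S" for x using S(5)[OF that] lam'[OF that] by auto
    define h where "h x = y0 + (1 / lam x) *\<^sub>R (f x - y0)" for x
    have sh: "smooth_on h S" unfolding h_def[abs_def]
      by (intro smooth_on_add smooth_on_const smooth_on_scaleR smooth_on_divide smooth_on_diff S lam0)
    show ?thesis
    proof (rule that[of "sphere_inversion y0 (sqrt (2 / b)) \<circ> (\<lambda>y. y)" h, OF _ _ sh])
      show "moebius (sphere_inversion y0 (sqrt (2 / b)) \<circ> (\<lambda>y. y))"
        using b by (intro moebius_inversion moebius_id) auto
      show "(sphere_inversion y0 (sqrt (2 / b)) \<circ> (\<lambda>y. y)) (Some (f x)) = Some (h x)" if "x \<in> S" for x
      proof -
        have "(2 / b) / (norm (f x - y0))\<^sup>2 = 1 / lam x"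
          using b by (simp add: lam'[OF that] power2_norm_eq_inner field_simps)
        then show ?thesis using ne[OF that] b by (simp add: sphere_inversion_def h_def)
      qed
      fix x v w assume x: "x \<in> S"
      let ?F = "lift f lam"
      \<comment> \<open>\<open>h\<close> is, up to the translation by \<open>y0\<close>, the
        projection of the lift along \<open>\<eta>\<close>, so \<open>lor_perp_projection\<close>
        compares the metrics without differentiating the inversion.\<close>
      let ?P = "\<lambda>X :: 'm lspace. fst X - fst (snd X) *\<^sub>R y0"
      have hF: "h y = y0 + ?P (?F y)" for y by (simp add: h_def lift_def algebra_simps)
      have blP: "bounded_linear ?P"
        by (rule linear_conv_bounded_linear[THEN iffD1], rule linearI) (simp_all add: algebra_simps)
      have sF: "smooth_on ?F S" by (rule smooth_lift[OF S(1,3,4) lam0])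
      have dF: "?F differentiable (at x)" by (rule smooth_on_differentiable[OF sF x])
      have dh: "dd v h x = ?P (dd v ?F x)" for v
      proof -
        have "dd v h x = dd v (\<lambda>y. y0) x + dd v (\<lambda>y. ?P (?F y)) x"
          unfolding hF[abs_def] by (rule dd_add) (use smooth_on_differentiable[OF smooth_on_linear_comp[OF blP S(1) sF] x] in auto)
        then show ?thesis using dd_linear[OF blP dF, of v] by simp
      qed
      have perp: "lor (dd v ?F x) (a, b, k) = 0" for v
      proof -
        have "dd v (\<lambda>y. lor (?F y) \<eta>) x = 0"
          using dd_cong_open[OF S(1) x, of "\<lambda>y. lor (?F y) \<eta>" "\<lambda>_. -1" v] \<eta>(2) by (simp add: lor_sym[of _ \<eta>])
        then show ?thesis using dd_linear[OF lor.bounded_linear_left dF, of v \<eta>] by (simp add: e)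
      qed
      obtain p q r where 1: "dd v ?F x = (p, q, r)" by (cases "dd v ?F x")
      obtain p' q' r' where 2: "dd w ?F x = (p', q', r')" by (cases "dd w ?F x")
      have "dd v h x \<bullet> dd w h x = lor (dd v ?F x) (dd w ?F x)"
        using lor_perp_projection[of a b k p q r p' q' r'] perp[of v] perp[of w] \<eta>(1) False
        by (simp add: dh 1 2 e y0_def)
      then show "dd v h x \<bullet> dd w h x = (dd v f x \<bullet> dd w f x) / (lam x)\<^sup>2"
        by (simp add: lift_metric[OF S(1,3,4) lam0 x])
    qed
  qed
qed

text \<open>In the parallel case \<open>\<eta>\<close> is constant on a ball and
  \<open>moebius_case\<close> applies. Otherwise \<open>hypersurface_case\<close> gives an isometry
  \<open>H\<close> into the cone; dividing by its first null coordinate \<open>q\<close> moves it to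
  the Euclidean section of the cone and produces a conformal map with factor
  \<open>1 / q\<close>.\<close>

theorem local_alternative:
  fixes W :: "(real^'d::finite) set" and g Jc :: "real^'d \<Rightarrow> real^'d^'d" and f :: "real^'d \<Rightarrow> real^'m::finite"
  assumes W: "open W" "W \<noteq> {}"
    and g: "smooth_on g W" "\<And>x. x \<in> W \<Longrightarrow> transpose (g x) = g x" "\<And>x v. x \<in> W \<Longrightarrow> v \<noteq> 0 \<Longrightarrow> v \<bullet> (g x *v v) > 0"
    and J: "smooth_on Jc W" "\<And>x. x \<in> W \<Longrightarrow> Jc x ** Jc x = - mat 1"
      "\<And>x. x \<in> W \<Longrightarrow> transpose (Jc x) ** g x ** Jc x = g x"
      "\<And>x k i j. x \<in> W \<Longrightarrow> covariant_deriv_endo g Jc k i j x = 0"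
    and f: "smooth_on f W" "smooth_on lam W" "\<And>x. x \<in> W \<Longrightarrow> lam x > 0"
      "\<And>x v w. x \<in> W \<Longrightarrow> dd v f x \<bullet> dd w f x = (lam x)\<^sup>2 * (v \<bullet> (g x *v w))"
    and dim_eqs: "CARD('m) = CARD('d) + 2" "CARD('d) \<ge> 10" "CARD('h::finite) = CARD('d) + 1"
    and nonflat: "\<And>x. x \<in> W \<Longrightarrow> \<exists>l i j k. curvature g l i j k x \<noteq> 0"
  obtains (congruent) B \<tau> and h :: "real^'d \<Rightarrow> real^'m" where "open B" "B \<noteq> {}" "B \<subseteq> W" "smooth_on h B"
      "\<And>x v w. x \<in> B \<Longrightarrow> dd v h x \<bullet> dd w h x = v \<bullet> (g x *v w)" "moebius \<tau>"
      "\<And>x. x \<in> B \<Longrightarrow> \<tau> (Some (f x)) = Some (h x)"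
  | (composition) B V lamh and gh :: "real^'d \<Rightarrow> real^'h::finite" and h :: "real^'h \<Rightarrow> real^'m"
    where "open B" "B \<noteq> {}" "B \<subseteq> W" "smooth_on gh B"
      "\<And>x v w. x \<in> B \<Longrightarrow> dd v gh x \<bullet> dd w gh x = v \<bullet> (g x *v w)"
      "open V" "gh ` B \<subseteq> V" "smooth_on h V" "smooth_on lamh V" "\<And>z. z \<in> V \<Longrightarrow> lamh z > 0"
      "\<And>z a b. z \<in> V \<Longrightarrow> dd a h z \<bullet> dd b h z = (lamh z)\<^sup>2 * (a \<bullet> b)" "\<And>x. x \<in> B \<Longrightarrow> h (gh x) = f x"
proof -
  let ?F = "lift f lam"
  have lam0: "lam x \<noteq> 0" if "x \<in> W" for x using f(3)[OF that] by simp
  interpret conformal_chart W g Jc ?F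
  proof (rule conformal_chart.intro)
    show "smooth_on ?F W" by (rule smooth_lift[OF W(1) f(1,2) lam0])
    show "lor (?F x) (?F x) = 0" for x by (rule lift_null)
    show "lor (dd v ?F x) (dd w ?F x) = v \<bullet> (g x *v w)" if "x \<in> W" for x v w
      using lift_metric[OF W(1) f(1,2) lam0 that] f(4)[OF that] lam0[OF that] by simp
  qed (use W g J dim_eqs nonflat in blast)+
  obtain W' \<eta> where W': "W' \<noteq> {}" "W' \<subseteq> W" and ccn: "conformal_chart_normal W' g Jc ?F \<eta>"
    by (rule exists_null_normal[OF assms(2)])
  interpret cn: conformal_chart_normal W' g Jc ?F \<eta> by (rule ccn)
  show ?thesis
  proof (rule cn.dichotomy[OF W'(1)])
    assume par: "\<And>x v. x \<in> W' \<Longrightarrow> dd v \<eta> x = 0"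
    obtain x1 where x1: "x1 \<in> W'" using W' by blast
    obtain \<epsilon> where \<epsilon>: "\<epsilon> > 0" "ball x1 \<epsilon> \<subseteq> W'" using cn.W x1 open_contains_ball by blast
    let ?B = "ball x1 \<epsilon>"
    have BW: "?B \<subseteq> W" using \<epsilon>(2) W'(2) by blast
    have "(\<eta> has_derivative (\<lambda>h. 0)) (at y within ?B)" if "y \<in> ?B" for y
      using has_derivative_at_withinI[OF smooth_on_has_derivative[OF cn.smooth_\<eta>, of y]] par that \<epsilon> by auto
    then obtain e where e: "\<And>y. y \<in> ?B \<Longrightarrow> \<eta> y = e"
      using has_derivative_zero_constant[OF convex_ball] by blast
    have e0: "lor e e = 0" using cn.\<eta>_null[OF x1] e[of x1] \<epsilon>(1) by simp
    have eF: "lor e (?F x) = -1" if "x \<in> ?B" for x using cn.\<eta>_F[of x] e[OF that] that \<epsilon>(2) by auto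
    have ne: "?B \<noteq> {}" using \<epsilon>(1) by simp
    obtain \<tau> h where m: "moebius \<tau>" "\<And>x. x \<in> ?B \<Longrightarrow> \<tau> (Some (f x)) = Some (h x)" "smooth_on h ?B"
      "\<And>x v w. x \<in> ?B \<Longrightarrow> dd v h x \<bullet> dd w h x = (dd v f x \<bullet> dd w f x) / (lam x)\<^sup>2"
      by (rule moebius_case[OF open_ball ne smooth_on_subset[OF f(1) BW] smooth_on_subset[OF f(2) BW] _ e0 eF])
        (use f(3) BW in blast)+
    show ?thesis
    proof (rule congruent[OF open_ball ne BW m(3) _ m(1,2)])
      show "dd v h x \<bullet> dd w h x = v \<bullet> (g x *v w)" if "x \<in> ?B" for x v w
        using m(4)[OF that] f(4)[of x] lam0[of x] BW that by auto
    qed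
  next
    fix U u assume U: "open U" "U \<noteq> {}" "U \<subseteq> W'" and u: "\<And>x. x \<in> U \<Longrightarrow> dd u \<eta> x \<noteq> 0"
      "\<And>x w. x \<in> U \<Longrightarrow> dd w \<eta> x = (lor (dd u \<eta> x) (dd w \<eta> x) / lor (dd u \<eta> x) (dd u \<eta> x)) *\<^sub>R dd u \<eta> x"
      "\<And>x. x \<in> U \<Longrightarrow> \<exists>v. lor (dd u (dd v ?F) x) (dd u \<eta> x) \<noteq> 0"
    have u2: "\<exists>r. dd w \<eta> x = r *\<^sub>R dd u \<eta> x" if "x \<in> U" for x w using u(2)[OF that] by blast
    have dims_h: "CARD('m) = CARD('h) + 1" using dim_eqs by simp
    obtain B V and gh :: "real^'d \<Rightarrow> real^'h" and H :: "real^'h \<Rightarrow> 'm lspace"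
      where B: "open B" "B \<noteq> {}" "B \<subseteq> U" and gh: "smooth_on gh B"
      "\<And>x v w. x \<in> B \<Longrightarrow> dd v gh x \<bullet> dd w gh x = v \<bullet> (g x *v w)"
      and V: "open V" "gh ` B \<subseteq> V" and H: "smooth_on H V" "\<And>z. z \<in> V \<Longrightarrow> lor (H z) (H z) = 0"
      "\<And>z a b. z \<in> V \<Longrightarrow> lor (dd a H z) (dd b H z) = a \<bullet> b" "\<And>x. x \<in> B \<Longrightarrow> H (gh x) = ?F x"
      by (rule cn.hypersurface_case[OF dims_h U, of u], erule u(1), erule u2, erule u(3), rule that) assumption+
    define q where "q z = fst (snd (H z))" for z
    \<comment> \<open>On the image of \<open>gh\<close> one has \<open>q = 1 / lam > 0\<close>, so
      the restriction loses no point of that image.\<close>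
    define V' where "V' = V \<inter> q -` {0<..}"
    have sq: "smooth_on q V" unfolding q_def[abs_def] by (intro smooth_on_fst smooth_on_snd H V)
    have V': "open V'" unfolding V'_def
      by (rule continuous_open_preimage[OF smooth_on_continuous[OF sq] V(1) open_greaterThan])
    have V'V: "V' \<subseteq> V" by (auto simp: V'_def)
    have qpos: "q z > 0" if "z \<in> V'" for z using that by (simp add: V'_def)
    define h where "h z = (1 / q z) *\<^sub>R fst (H z)" for z
    define lamh where "lamh z = 1 / q z" for z
    have sub: "smooth_on p V'" if "smooth_on p V" for p :: "real^'h \<Rightarrow> 'z::real_normed_vector"
      by (rule smooth_on_subset[OF that V'V])
    have slam: "smooth_on lamh V'" unfolding lamh_def[abs_def]
      by (intro smooth_on_divide smooth_on_const sub sq V') (use qpos in force)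
    have sh: "smooth_on h V'" unfolding h_def[abs_def]
      by (intro smooth_on_scaleR smooth_on_divide smooth_on_const smooth_on_subset[OF smooth_on_fst[OF V(1) H(1)] V'V] sub sq V')
        (use qpos in force)
    have lamh0: "lamh z \<noteq> 0" if "z \<in> V'" for z using qpos[OF that] by (simp add: lamh_def)
    have Hlift: "H z = lift h lamh z" if "z \<in> V'" for z
    proof -
      obtain p q0 r where e: "H z = (p, q0, r)" by (cases "H z")
      have q0: "q0 = q z" "q0 > 0" using qpos[OF that] by (simp_all add: q_def e)
      have "p \<bullet> p = 2 * q0 * r" using H(2)[of z] that V'V by (auto simp: e lor_def)
      then show ?thesis using q0 by (simp add: lift_def h_def lamh_def e field_simps)
    qed
    show ?thesis
    proof (rule composition[OF B(1,2) _ gh V' _ sh slam])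
      show "B \<subseteq> W" using B U W' by blast
      show "gh ` B \<subseteq> V'"
      proof
        fix z assume "z \<in> gh ` B"
        then obtain x where x: "x \<in> B" "z = gh x" by blast
        have "x \<in> W" using x B U W' by blast
        then have "q z > 0" using H(4)[OF x(1)] f(3)[of x] by (simp add: q_def x(2) lift_def)
        then show "z \<in> V'" using x V(2) by (auto simp: V'_def)
      qed
      show "lamh z > 0" if "z \<in> V'" for z using qpos[OF that] by (simp add: lamh_def)
      show "dd a h z \<bullet> dd b h z = (lamh z)\<^sup>2 * (a \<bullet> b)" if z: "z \<in> V'" for z a b
      proof -
        have "dd c H z = dd c (lift h lamh) z" for c by (rule dd_cong_open[OF V' z Hlift])
        then have "a \<bullet> b = (dd a h z \<bullet> dd b h z) / (lamh z)\<^sup>2"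
          using H(3)[of z a b] lift_metric[OF V' sh slam lamh0 z, of a b] z V'V by auto
        then show ?thesis using lamh0[OF z] by simp
      qed
      show "h (gh x) = f x" if x: "x \<in> B" for x
      proof -
        have "x \<in> W" using x B U W' by blast
        then show ?thesis using H(4)[OF x] f(3)[of x] by (simp add: h_def q_def lift_def)
      qed
    qed
  qed
qed

section \<open>From charts to the manifold\<close>

lemma jacobian_apply:
  fixes F :: "real^'a \<Rightarrow> real^'b"
  assumes "F differentiable (at x)"
  shows "jacobian F (at x) *v v = dd v F x"
proof -
  have "linear (frechet_derivative F (at x))" by (rule linear_frechet_derivative[OF assms])
  then show ?thesis
    unfolding jacobian_def dd_def by (simp add: matrix_works linear_matrix_vector_mul_eq)
qed

lemma inner_transpose_mult: "v \<bullet> ((transpose D ** M ** D) *v w) = (D *v v) \<bullet> (M *v (D *v w))"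
  for D :: "real^'n^'m" and M :: "real^'m^'m"
proof -
  have "(transpose D ** M ** D) *v w = transpose D *v (M *v (D *v w))"
    by (simp add: matrix_vector_mul_assoc matrix_mul_assoc)
  then show ?thesis using dot_lmul_matrix[of v "transpose D" "M *v (D *v w)"] by simp
qed

lemma inner_gram: "v \<bullet> ((transpose D ** D) *v w) = (D *v v) \<bullet> (D *v w)" for D :: "real^'n^'m"
  using inner_transpose_mult[of v D "mat 1" w] by simp

lemma matrix_eq_inner:
  fixes A B :: "real^'n^'m"
  assumes "\<And>v w. v \<bullet> (A *v w) = v \<bullet> (B *v w)" shows "A = B"
proof -
  have "A *v w = B *v w" for w using assms by (metis vector_eq_ldot)
  then show ?thesis by (simp add: matrix_eq)
qed

locale manifold_data =
  fixes A :: "('a::{t2_space, second_countable_topology}, 'd::finite) chart set"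
    and met J :: "('a, 'd) tensor2"
  assumes kaehler: "kaehler_manifold A met J"
begin

lemma chart:
  assumes "(U, \<phi>) \<in> A"
  shows "open U" "open (\<phi> ` U)" "homeomorphism U (\<phi> ` U) \<phi> (inv_into U \<phi>)" "U \<subseteq> carrier_of A"
  using kaehler assms unfolding kaehler_manifold_def smooth_atlas_def carrier_of_def by auto

lemma chart_inv:
  assumes "(U, \<phi>) \<in> A" "p \<in> U"
  shows "inv_into U \<phi> (\<phi> p) = p"
  using chart(3)[OF assms(1)] assms(2) by (simp add: homeomorphism_def)

lemma chart_image_open:
  assumes c: "(U, \<phi>) \<in> A" and N: "open N"
  shows "open (\<phi> ` (U \<inter> N))"
proof -
  have "\<phi> ` (U \<inter> N) = \<phi> ` U \<inter> inv_into U \<phi> -` N"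
    using chart_inv[OF c] by (auto simp: image_iff)
  moreover have "open (\<phi> ` U \<inter> inv_into U \<phi> -` N)"
    using chart(3)[OF c] by (intro continuous_open_preimage chart(2)[OF c] N) (simp add: homeomorphism_def)
  ultimately show ?thesis by simp
qed

lemma transition_smooth:
  assumes "(U, \<phi>) \<in> A" "(V, \<psi>) \<in> A"
  shows "smooth_on (\<psi> \<circ> inv_into U \<phi>) (\<phi> ` (U \<inter> V))"
  using kaehler assms unfolding kaehler_manifold_def smooth_atlas_def by fast

lemma metric_transform:
  assumes "(U, \<phi>) \<in> A" "(V, \<psi>) \<in> A" "p \<in> U \<inter> V"
  shows "met (U, \<phi>) (\<phi> p) = transpose (jacobian (\<psi> \<circ> inv_into U \<phi>) (at (\<phi> p))) ** met (V, \<psi>) (\<psi> p) **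
     jacobian (\<psi> \<circ> inv_into U \<phi>) (at (\<phi> p))"
  using kaehler assms unfolding kaehler_manifold_def riemannian_metric_def Let_def by fast

lemma metric:
  assumes "(U, \<phi>) \<in> A"
  shows "smooth_on (met (U, \<phi>)) (\<phi> ` U)" "\<And>x. x \<in> \<phi> ` U \<Longrightarrow> transpose (met (U, \<phi>) x) = met (U, \<phi>) x"
    "\<And>x v. x \<in> \<phi> ` U \<Longrightarrow> v \<noteq> 0 \<Longrightarrow> v \<bullet> (met (U, \<phi>) x *v v) > 0"
  using kaehler assms unfolding kaehler_manifold_def riemannian_metric_def by fast+

lemma complex_structure:
  assumes "(U, \<phi>) \<in> A"
  shows "smooth_on (J (U, \<phi>)) (\<phi> ` U)" "\<And>x. x \<in> \<phi> ` U \<Longrightarrow> J (U, \<phi>) x ** J (U, \<phi>) x = - mat 1"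
    "\<And>x. x \<in> \<phi> ` U \<Longrightarrow> transpose (J (U, \<phi>) x) ** met (U, \<phi>) x ** J (U, \<phi>) x = met (U, \<phi>) x"
    "\<And>x k i j. x \<in> \<phi> ` U \<Longrightarrow> covariant_deriv_endo (met (U, \<phi>)) (J (U, \<phi>)) k i j x = 0"
  using kaehler assms unfolding kaehler_manifold_def almost_complex_structure_def by fast+

text \<open>The definitions speak of all charts of the atlas, while \<open>h\<close> is isometric in
  one; the transition map and the transformation law of the metric carry the identity to every other
  chart. Injectivity of the derivative follows from positive definiteness.\<close>

lemma isometric_from_chart:
  fixes h :: "real^'d \<Rightarrow> real^'k::finite"
  assumes c: "(U, \<phi>) \<in> A" and O: "open O'" "O' \<subseteq> U"
    and h: "smooth_on h (\<phi> ` O')"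
      "\<And>x v w. x \<in> \<phi> ` O' \<Longrightarrow> dd v h x \<bullet> dd w h x = v \<bullet> (met (U, \<phi>) x *v w)"
  shows "conformal_immersion_with_factor A met O' (\<lambda>p. 1) (h \<circ> \<phi>)"
proof -
  have UO: "U \<inter> O' = O'" using O(2) by blast
  have oO: "open (\<phi> ` O')" using chart_image_open[OF c O(1)] by (simp add: UO)
  have main: "smooth_on ((h \<circ> \<phi>) \<circ> inv_into V \<rho>) (\<rho> ` (V \<inter> O')) \<and>
      (\<forall>p\<in>V \<inter> O'. inj (frechet_derivative ((h \<circ> \<phi>) \<circ> inv_into V \<rho>) (at (\<rho> p))) \<and>
        induced_metric (h \<circ> \<phi>) (V, \<rho>) (\<rho> p) = met (V, \<rho>) (\<rho> p))"
    if c': "(V, \<rho>) \<in> A" for V \<rho>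
  proof -
    define \<theta> where "\<theta> = \<phi> \<circ> inv_into V \<rho>"
    have oV: "open (\<rho> ` (V \<inter> O'))" by (rule chart_image_open[OF c' O(1)])
    have s\<theta>: "smooth_on \<theta> (\<rho> ` (V \<inter> O'))"
      unfolding \<theta>_def by (rule smooth_on_subset[OF transition_smooth[OF c' c]]) (use O(2) in blast)
    have \<theta>p: "\<theta> (\<rho> p) = \<phi> p" if "p \<in> V \<inter> O'" for p
      using chart_inv[OF c', of p] that by (simp add: \<theta>_def)
    have \<theta>im: "\<theta> ` (\<rho> ` (V \<inter> O')) \<subseteq> \<phi> ` O'" using \<theta>p by auto
    have fe: "(h \<circ> \<phi>) \<circ> inv_into V \<rho> = (\<lambda>x. h (\<theta> x))" by (auto simp: \<theta>_def)
    have sm: "smooth_on (\<lambda>x. h (\<theta> x)) (\<rho> ` (V \<inter> O'))"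
      by (rule smooth_on_compose[OF h(1) oV oO \<theta>im s\<theta>])
    have "inj (frechet_derivative ((h \<circ> \<phi>) \<circ> inv_into V \<rho>) (at (\<rho> p))) \<and>
        induced_metric (h \<circ> \<phi>) (V, \<rho>) (\<rho> p) = met (V, \<rho>) (\<rho> p)" if p: "p \<in> V \<inter> O'" for p
    proof -
      let ?x = "\<rho> p"
      have x: "?x \<in> \<rho> ` (V \<inter> O')" using p by blast
      have \<theta>x: "\<theta> ?x \<in> \<phi> ` O'" using \<theta>im x by blast
      have xV: "?x \<in> \<rho> ` V" using p by blast
      have d\<theta>: "\<theta> differentiable (at ?x)" by (rule smooth_on_differentiable[OF s\<theta> x])
      have dh: "h differentiable (at (\<theta> ?x))" by (rule smooth_on_differentiable[OF h(1) \<theta>x])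
      have dc: "(\<lambda>x. h (\<theta> x)) differentiable (at ?x)" by (rule smooth_on_differentiable[OF sm x])
      let ?D = "jacobian \<theta> (at ?x)" and ?E = "jacobian (\<lambda>x. h (\<theta> x)) (at ?x)"
      have iso: "dd v (\<lambda>x. h (\<theta> x)) ?x \<bullet> dd w (\<lambda>x. h (\<theta> x)) ?x = v \<bullet> (met (V, \<rho>) ?x *v w)" for v w
      proof -
        have "dd v (\<lambda>x. h (\<theta> x)) ?x \<bullet> dd w (\<lambda>x. h (\<theta> x)) ?x = dd v \<theta> ?x \<bullet> (met (U, \<phi>) (\<theta> ?x) *v dd w \<theta> ?x)"
          by (simp add: dd_compose[OF d\<theta> dh] h(2)[OF \<theta>x])
        also have "\<dots> = v \<bullet> ((transpose ?D ** met (U, \<phi>) (\<phi> p) ** ?D) *v w)"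
          by (simp add: inner_transpose_mult jacobian_apply[OF d\<theta>] \<theta>p[OF p])
        also have "transpose ?D ** met (U, \<phi>) (\<phi> p) ** ?D = met (V, \<rho>) ?x"
          unfolding \<theta>_def by (rule metric_transform[OF c' c, symmetric]) (use p O(2) in blast)
        finally show ?thesis .
      qed
      have "transpose ?E ** ?E = met (V, \<rho>) ?x"
        by (rule matrix_eq_inner) (simp add: inner_gram jacobian_apply[OF dc] iso)
      then have "induced_metric (h \<circ> \<phi>) (V, \<rho>) ?x = met (V, \<rho>) ?x"
        by (simp add: induced_metric_def Let_def fe)
      moreover have "inj (frechet_derivative (\<lambda>x. h (\<theta> x)) (at ?x))"
      proof (rule linear_injective_0[OF linear_frechet_derivative[OF dc], THEN iffD2], intro allI impI)
        fix v assume "frechet_derivative (\<lambda>x. h (\<theta> x)) (at ?x) v = 0"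
        then have "v \<bullet> (met (V, \<rho>) ?x *v v) = 0" using iso[of v v] by (simp add: dd_def)
        then show "v = 0" using metric(3)[OF c' xV, of v] by auto
      qed
      ultimately show ?thesis by (simp add: fe)
    qed
    then show ?thesis using sm by (simp add: fe)
  qed
  have "O' \<subseteq> carrier_of A" using O(2) chart(4)[OF c] by blast
  then show ?thesis
    unfolding conformal_immersion_with_factor_def immersion_on_def smooth_map_on_def
    using main O(1) smooth_on_const[of 1] by (auto simp: o_def)
qed

end

text \<open>The inverse \<open>inv_into V (\<lambda>x. x)\<close> of the single chart is known to be
  the identity only on \<open>V\<close>; openness of \<open>V\<close> lets derivatives be compared
  there.\<close>

lemma conformal_immersion_euclidean:
  fixes h :: "real^'h::finite \<Rightarrow> real^'m::finite"
  assumes V: "open V" and h: "smooth_on h V" "smooth_on lam V" "\<And>z. z \<in> V \<Longrightarrow> lam z > 0"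
    and conf: "\<And>z a b. z \<in> V \<Longrightarrow> dd a h z \<bullet> dd b h z = (lam z)\<^sup>2 * (a \<bullet> b)"
  shows "conformal_immersion (euclidean_atlas V) flat_metric V h"
proof -
  let ?i = "inv_into V (\<lambda>x. x)"
  have i: "?i x = x" if "x \<in> V" for x using inv_into_f_f[of "\<lambda>x. x" V x] that by simp
  have sm: "smooth_on (q \<circ> ?i) V" if "smooth_on q V" for q :: "real^'h \<Rightarrow> 'z::real_normed_vector"
    using smooth_on_cong[OF V, of "q \<circ> ?i" q] that i by simp
  have d: "dd a (h \<circ> ?i) x = dd a h x" if "x \<in> V" for a x
    by (rule dd_cong_open[OF V that]) (simp add: i)
  have pt: "inj (frechet_derivative (h \<circ> ?i) (at x)) \<and>
     induced_metric h (V, \<lambda>x. x) x = (lam x)\<^sup>2 *\<^sub>R flat_metric (V, \<lambda>x. x) x" if x: "x \<in> V" for x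
  proof -
    have dh: "(h \<circ> ?i) differentiable (at x)" by (rule smooth_on_differentiable[OF sm[OF h(1)] x])
    have "inj (frechet_derivative (h \<circ> ?i) (at x))"
    proof (rule linear_injective_0[OF linear_frechet_derivative[OF dh], THEN iffD2], intro allI impI)
      fix v assume "frechet_derivative (h \<circ> ?i) (at x) v = 0"
      then have "dd v h x = 0" using d[OF x, of v] by (simp add: dd_def)
      then have "(lam x)\<^sup>2 * (v \<bullet> v) = 0" using conf[OF x, of v v] by simp
      then show "v = 0" using h(3)[OF x] by simp
    qed
    moreover have "transpose (jacobian (h \<circ> ?i) (at x)) ** jacobian (h \<circ> ?i) (at x) = (lam x)\<^sup>2 *\<^sub>R mat 1"
      by (rule matrix_eq_inner) (simp add: inner_gram jacobian_apply[OF dh] d[OF x] conf[OF x] scaleR_matrix_vector_assoc[symmetric])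
    ultimately show ?thesis by (simp add: induced_metric_def flat_metric_def Let_def)
  qed
  show ?thesis
    unfolding conformal_immersion_def conformal_immersion_with_factor_def immersion_on_def smooth_map_on_def
      euclidean_atlas_def carrier_of_def
    by (rule exI[of _ lam]) (use V h(3) pt sm[OF h(1)] sm[OF h(2)] in simp)
qed

text \<open>The members of the family are open, connected and disjoint, so each component of their
  union is one of them and \<open>P\<close> holds for it without any change of set. Density is
  maximality: a good set outside the closure could be added.\<close>

lemma disjoint_open_refinement:
  fixes C :: "'a::topological_space set"
  assumes C: "open C" and dense: "\<And>\<Omega>. open \<Omega> \<Longrightarrow> \<Omega> \<noteq> {} \<Longrightarrow> \<Omega> \<subseteq> C \<Longrightarrow>
      \<exists>O'. open O' \<and> connected O' \<and> O' \<noteq> {} \<and> O' \<subseteq> \<Omega> \<and> P O'"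
  shows "\<exists>M0. open M0 \<and> M0 \<subseteq> C \<and> C \<subseteq> closure M0 \<and> (\<forall>N\<in>components M0. P N)"
proof -
  define good where "good = {O'. open O' \<and> connected O' \<and> O' \<noteq> {} \<and> O' \<subseteq> C \<and> P O'}"
  define Fam where "Fam = {M. M \<subseteq> good \<and> (\<forall>X\<in>M. \<forall>Y\<in>M. X \<noteq> Y \<longrightarrow> X \<inter> Y = {})}"
  have "\<exists>M\<in>Fam. \<forall>X\<in>Fam. M \<subseteq> X \<longrightarrow> X = M"
  proof (rule subset_Zorn')
    fix \<C> assume ch: "subset.chain Fam \<C>"
    then have sub: "\<C> \<subseteq> Fam" and lin: "\<And>X Y. X \<in> \<C> \<Longrightarrow> Y \<in> \<C> \<Longrightarrow> X \<subseteq> Y \<or> Y \<subseteq> X"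
      by (auto simp: subset_chain_def)
    have "X \<inter> Y = {}" if XY: "X \<in> \<Union>\<C>" "Y \<in> \<Union>\<C>" "X \<noteq> Y" for X Y
    proof -
      obtain S T where ST: "S \<in> \<C>" "T \<in> \<C>" "X \<in> S" "Y \<in> T" using XY by blast
      then obtain R where R: "R \<in> \<C>" "X \<in> R" "Y \<in> R" using lin[of S T] by blast
      then have "R \<in> Fam" using sub by blast
      then show ?thesis using R(2,3) XY(3) unfolding Fam_def by blast
    qed
    then show "\<Union>\<C> \<in> Fam" using sub by (auto simp: Fam_def)
  qed
  then obtain M where M: "M \<in> Fam" "\<And>X. X \<in> Fam \<Longrightarrow> M \<subseteq> X \<Longrightarrow> X = M" by blast
  have good: "open X" "connected X" "X \<noteq> {}" "X \<subseteq> C" "P X" if "X \<in> M" for X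
    using M(1) that by (auto simp: Fam_def good_def)
  have disj: "X \<inter> Y = {}" if "X \<in> M" "Y \<in> M" "X \<noteq> Y" for X Y using M(1) that by (auto simp: Fam_def)
  define M0 where "M0 = \<Union>M"
  have o: "open M0" unfolding M0_def using good(1) by blast
  have dn: "C \<subseteq> closure M0"
  proof (rule ccontr)
    assume "\<not> ?thesis"
    then have "C - closure M0 \<noteq> {}" by blast
    moreover have "open (C - closure M0)" using C by (intro open_Diff) auto
    ultimately obtain O' where O': "open O'" "connected O'" "O' \<noteq> {}" "O' \<subseteq> C - closure M0" "P O'"
      using dense[of "C - closure M0"] by auto
    have dO: "O' \<inter> X = {}" if "X \<in> M" for X
      using O'(4) that closure_subset[of M0] by (auto simp: M0_def)
    have "insert O' M \<in> Fam"
      using M(1) O' dO by (auto simp: Fam_def good_def)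
    then have "O' \<in> M" using M(2)[of "insert O' M"] by blast
    then show False using dO[of O'] O'(3) by blast
  qed
  have "P N" if N: "N \<in> components M0" for N
  proof -
    obtain p where p: "p \<in> N" using in_components_nonempty[OF N] by blast
    then obtain X where X: "X \<in> M" "p \<in> X" using in_components_subset[OF N] by (auto simp: M0_def)
    have "X \<subseteq> N"
      by (rule components_maximal[OF N good(2)[OF X(1)]]) (use X p in \<open>auto simp: M0_def\<close>)
    moreover have "N \<subseteq> X"
    proof -
      let ?R = "\<Union>(M - {X})"
      have "X \<inter> N = {} \<or> ?R \<inter> N = {}"
      proof (rule connectedD[OF in_components_connected[OF N] good(1)[OF X(1)]])
        show "open ?R" using good(1) by blast
        show "X \<inter> ?R \<inter> N = {}" using disj[OF X(1)] by blast
        show "N \<subseteq> X \<union> ?R" using in_components_subset[OF N] by (auto simp: M0_def)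
      qed
      then have "?R \<inter> N = {}" using X p by blast
      then show ?thesis using in_components_subset[OF N] unfolding M0_def by blast
    qed
    ultimately show ?thesis using good(5)[OF X(1)] by simp
  qed
  then show ?thesis using o dn good(4) by (intro exI[of _ M0]) (auto simp: M0_def)
qed

theorem theorem2:
  fixes n :: nat
    and A :: "('a::{t2_space, second_countable_topology}, 'd::finite) chart set"
    and met J :: "('a, 'd) tensor2"
    and f :: "'a \<Rightarrow> real^'m::finite"
  assumes "n \<ge> 5"
    and "CARD('d) = 2 * n"
    and "CARD('h::finite) = 2 * n + 1"
    and "CARD('m) = 2 * n + 2"
    and "kaehler_manifold A met J"
    and "connected (carrier_of A)"
    and "\<forall>p\<in>carrier_of A. \<not> flat_point A met p"
    and "conformal_immersion A met (carrier_of A) f"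
  shows "\<exists>M0. open M0 \<and> M0 \<subseteq> carrier_of A \<and> carrier_of A \<subseteq> closure M0 \<and>
    (\<forall>N\<in>components M0.
       (\<exists>g :: 'a \<Rightarrow> real^'m.
          real_kaehler_submanifold A met J N g \<and> conformally_congruent_on N f g) \<or>
       (\<exists>(g :: 'a \<Rightarrow> real^'h) (V :: (real^'h) set) (h :: real^'h \<Rightarrow> real^'m).
          real_kaehler_hypersurface A met J N g \<and> open V \<and> g ` N \<subseteq> V \<and>
          conformal_immersion (euclidean_atlas V) flat_metric V h \<and>
          (\<forall>p\<in>N. f p = h (g p))))"
proof (rule disjoint_open_refinement)
  interpret manifold_data A met J by unfold_locales (rule assms(5))
  show "open (carrier_of A)" using chart(1) unfolding carrier_of_def by auto
  obtain lam where "conformal_immersion_with_factor A met (carrier_of A) lam f"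
    using assms(8) unfolding conformal_immersion_def by blast
  then have sf: "\<And>U \<phi>. (U, \<phi>) \<in> A \<Longrightarrow> smooth_on (f \<circ> inv_into U \<phi>) (\<phi> ` (U \<inter> carrier_of A))"
    and sl: "\<And>U \<phi>. (U, \<phi>) \<in> A \<Longrightarrow> smooth_on (lam \<circ> inv_into U \<phi>) (\<phi> ` (U \<inter> carrier_of A))"
    and lpos: "\<And>p. p \<in> carrier_of A \<Longrightarrow> lam p > 0"
    and ind: "\<And>U \<phi> p. (U, \<phi>) \<in> A \<Longrightarrow> p \<in> U \<inter> carrier_of A \<Longrightarrow>
        induced_metric f (U, \<phi>) (\<phi> p) = (lam p)\<^sup>2 *\<^sub>R met (U, \<phi>) (\<phi> p)"
    unfolding conformal_immersion_with_factor_def immersion_on_def smooth_map_on_def by auto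
  fix \<Omega> :: "'a set" assume \<Omega>: "open \<Omega>" "\<Omega> \<noteq> {}" "\<Omega> \<subseteq> carrier_of A"
  then obtain p where p: "p \<in> \<Omega>" by blast
  then have "\<not> flat_point A met p" using assms(7) \<Omega>(3) by blast
  then obtain U \<phi> l i j k where c: "(U, \<phi>) \<in> A" "p \<in> U" and R: "curvature (met (U, \<phi>)) l i j k (\<phi> p) \<noteq> 0"
    unfolding flat_point_def by blast
  note UC = chart(4)[OF c(1)]
  have UCU: "U \<inter> carrier_of A = U" using UC by blast
  \<comment> \<open>One fixed component of the curvature, nonzero at \<open>p\<close>, cuts out an
    open set of the chart without flat points.\<close>
  define W where "W = \<phi> ` (U \<inter> \<Omega>) \<inter> curvature (met (U, \<phi>)) l i j k -` (- {0})"
  have sub: "\<phi> ` (U \<inter> \<Omega>) \<subseteq> \<phi> ` U" by blast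
  have sR: "smooth_on (curvature (met (U, \<phi>)) l i j k) (\<phi> ` U)"
    by (rule smooth_on_curvature[OF chart(2)[OF c(1)] metric(1)[OF c(1)] det_positive_definite]) (rule metric(3)[OF c(1)])
  have W: "open W" unfolding W_def
    by (rule continuous_open_preimage[OF continuous_on_subset[OF smooth_on_continuous[OF sR] sub] chart_image_open[OF c(1) \<Omega>(1)]])
      (rule open_Compl[OF closed_singleton])
  have Wne: "W \<noteq> {}" using c(2) p R by (auto simp: W_def)
  have WU: "W \<subseteq> \<phi> ` U" by (auto simp: W_def)
  let ?i = "inv_into U \<phi>"
  let ?f = "\<lambda>x. f (?i x)" and ?l = "\<lambda>x. lam (?i x)"
  have i: "\<phi> (?i x) = x" "?i x \<in> U" if "x \<in> \<phi> ` U" for x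
    using chart(3)[OF c(1)] that by (auto simp: homeomorphism_def)
  have sf': "smooth_on ?f W" "smooth_on ?l W"
    using smooth_on_subset[OF sf[OF c(1)], of W] smooth_on_subset[OF sl[OF c(1)], of W] WU by (auto simp: UCU o_def)
  have lpos': "?l x > 0" if "x \<in> W" for x using lpos i(2)[of x] that WU UC by blast
  have conf: "dd v ?f x \<bullet> dd w ?f x = (?l x)\<^sup>2 * (v \<bullet> (met (U, \<phi>) x *v w))" if x: "x \<in> W" for x v w
  proof -
    have xU: "x \<in> \<phi> ` U" using x WU by blast
    have df: "(f \<circ> ?i) differentiable (at x)"
      using smooth_on_differentiable[OF sf'(1) x] by (simp add: o_def)
    have "induced_metric f (U, \<phi>) (\<phi> (?i x)) = (?l x)\<^sup>2 *\<^sub>R met (U, \<phi>) (\<phi> (?i x))"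
      by (rule ind[OF c(1)]) (use i(2)[OF xU] UC in blast)
    then have "transpose (jacobian (f \<circ> ?i) (at x)) ** jacobian (f \<circ> ?i) (at x) = (?l x)\<^sup>2 *\<^sub>R met (U, \<phi>) x"
      by (simp add: i(1)[OF xU] induced_metric_def Let_def)
    then have "v \<bullet> (((?l x)\<^sup>2 *\<^sub>R met (U, \<phi>) x) *v w) = dd v (f \<circ> ?i) x \<bullet> dd w (f \<circ> ?i) x"
      using inner_gram[of v "jacobian (f \<circ> ?i) (at x)" w] by (simp add: jacobian_apply[OF df])
    then show ?thesis by (simp add: scaleR_matrix_vector_assoc[symmetric] o_def)
  qed
  have nf: "\<exists>l i j k. curvature (met (U, \<phi>)) l i j k x \<noteq> 0" if "x \<in> W" for x using that by (auto simp: W_def)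
  have d: "CARD('m) = CARD('d) + 2" "CARD('d) \<ge> 10" "CARD('h) = CARD('d) + 1" using assms(1-4) by auto
  let ?P = "\<lambda>N. (\<exists>g :: 'a \<Rightarrow> real^'m.
          real_kaehler_submanifold A met J N g \<and> conformally_congruent_on N f g) \<or>
       (\<exists>(g :: 'a \<Rightarrow> real^'h) (V :: (real^'h) set) (h :: real^'h \<Rightarrow> real^'m).
          real_kaehler_hypersurface A met J N g \<and> open V \<and> g ` N \<subseteq> V \<and>
          conformal_immersion (euclidean_atlas V) flat_metric V h \<and>
          (\<forall>p\<in>N. f p = h (g p)))"
  \<comment> \<open>The set \<open>B\<close> of \<open>local_alternative\<close> lies in the chart
    image and need not be connected; the preimage of a ball in \<open>B\<close> is connected, and
    both alternatives restrict to it.\<close>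
  have ball: "\<exists>O'. open O' \<and> connected O' \<and> O' \<noteq> {} \<and> O' \<subseteq> \<Omega> \<and> O' \<subseteq> U \<and> \<phi> ` O' \<subseteq> B"
    if B: "open B" "B \<noteq> {}" "B \<subseteq> W" for B
  proof -
    obtain b where b: "b \<in> B" using B by blast
    then obtain r where r: "r > 0" "ball b r \<subseteq> B" using B(1) open_contains_ball by blast
    have bU: "ball b r \<subseteq> \<phi> ` U" using r B(3) WU by blast
    have ci: "continuous_on (\<phi> ` U) ?i" and cp: "continuous_on U \<phi>" using chart(3)[OF c(1)] by (auto simp: homeomorphism_def)
    have e: "?i ` ball b r = U \<inter> \<phi> -` ball b r"
    proof (intro equalityI subsetI)
      fix q assume "q \<in> ?i ` ball b r"
      then obtain x where x: "x \<in> ball b r" "q = ?i x" by blast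
      then obtain q' where q': "q' \<in> U" "x = \<phi> q'" using bU by blast
      then show "q \<in> U \<inter> \<phi> -` ball b r" using x chart_inv[OF c(1) q'(1)] by simp
    next
      fix q assume q: "q \<in> U \<inter> \<phi> -` ball b r"
      then have "q = ?i (\<phi> q)" using chart_inv[OF c(1)] by simp
      then show "q \<in> ?i ` ball b r" using q by blast
    qed
    have "open (?i ` ball b r)" unfolding e
      by (rule continuous_open_preimage[OF cp chart(1)[OF c(1)] open_ball])
    moreover have "connected (?i ` ball b r)"
      by (rule connected_continuous_image[OF continuous_on_subset[OF ci bU] connected_ball])
    moreover have "?i ` ball b r \<subseteq> \<Omega>"
    proof
      fix q assume "q \<in> ?i ` ball b r"
      then obtain x where x: "x \<in> ball b r" "q = ?i x" by blast
      then have "x \<in> \<phi> ` (U \<inter> \<Omega>)" using r B(3) by (auto simp: W_def)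
      then show "q \<in> \<Omega>" using chart_inv[OF c(1)] x(2) by auto
    qed
    moreover have "\<phi> ` (?i ` ball b r) \<subseteq> B" using r(2) e by auto
    ultimately show ?thesis using r(1) e by (intro exI[of _ "?i ` ball b r"]) auto
  qed
  have gW: "smooth_on (met (U, \<phi>)) W" "smooth_on (J (U, \<phi>)) W"
    using smooth_on_subset[OF metric(1)[OF c(1)] WU] smooth_on_subset[OF complex_structure(1)[OF c(1)] WU] by auto
  show "\<exists>O'. open O' \<and> connected O' \<and> O' \<noteq> {} \<and> O' \<subseteq> \<Omega> \<and> ?P O'"
  proof (rule local_alternative[where W = W and g = "met (U, \<phi>)" and Jc = "J (U, \<phi>)" and f = ?f and lam = ?l
        and 'h = 'h, OF W Wne gW(1) _ _ gW(2) _ _ _ sf' lpos' conf d nf])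
    show "transpose (met (U, \<phi>) x) = met (U, \<phi>) x" if "x \<in> W" for x using metric(2)[OF c(1)] that WU by blast
    show "v \<bullet> (met (U, \<phi>) x *v v) > 0" if "x \<in> W" "v \<noteq> 0" for x v using metric(3)[OF c(1)] that WU by blast
    show "J (U, \<phi>) x ** J (U, \<phi>) x = - mat 1" if "x \<in> W" for x using complex_structure(2)[OF c(1)] that WU by blast
    show "transpose (J (U, \<phi>) x) ** met (U, \<phi>) x ** J (U, \<phi>) x = met (U, \<phi>) x" if "x \<in> W" for x
      using complex_structure(3)[OF c(1)] that WU by blast
    show "covariant_deriv_endo (met (U, \<phi>)) (J (U, \<phi>)) k i j x = 0" if "x \<in> W" for x k i j
      using complex_structure(4)[OF c(1)] that WU by blast
  next
    fix B \<tau> and h :: "real^'d \<Rightarrow> real^'m"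
    assume B: "open B" "B \<noteq> {}" "B \<subseteq> W" and h: "smooth_on h B"
      "\<And>x v w. x \<in> B \<Longrightarrow> dd v h x \<bullet> dd w h x = v \<bullet> (met (U, \<phi>) x *v w)"
      and \<tau>: "moebius \<tau>" "\<And>x. x \<in> B \<Longrightarrow> \<tau> (Some (?f x)) = Some (h x)"
    obtain O' where O': "open O'" "connected O'" "O' \<noteq> {}" "O' \<subseteq> \<Omega>" "O' \<subseteq> U" "\<phi> ` O' \<subseteq> B" using ball[OF B] by blast
    have "conformal_immersion_with_factor A met O' (\<lambda>p. 1) (h \<circ> \<phi>)"
      by (rule isometric_from_chart[OF c(1) O'(1,5) smooth_on_subset[OF h(1) O'(6)]]) (use h(2) O'(6) in blast)
    moreover have "conformally_congruent_on O' f (h \<circ> \<phi>)"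
      unfolding conformally_congruent_on_def
    proof (intro exI[of _ \<tau>] conjI ballI \<tau>(1))
      fix q assume q: "q \<in> O'"
      then have "\<phi> q \<in> B" "?i (\<phi> q) = q" using O'(5,6) chart_inv[OF c(1)] by auto
      then show "\<tau> (Some (f q)) = Some ((h \<circ> \<phi>) q)" using \<tau>(2)[of "\<phi> q"] by simp
    qed
    ultimately have "?P O'" using assms(5) by (auto simp: real_kaehler_submanifold_def)
    then show ?thesis using O' by blast
  next
    fix B V lamh and gh :: "real^'d \<Rightarrow> real^'h" and h :: "real^'h \<Rightarrow> real^'m"
    assume B: "open B" "B \<noteq> {}" "B \<subseteq> W" and g: "smooth_on gh B"
      "\<And>x v w. x \<in> B \<Longrightarrow> dd v gh x \<bullet> dd w gh x = v \<bullet> (met (U, \<phi>) x *v w)"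
      and V: "open V" "gh ` B \<subseteq> V" and h: "smooth_on h V" "smooth_on lamh V" "\<And>z. z \<in> V \<Longrightarrow> lamh z > 0"
      "\<And>z a b. z \<in> V \<Longrightarrow> dd a h z \<bullet> dd b h z = (lamh z)\<^sup>2 * (a \<bullet> b)" "\<And>x. x \<in> B \<Longrightarrow> h (gh x) = ?f x"
    obtain O' where O': "open O'" "connected O'" "O' \<noteq> {}" "O' \<subseteq> \<Omega>" "O' \<subseteq> U" "\<phi> ` O' \<subseteq> B" using ball[OF B] by blast
    have "conformal_immersion_with_factor A met O' (\<lambda>p. 1) (gh \<circ> \<phi>)"
      by (rule isometric_from_chart[OF c(1) O'(1,5) smooth_on_subset[OF g(1) O'(6)]]) (use g(2) O'(6) in blast)
    then have "real_kaehler_hypersurface A met J O' (gh \<circ> \<phi>)"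
      using assms(5,7) d O'(4) \<Omega>(3) by (auto simp: real_kaehler_hypersurface_def real_kaehler_submanifold_def)
    moreover have "conformal_immersion (euclidean_atlas V) flat_metric V h"
      by (rule conformal_immersion_euclidean[OF V(1) h(1-4)])
    moreover have "(gh \<circ> \<phi>) ` O' \<subseteq> V" using O'(6) V(2) by (auto simp: image_subset_iff)
    moreover have "\<forall>q\<in>O'. f q = h ((gh \<circ> \<phi>) q)"
    proof
      fix q assume q: "q \<in> O'"
      then have "\<phi> q \<in> B" "?i (\<phi> q) = q" using O'(5,6) chart_inv[OF c(1)] by auto
      then show "f q = h ((gh \<circ> \<phi>) q)" using h(5)[of "\<phi> q"] by simp
    qed
    ultimately have "?P O'" using V(1) by blast
    then show ?thesis using O' by blast
  qed
qed

end
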